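(* Let $p\geq 2$ and let $G$ be a finite simple $\{pK_2, \mathrm{butterfly}\}$-free graph. Then $\chi(G)\leq f_p(\omega(G))$, where $f_p:\mathbb{N}\to\mathbb{N}$ ($p\geq2$) is defined by: $f_t(1)=1$ for $t\geq2$; $f_2(2)=3$; $f_2(3)=4$; $f_2(s)=\binom{s+1}{2}$ for $s\geq 4$; $f_p(2)=2p-2$ for $p\geq 3$; and $f_p(m)=f_{p-1}(m)+\binom{m+1}{2}-1$ for $m,p\geq 3$.
   Context: $\chi(G)$ is the chromatic number and $\omega(G)$ the clique number of $G$. $pK_2$ is the disjoint union of $p$ edges. The butterfly is the graph on five vertices consisting of two triangles sharing exactly one vertex. A graph is $\mathcal{F}$-free if it has no induced subgraph isomorphic to a member of $\mathcal{F}$. *)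

theory Defs
  imports "Graph_Theory.Pair_Digraph" "Graph_Theory.Digraph_Component"
    "Graph_Theory.Digraph_Isomorphism"
begin

text \<open>
  Finite simple graphs are rendered by the locale \<open>pair_graph\<close>: finite vertex set, and a
  loop-free symmetric set of arcs, an edge \<open>uv\<close> being the pair of arcs \<open>(u, v)\<close>, \<open>(v, u)\<close>.
\<close>

definition free_of :: "'b pair_pre_digraph set \<Rightarrow> 'a pair_pre_digraph \<Rightarrow> bool" where
  "free_of \<F> G \<longleftrightarrow>
    \<not> (\<exists>F\<in>\<F>. \<exists>H. induced_subgraph H (with_proj G) \<and> digraph_iso H (with_proj F))"

definition matching_graph :: "nat \<Rightarrow> nat pair_pre_digraph" where
  "matching_graph p = \<lparr> pverts = {..<2 * p},
     parcs = (\<Union>i<p. {(2 * i, 2 * i + 1), (2 * i + 1, 2 * i)}) \<rparr>"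

definition butterfly :: "nat pair_pre_digraph" where
  "butterfly = (let E = {(0, 1), (0, 2), (1, 2), (0, 3), (0, 4), (3, 4)}
     in \<lparr> pverts = {0, 1, 2, 3, 4}, parcs = E \<union> E\<inverse> \<rparr>)"

definition clique :: "'a pair_pre_digraph \<Rightarrow> 'a set \<Rightarrow> bool" where
  "clique G K \<longleftrightarrow> K \<subseteq> pverts G \<and> pairwise (\<lambda>u v. (u, v) \<in> parcs G) K"

definition clique_number :: "'a pair_pre_digraph \<Rightarrow> nat" where
  "clique_number G = Max {card K | K. clique G K}"

definition proper_coloring :: "'a pair_pre_digraph \<Rightarrow> nat \<Rightarrow> ('a \<Rightarrow> nat) \<Rightarrow> bool" where
  "proper_coloring G k c \<longleftrightarrow>
    c ` pverts G \<subseteq> {..<k} \<and> (\<forall>(u, v)\<in>parcs G. c u \<noteq> c v)"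

definition chromatic_number :: "'a pair_pre_digraph \<Rightarrow> nat" where
  "chromatic_number G = (LEAST k. \<exists>c. proper_coloring G k c)"

text \<open>
  The function is specified for \<open>p \<ge> 2\<close> and \<open>m \<ge> 1\<close> only; all other values are arbitrary.
  The value \<open>0\<close> at \<open>m = 0\<close> makes the bound hold for the graph without vertices, the only one
  of clique number \<open>0\<close>.
\<close>

fun chi_bound :: "nat \<Rightarrow> nat \<Rightarrow> nat" where
  "chi_bound p m =
    (if m = 0 then 0
     else if m = 1 then 1
     else if p \<le> 2 then (if m = 2 then 3 else if m = 3 then 4 else (m + 1) choose 2)
     else if m = 2 then 2 * p - 2
     else chi_bound (p - 1) m + ((m + 1) choose 2) - 1)"

declare chi_bound.simps [simp del]

lemma chi_bound_clauses:
  "t \<ge> 2 \<Longrightarrow> chi_bound t 1 = 1"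
  "chi_bound 2 2 = 3"
  "chi_bound 2 3 = 4"
  "s \<ge> 4 \<Longrightarrow> chi_bound 2 s = (s + 1) choose 2"
  "p \<ge> 3 \<Longrightarrow> chi_bound p 2 = 2 * p - 2"
  "m \<ge> 3 \<Longrightarrow> p \<ge> 3 \<Longrightarrow> chi_bound p m = chi_bound (p - 1) m + ((m + 1) choose 2) - 1"
  by (subst chi_bound.simps; simp)+

lemma pair_graph_matching_graph: "pair_graph (matching_graph p)"
  by unfold_locales (auto simp: matching_graph_def arcs_ends_def symmetric_def sym_def arc_to_ends_def)

lemma pair_graph_butterfly: "pair_graph butterfly"
  by unfold_locales (auto simp: butterfly_def Let_def symmetric_def sym_def)

end

theory Submission
  imports Defs
begin

text \<open>
  Let \<open>v\<^sub>0, \<dots>, v\<^sub>m\<^sub>-\<^sub>1\<close> be a maximum clique and colour every vertex by the first two clique vertices that it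
  misses. In a butterfly-free graph this is proper on \<open>N(v\<^sub>0) \<union> N(v\<^sub>1)\<close>, where the pair \<open>(0, 1)\<close> does not occur,
  and the remaining vertices induce a \<open>(p - 1)K\<^sub>2\<close>-free graph; this is the recursion for \<open>p \<ge> 3\<close>.
  If \<open>p = 2\<close>, the colouring is proper on the whole graph (Wagon's bound).
  Two cases remain: \<open>(2K\<^sub>2, K\<^sub>4)\<close>-free graphs and \<open>(3K\<^sub>2, K\<^sub>3)\<close>-free graphs are 4-colourable.

  For these, consider a minimal counterexample and small graphs \<open>J\<close> which it cannot contain as induced
  subgraphs. Given a copy of \<open>J\<close>, every vertex has a type, its adjacency to the copy. If the types which do not
  create a pattern excluded earlier can be coloured such that two adjacent vertices of equal colour always
  create an excluded pattern, then \<open>J\<close> is excluded as well. Another reason is that one vertex of \<open>J\<close> is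
  dominated by another one, which cannot happen in a critical graph. A finite list of such steps almost
  suffices. The \<open>(2K\<^sub>2, K\<^sub>4)\<close>-free case requires in addition an extremal argument, since a
  pentagon may be surrounded by a circular structure of unbounded size. In the \<open>(3K\<^sub>2, K\<^sub>3)\<close>-free case, the
  nonneighbours of an edge induce a \<open>2K\<^sub>2\<close>-free and triangle-free graph that is not bipartite, so that each of its
  edges lies on a pentagon.
\<close>

section \<open>Colourability\<close>

text \<open>The colouring by missed clique vertices has \<open>(m + 1) choose 2\<close> colours, and
  around the edge \<open>v\<^sub>0v\<^sub>1\<close> one of them is saved; this is the
  \<open>- 1\<close> of the recursion. For m = 2 a recursion step costs 3 - 1 = 2 colours, the slope
  of 2p - 2, but started from \<open>f\<^sub>2(2) = 3\<close> it would give 5 for p = 3. For p = 2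
  and m = 3 Wagon's bound gives 6. At both places the claimed value is 4; every other value is
  obtained by counting alone. The exclusion of a small graph is a case analysis too large for proof
  text. A critical graph has unbounded size, but only finitely many vertex types occur relative to a
  fixed copy, so the analysis can be stored as a certificate: a decision tree for the type of a
  vertex and, for each pair of types of equal colour, an embedding of an excluded pattern. Nothing
  depends on how the certificates were found. Executable checkers are proved sound once and then
  evaluated on them.\<close>

definition colorable :: "('a \<Rightarrow> 'a \<Rightarrow> bool) \<Rightarrow> 'a set \<Rightarrow> nat \<Rightarrow> bool" where
  "colorable E V k \<longleftrightarrow> (\<exists>c. c ` V \<subseteq> {..<k} \<and> (\<forall>u\<in>V. \<forall>v\<in>V. E u v \<longrightarrow> c u \<noteq> c v))"

lemma colorableI:
  assumes "finite C" "card C \<le> k" "c ` V \<subseteq> C" "\<And>u v. u \<in> V \<Longrightarrow> v \<in> V \<Longrightarrow> E u v \<Longrightarrow> c u \<noteq> c v"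
  shows "colorable E V k"
proof -
  obtain f where f: "bij_betw f C {..<card C}"
    using assms(1) finite_same_card_bij[of C "{..<card C}"] by auto
  show ?thesis unfolding colorable_def
  proof (intro exI[of _ "f \<circ> c"] conjI ballI impI)
    have "f ` c ` V \<subseteq> f ` C" by (rule image_mono[OF assms(3)])
    then show "(f \<circ> c) ` V \<subseteq> {..<k}"
      using f assms(2) by (auto simp: bij_betw_def image_comp)
    show "(f \<circ> c) u \<noteq> (f \<circ> c) v" if "u \<in> V" "v \<in> V" "E u v" for u v
      using assms(3,4) that f by (auto simp: bij_betw_def dest!: inj_onD)
  qed
qed

lemma colorable_mono: "colorable E V k \<Longrightarrow> k \<le> l \<Longrightarrow> colorable E V l"
  unfolding colorable_def by (meson lessThan_subset_iff order_trans)

lemma colorable_subset: "colorable E V k \<Longrightarrow> W \<subseteq> V \<Longrightarrow> colorable E W k"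
  unfolding colorable_def by (meson image_mono order_trans subsetD)

lemma colorable_Un:
  assumes "colorable E U a" "colorable E W b"
  shows "colorable E (U \<union> W) (a + b)"
proof -
  obtain c d where c: "c ` U \<subseteq> {..<a}" "\<forall>u\<in>U. \<forall>v\<in>U. E u v \<longrightarrow> c u \<noteq> c v"
    and d: "d ` W \<subseteq> {..<b}" "\<forall>u\<in>W. \<forall>v\<in>W. E u v \<longrightarrow> d u \<noteq> d v"
    using assms unfolding colorable_def by auto
  show ?thesis unfolding colorable_def
  proof (intro exI[of _ "\<lambda>v. if v \<in> U then c v else a + d v"] conjI ballI impI)
    show "(\<lambda>v. if v \<in> U then c v else a + d v) ` (U \<union> W) \<subseteq> {..<a + b}"
    proof (rule image_subsetI)
      fix v assume "v \<in> U \<union> W"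
      then have "v \<in> U \<Longrightarrow> c v < a" "v \<notin> U \<Longrightarrow> d v < b" using c(1) d(1) by auto
      then show "(if v \<in> U then c v else a + d v) \<in> {..<a + b}" by auto
    qed
    fix u v assume "u \<in> U \<union> W" "v \<in> U \<union> W" and e: "E u v"
    moreover have "\<And>x. x \<in> U \<Longrightarrow> c x < a" using c(1) by auto
    ultimately show "(if u \<in> U then c u else a + d u) \<noteq> (if v \<in> U then c v else a + d v)"
      using c(2) d(2) by (auto) (metis not_add_less1)+
  qed
qed

section \<open>Induced copies of small graphs\<close>

text \<open>A total lookup: a wrong index in a certificate makes the check fail, whereas
  \<open>!\<close> out of range would be an unspecified value.\<close>

fun nth_opt :: "'a list \<Rightarrow> nat \<Rightarrow> 'a option" where
  "nth_opt [] n = None"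
| "nth_opt (x # xs) 0 = Some x"
| "nth_opt (x # xs) (Suc n) = nth_opt xs n"

lemma nth_opt_eq: "nth_opt xs n = (if n < length xs then Some (xs ! n) else None)"
  by (induction xs n rule: nth_opt.induct) auto

text \<open>
  A graph on the vertices \<open>0, \<dots>, n - 1\<close> is the list of its rows, row \<open>i\<close> being the adjacency of \<open>i\<close>
  to \<open>0, \<dots>, i - 1\<close>. Rows may be truncated, in which case the missing adjacencies are unknown.
\<close>

type_synonym rows = "bool list list"

definition rows_of :: "nat list list \<Rightarrow> rows" where
  "rows_of ns = map (\<lambda>(i, js). map (\<lambda>j. j \<in> set js) [0..<i]) (zip [0..<length ns] ns)"

text \<open>\<open>None\<close> stands for the diagonal, for the missing part of a truncated row and
  for indices out of range. As row \<open>i\<close> has length at most \<open>i\<close>, at most one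
  of the two lookups succeeds.\<close>

definition edge_at :: "rows \<Rightarrow> nat \<Rightarrow> nat \<Rightarrow> bool option" where
  "edge_at G i j =
    (case nth_opt G j of None \<Rightarrow> None
     | Some r \<Rightarrow> (case nth_opt r i of Some b \<Rightarrow> Some b
        | None \<Rightarrow> (case nth_opt G i of None \<Rightarrow> None | Some r' \<Rightarrow> nth_opt r' j)))"

text \<open>The test on the empty lists is what places the first vertex of an embedding inside the
  host, since that vertex has no adjacency to be looked up.\<close>

fun matches :: "rows \<Rightarrow> nat \<Rightarrow> nat list \<Rightarrow> bool list \<Rightarrow> bool" where
  "matches G i [] [] = (nth_opt G i \<noteq> None)"
| "matches G i (d # ds) (b # bs) = (if edge_at G i d = Some b then matches G i ds bs else False)"
| "matches G i _ _ = False"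

fun embeds :: "rows \<Rightarrow> nat list \<Rightarrow> nat list \<Rightarrow> rows \<Rightarrow> bool" where
  "embeds G ds [] [] = True"
| "embeds G ds (i # is) (q # Q) = (if matches G i ds q then embeds G (ds @ [i]) is Q else False)"
| "embeds G ds _ _ = False"

definition refutes :: "rows list \<Rightarrow> rows \<Rightarrow> nat \<Rightarrow> nat list \<Rightarrow> bool" where
  "refutes P G k is = (case nth_opt P k of None \<Rightarrow> False | Some Q \<Rightarrow> embeds G [] is Q)"

text \<open>
  A tree decides the type of an additional vertex bit by bit: \<open>N\<close> branches on the adjacency to the next vertex,
  \<open>X k is\<close> refutes a partial type by an embedding \<open>is\<close> of the \<open>k\<close>-th excluded pattern, and \<open>L\<close> labels a full type.
  Adjacencies which are required in advance are skipped.
\<close>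

datatype 'b tree = L 'b | X nat "nat list" | N "'b tree" "'b tree"

text \<open>The partial type \<open>t\<close> is appended to \<open>J\<close> as a truncated row, so
  a refutation can use only the adjacencies decided so far and disposes of all completions of
  \<open>t\<close> at once.\<close>

fun closed_tree :: "rows list \<Rightarrow> rows \<Rightarrow> bool list \<Rightarrow> bool option list \<Rightarrow> 'b tree \<Rightarrow> bool" where
  "closed_tree P J t (Some b # rs) T = closed_tree P J (t @ [b]) rs T"
| "closed_tree P J t rs (X k is) = refutes P (J @ [t]) k is"
| "closed_tree P J t (None # rs) (N l r) =
    (if closed_tree P J (t @ [False]) rs l then closed_tree P J (t @ [True]) rs r else False)"
| "closed_tree P J t [] (L c) = True"
| "closed_tree P J t _ _ = False"

text \<open>The labels are colours or block numbers, and in the pentagon certificates again trees: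
  each surviving type of one vertex carries the tree for the next vertex.\<close>

fun leaves :: "bool list \<Rightarrow> bool option list \<Rightarrow> 'b tree \<Rightarrow> (bool list \<times> 'b) list" where
  "leaves t (Some b # rs) T = leaves (t @ [b]) rs T"
| "leaves t (None # rs) (N l r) = leaves (t @ [False]) rs l @ leaves (t @ [True]) rs r"
| "leaves t [] (L c) = [(t, c)]"
| "leaves t _ _ = []"

section \<open>Soundness of embeddings and trees\<close>

locale sym_graph =
  fixes E :: "'a \<Rightarrow> 'a \<Rightarrow> bool" and V :: "'a set"
  assumes sym: "E u v \<Longrightarrow> E v u" and irrefl: "\<not> E v v"
begin

lemma comm: "E u v = E v u"
  using sym by blast

text \<open>Unlike \<open>copy\<close>, this admits truncated rows, as they occur when a vertex of
  partially known type is added to a copy.\<close>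

definition agrees :: "'a list \<Rightarrow> rows \<Rightarrow> bool" where
  "agrees xs G \<longleftrightarrow> length xs = length G \<and> set xs \<subseteq> V \<and>
     (\<forall>i<length G. length (G ! i) \<le> i \<and> (\<forall>j<length (G ! i). G ! i ! j = E (xs ! i) (xs ! j)))"

text \<open>
  The vertices of a copy need not be distinct: two of them may coincide if they have the same neighbours
  in the pattern. Patterns without such twins have injective copies only.
\<close>

definition copy :: "'a list \<Rightarrow> rows \<Rightarrow> bool" where
  "copy xs G \<longleftrightarrow> length xs = length G \<and> set xs \<subseteq> V \<and>
     (\<forall>i<length G. G ! i = map (E (xs ! i)) (take i xs))"

definition avoids :: "rows list \<Rightarrow> bool" where
  "avoids P \<longleftrightarrow> (\<forall>Q\<in>set P. \<forall>xs. \<not> copy xs Q)"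

lemma copy_imp_agrees: "copy xs G \<Longrightarrow> agrees xs G"
  unfolding copy_def agrees_def by auto

lemma copy_Nil [simp]: "copy [] G \<longleftrightarrow> G = []" "copy xs [] \<longleftrightarrow> xs = []"
  by (auto simp: copy_def)

lemma copy_snoc: "copy (xs @ [v]) (G @ [t]) \<longleftrightarrow> copy xs G \<and> v \<in> V \<and> t = map (E v) xs"
  unfolding copy_def by (auto simp: nth_append less_Suc_eq)

lemma agrees_snoc:
  assumes "agrees xs G" "v \<in> V" "t = take k (map (E v) xs)"
  shows "agrees (xs @ [v]) (G @ [t])"
  using assms unfolding agrees_def by (auto simp: nth_append less_Suc_eq)

lemma edge_at_sound:
  assumes "agrees xs G" "edge_at G i j = Some b"
  shows "i < length xs" "j < length xs" "E (xs ! i) (xs ! j) = b"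
  using assms unfolding agrees_def edge_at_def
  by (auto simp: nth_opt_eq comm split: option.splits if_splits)

lemma matches_sound:
  "agrees xs G \<Longrightarrow> matches G i ds q \<Longrightarrow> i < length xs \<and> q = map (\<lambda>d. E (xs ! i) (xs ! d)) ds"
proof (induction G i ds q rule: matches.induct)
  case (1 G i)
  then show ?case by (auto simp: nth_opt_eq agrees_def split: if_splits)
qed (auto dest: edge_at_sound(3) split: if_splits)

text \<open>\<open>ds\<close> are the images placed so far and \<open>R\<close> the rows they
  realise. With both empty, an accepted embedding is a copy of the pattern \<open>Q\<close>
  itself.\<close>

lemma embeds_sound:
  "agrees xs G \<Longrightarrow> embeds G ds is Q \<Longrightarrow> copy (map ((!) xs) ds) R \<Longrightarrow>
    copy (map ((!) xs) (ds @ is)) (R @ Q)"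
proof (induction G ds "is" Q arbitrary: R rule: embeds.induct)
  case (2 G ds i "is" q Q)
  then have m: "matches G i ds q" and e: "embeds G (ds @ [i]) is Q" by (auto split: if_splits)
  have "i < length xs" "q = map (E (xs ! i)) (map ((!) xs) ds)"
    using matches_sound[OF 2(2) m] by auto
  then have "copy (map ((!) xs) (ds @ [i])) (R @ [q])"
    using 2(2,4) by (auto simp: copy_snoc agrees_def)
  from 2(1)[OF m 2(2) e this] show ?case by simp
qed auto

lemma refutes_sound: "avoids P \<Longrightarrow> agrees xs G \<Longrightarrow> \<not> refutes P G k is"
  using embeds_sound[of xs G "[]" "is" "P ! k" "[]"] nth_mem[of k P]
  unfolding refutes_def avoids_def by (fastforce simp: nth_opt_eq split: option.splits if_splits)

lemma refutes_prefix:
  assumes "avoids P" "copy xs J" "v \<in> V" "map (E v) xs = t @ s"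
  shows "\<not> refutes P (J @ [t]) k is"
  using refutes_sound[OF assms(1) agrees_snoc[OF copy_imp_agrees[OF assms(2)] assms(3), of t "length t"]] assms(4)
  by simp

text \<open>The actual type of \<open>v\<close> determines a path down the tree. It cannot end in a
  refutation, because a refuted prefix would yield an excluded copy, so it ends at a label. Here
  \<open>t\<close> is the part of the type already read and \<open>s\<close> the rest.\<close>

lemma closed_tree_sound:
  "avoids P \<Longrightarrow> copy xs J \<Longrightarrow> v \<in> V \<Longrightarrow> closed_tree P J t rs T \<Longrightarrow> map (E v) xs = t @ s \<Longrightarrow>
    list_all2 (\<lambda>r b. r = None \<or> r = Some b) rs s \<Longrightarrow>
    \<exists>c. (map (E v) xs, c) \<in> set (leaves t rs T)"
proof (induction P J t rs T arbitrary: s rule: closed_tree.induct)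
  case (3 P J t rs l r)
  then obtain b s' where s: "s = b # s'" "list_all2 (\<lambda>r b. r = None \<or> r = Some b) rs s'"
    by (auto simp: list_all2_Cons1)
  show ?case
  proof (cases b)
    case True
    then show ?thesis using 3(2)[OF _ 3(3-5), of s'] 3(6,7) s by (auto split: if_splits)
  next
    case False
    then show ?thesis using 3(1)[OF 3(3-5), of s'] 3(6,7) s by (auto split: if_splits)
  qed
qed (use refutes_prefix in \<open>auto simp: list_all2_Cons1\<close>)

lemma closed_tree_free_sound:
  assumes "avoids P" "copy xs J" "v \<in> V" "closed_tree P J [] (replicate (length J) None) T"
  shows "\<exists>c. (map (E v) xs, c) \<in> set (leaves [] (replicate (length J) None) T)"
  using assms(2) by (intro closed_tree_sound[OF assms, of "map (E v) xs"])
    (auto simp: list_all2_conv_all_nth copy_def)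

text \<open>The final bit \<open>b\<close> is the adjacency of \<open>v\<close> to \<open>u\<close>.
  With \<open>True\<close>, vertices of the two types are shown nonadjacent, as colour classes
  require; with \<open>False\<close>, adjacency is forced.\<close>

lemma refutes_pair:
  assumes "avoids P" "copy xs J" "u \<in> V" "v \<in> V"
    and "refutes P (J @ [map (E u) xs, map (E v) xs @ [b]]) k is"
  shows "E v u \<noteq> b"
proof
  assume "E v u = b"
  then have "agrees (xs @ [u] @ [v]) (J @ [map (E u) xs] @ [map (E v) xs @ [b]])"
    using assms agrees_snoc[OF agrees_snoc[OF copy_imp_agrees[OF assms(2)] assms(3), where k = "length xs"] assms(4),
      where k = "Suc (length xs)"]
    by simp
  then show False using refutes_sound[OF assms(1)] assms(5) by auto
qed

end

text \<open>Each type is also paired with itself, because distinct vertices of equal type share a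
  colour. Of the two orders of a pair only one is listed.\<close>

fun same_pairs :: "(bool list \<times> nat) list \<Rightarrow> (bool list \<times> bool list) list" where
  "same_pairs [] = []"
| "same_pairs ((t, c) # ls) =
    map (\<lambda>(s, d). (t, s)) (filter (\<lambda>(s, d). d = c) ((t, c) # ls)) @ same_pairs ls"

lemma same_pairs_complete:
  "(s, c) \<in> set ls \<Longrightarrow> (t, c) \<in> set ls \<Longrightarrow> (s, t) \<in> set (same_pairs ls) \<or> (t, s) \<in> set (same_pairs ls)"
  by (induction ls rule: same_pairs.induct) force+

fun all_refuted :: "rows list \<Rightarrow> rows \<Rightarrow> bool \<Rightarrow> (bool list \<times> bool list) list \<Rightarrow> (nat \<times> nat list) list \<Rightarrow> bool"
  where
  "all_refuted P J b [] [] = True"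
| "all_refuted P J b ((s, t) # ps) ((k, is) # ws) =
    (if refutes P (J @ [s, t @ [b]]) k is then all_refuted P J b ps ws else False)"
| "all_refuted P J b _ _ = False"

lemma all_refutedD:
  "all_refuted P J b ps ws \<Longrightarrow> (s, t) \<in> set ps \<Longrightarrow> \<exists>k is. refutes P (J @ [s, t @ [b]]) k is"
  by (induction P J b ps ws rule: all_refuted.induct) (auto split: if_splits)

text \<open>
  \<open>Comp a b m T\<close> refutes all vertices adjacent to \<open>a\<close> and not to \<open>b\<close>; the vertex \<open>m\<close> shows that \<open>a\<close> and \<open>b\<close> differ.
\<close>

datatype step = Colour "nat tree" "(nat \<times> nat list) list" | Comp nat nat nat "nat tree"

definition requirements :: "nat \<Rightarrow> nat list \<Rightarrow> nat list \<Rightarrow> bool option list" where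
  "requirements n ts fs =
    map (\<lambda>i. if i \<in> set ts then Some True else if i \<in> set fs then Some False else None) [0..<n]"

lemma (in sym_graph) requirements_sound:
  assumes "avoids P" "copy xs J" "v \<in> V" "closed_tree P J [] (requirements (length J) ts fs) T"
    and "\<And>i. i \<in> set ts \<Longrightarrow> E v (xs ! i)" "\<And>i. i \<in> set fs \<Longrightarrow> \<not> E v (xs ! i)"
  shows "\<exists>c. (map (E v) xs, c) \<in> set (leaves [] (requirements (length J) ts fs) T)"
  using assms(2,5,6)
  by (intro closed_tree_sound[OF assms(1-4), of "map (E v) xs"])
    (auto simp: list_all2_conv_all_nth requirements_def copy_def)

fun step_ok :: "nat \<Rightarrow> rows list \<Rightarrow> rows \<Rightarrow> step \<Rightarrow> bool" where
  "step_ok k P J (Colour T ws) =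
    (let rs = replicate (length J) None; ls = leaves [] rs T in
     closed_tree P J [] rs T \<and> list_all (\<lambda>(t, c). c < k) ls \<and> all_refuted P J True (same_pairs ls) ws)"
| "step_ok k P J (Comp a b m T) =
    (edge_at J b m = Some True \<and> edge_at J a m = Some False \<and>
     closed_tree P J [] (requirements (length J) [a] [b]) T \<and> leaves [] (requirements (length J) [a] [b]) T = [])"

text \<open>An excluded pattern is appended at the end, so the pattern numbers in a certificate
  count the base patterns first and then the earlier steps.\<close>

fun steps_ok :: "nat \<Rightarrow> rows list \<Rightarrow> (nat list list \<times> step) list \<Rightarrow> bool" where
  "steps_ok k P [] = True"
| "steps_ok k P ((ns, s) # ss) =
    (if step_ok k P (rows_of ns) s then steps_ok k (P @ [rows_of ns]) ss else False)"

section \<open>Exclusion steps in critical graphs\<close>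

locale critical_graph = sym_graph +
  fixes k :: nat
  assumes finite: "finite V" and not_colorable: "\<not> colorable E V k"
    and critical: "W \<subset> V \<Longrightarrow> colorable E W k"
begin

lemma colour_step:
  assumes "avoids P" "step_ok k P J (Colour T ws)"
  shows "\<not> copy xs J"
proof
  assume c: "copy xs J"
  define rs :: "bool option list" where "rs = replicate (length J) None"
  define ls where "ls = leaves [] rs T"
  have T: "closed_tree P J [] rs T" "list_all (\<lambda>(t, c). c < k) ls" "all_refuted P J True (same_pairs ls) ws"
    using assms(2) unfolding rs_def ls_def by (auto simp: Let_def)
  define col where "col v = (SOME c. (map (E v) xs, c) \<in> set ls)" for v
  have col: "(map (E v) xs, col v) \<in> set ls" if "v \<in> V" for v
    unfolding col_def
    by (rule someI_ex) (use closed_tree_free_sound[OF assms(1) c that] T(1) in \<open>auto simp: rs_def ls_def\<close>)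
  have "col u \<noteq> col v" if uv: "u \<in> V" "v \<in> V" "E u v" for u v
  proof
    assume "col u = col v"
    then consider "(map (E u) xs, map (E v) xs) \<in> set (same_pairs ls)"
      | "(map (E v) xs, map (E u) xs) \<in> set (same_pairs ls)"
      using same_pairs_complete[OF col[OF uv(1)], of "map (E v) xs"] col[OF uv(2)] by auto
    then show False
      using all_refutedD[OF T(3)] refutes_pair[OF assms(1) c] uv sym by cases metis+
  qed
  moreover have "col ` V \<subseteq> {..<k}" using col T(2) by (fastforce simp: list_all_iff)
  ultimately show False using not_colorable unfolding colorable_def by blast
qed

text \<open>No vertex of a critical graph is dominated by another one, whose colour it could take.\<close>

lemma comp_step:
  assumes "avoids P" "step_ok k P J (Comp a b m T)"
  shows "\<not> copy xs J"
proof
  assume c: "copy xs J"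
  define x y where "x = xs ! a" and "y = xs ! b"
  have e: "edge_at J b m = Some True" "edge_at J a m = Some False"
    and T: "closed_tree P J [] (requirements (length J) [a] [b]) T" "leaves [] (requirements (length J) [a] [b]) T = []"
    using assms(2) by auto
  note ed = edge_at_sound[OF copy_imp_agrees[OF c] e(1)] edge_at_sound[OF copy_imp_agrees[OF c] e(2)]
  have xy: "x \<noteq> y" "x \<in> V" "y \<in> V"
    using ed c unfolding x_def y_def copy_def by auto
  have dom: "E v y" if "v \<in> V" "E v x" for v
  proof (rule ccontr)
    assume "\<not> E v y"
    then show False
      using requirements_sound[OF assms(1) c that(1) T(1)] T(2) that(2) by (auto simp: x_def y_def)
  qed
  \<comment> \<open>If \<open>x\<close> and \<open>y\<close> were adjacent, \<open>y\<close> would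
    be a neighbour of \<open>x\<close> and by domination a neighbour of itself.\<close>
  have "\<not> E x y" using dom[OF xy(3)] irrefl sym by blast
  obtain d where d: "d ` (V - {x}) \<subseteq> {..<k}" "\<forall>u\<in>V - {x}. \<forall>v\<in>V - {x}. E u v \<longrightarrow> d u \<noteq> d v"
    using critical[of "V - {x}"] xy unfolding colorable_def by auto
  have "colorable E V k" unfolding colorable_def
  proof (intro exI[of _ "d(x := d y)"] conjI ballI impI)
    show "(d(x := d y)) ` V \<subseteq> {..<k}" using d(1) xy by auto
    fix u v assume "u \<in> V" "v \<in> V" "E u v"
    then show "(d(x := d y)) u \<noteq> (d(x := d y)) v"
      using d(2) dom irrefl sym xy \<open>\<not> E x y\<close> by (auto simp: comm)
  qed
  then show False using not_colorable by simp
qed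

lemma steps_ok_sound:
  "avoids P \<Longrightarrow> steps_ok k P ss \<Longrightarrow> avoids (P @ map (rows_of \<circ> fst) ss)"
proof (induction ss arbitrary: P)
  case (Cons a ss)
  obtain ns s where a: "a = (ns, s)" by (cases a)
  have s: "step_ok k P (rows_of ns) s" and ss: "steps_ok k (P @ [rows_of ns]) ss"
    using Cons.prems(2) by (auto simp: a split: if_splits)
  have "\<not> copy xs (rows_of ns)" for xs
    using s colour_step[OF Cons.prems(1)] comp_step[OF Cons.prems(1)] by (cases s) blast+
  then have "avoids (P @ [rows_of ns])"
    using Cons.prems(1) unfolding avoids_def by auto
  from Cons.IH[OF this ss] show ?case by (simp add: a)
qed simp

end

lemma ex_critical:
  assumes "finite V" "\<not> colorable E V k" "\<And>u v. E u v \<Longrightarrow> E v u" "\<And>v. \<not> E v v"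
  obtains W where "W \<subseteq> V" "critical_graph E W k"
proof -
  obtain W where W: "W \<subseteq> V" "\<not> colorable E W k"
    and least: "\<And>U. U \<subseteq> V \<Longrightarrow> \<not> colorable E U k \<Longrightarrow> card W \<le> card U"
    using ex_has_least_nat[of "\<lambda>W. W \<subseteq> V \<and> \<not> colorable E W k" V card] assms(2) by auto
  have "colorable E U k" if "U \<subset> W" for U
    using least[of U] psubset_card_mono[OF finite_subset[OF W(1) assms(1)] that] W(1) that by fastforce
  with W assms(1,3,4) that show thesis
    by (simp add: critical_graph_def sym_graph_def critical_graph_axioms_def finite_subset)
qed

text \<open>\<open>c\<close> is an attempt at a 2-colouring: N(a) receives 0, N(b) receives 1, and a
  vertex outside both receives 1 exactly if it has a neighbour in N(a). It must fail on some edge,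
  and the failure exhibits the pentagon a, b, v, z, u.\<close>

lemma (in sym_graph) pentagon_through_edge:
  assumes "\<not> colorable E M 2" "a \<in> M" "b \<in> M" "E a b"
    and tri: "\<And>x y z. x \<in> M \<Longrightarrow> y \<in> M \<Longrightarrow> z \<in> M \<Longrightarrow> E x y \<Longrightarrow> E x z \<Longrightarrow> \<not> E y z"
    and dom: "\<And>x y. x \<in> M \<Longrightarrow> y \<in> M \<Longrightarrow> E x y \<Longrightarrow> E x a \<or> E x b \<or> E y a \<or> E y b"
  obtains u v z where "u \<in> M" "v \<in> M" "z \<in> M" "E u a" "\<not> E u b" "E v b" "\<not> E v a" "\<not> E v u"
    "E z u" "E z v" "\<not> E z a" "\<not> E z b"
proof -
  define Q where "Q z \<longleftrightarrow> E z b \<or> (\<not> E z a \<and> (\<exists>u\<in>M. E u a \<and> E z u))" for z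
  define c :: "'a \<Rightarrow> nat" where "c z = (if Q z then 1 else 0)" for z
  have "c ` M \<subseteq> {..<2}" by (auto simp: c_def)
  then have "\<exists>u\<in>M. \<exists>v\<in>M. E u v \<and> c u = c v"
    using assms(1) unfolding colorable_def by blast
  then obtain x y where xy: "x \<in> M" "y \<in> M" "E x y" "Q x = Q y"
    by (auto simp: c_def split: if_splits)
  have nab: "\<not> (E w a \<and> E w b)" if "w \<in> M" for w
    using tri[OF that assms(2,3)] assms(4) by blast
  have nadj: "\<not> (E x w \<and> E y w)" if "w \<in> M" for w
    using tri[OF xy(1,2) that] xy(3) sym by blast
  \<comment> \<open>By \<open>dom\<close> the edge meets N(a) or N(b). If both ends have colour 1,
    one of them is a vertex \<open>v\<close> of N(b), and the other is a vertex \<open>z\<close>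
    outside N(a) and N(b) whose neighbour in N(a) serves as \<open>u\<close>. If both had colour 0,
    one end would lie in N(a), which gives the other end colour 1.\<close>
  have *: "\<exists>u\<in>M. \<exists>v\<in>M. \<exists>z\<in>M. E u a \<and> E v b \<and> E z u \<and> E z v \<and> \<not> E z a \<and> \<not> E z b"
  proof (cases "Q x")
    case True
    then have "Q y" using xy(4) by simp
    have "E x b \<or> E y b" using dom[OF xy(1-3)] True \<open>Q y\<close> unfolding Q_def by blast
    moreover have "\<not> (E x b \<and> E y b)" using nadj[OF assms(3)] by simp
    ultimately show ?thesis using True \<open>Q y\<close> xy(1-3) sym unfolding Q_def by metis
  next
    case False
    then have "E x a \<or> E y a" using dom[OF xy(1-3)] xy(4) unfolding Q_def by blast
    then show ?thesis using False xy sym nadj[OF assms(2)] unfolding Q_def by metis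
  qed
  then obtain u v z where "u \<in> M" "v \<in> M" "z \<in> M" "E u a" "E v b" "E z u" "E z v" "\<not> E z a" "\<not> E z b"
    by blast
  moreover from this have "\<not> E v u" using tri sym by metis
  ultimately show thesis using that nab by metis
qed

section \<open>Graphs without 2K2 and K4\<close>

definition K4_2K2 :: "rows list" where
  "K4_2K2 = [rows_of [[],[0],[],[2]], rows_of [[],[0],[0,1],[0,1,2]]]"

definition C5 :: rows where
  "C5 = rows_of [[],[0],[1],[2],[0,3]]"

text \<open>
  The last three patterns are a pentagon together with a vertex that is adjacent to all, to four, and to none of
  its vertices. The lists of steps were found by computer search.
\<close>

definition steps_C5 :: "(nat list list \<times> step) list" where
  "steps_C5 = [
   ([[],[],[],[1,2],[2,3],[0,3,4],[1,2,3,5],[0,1,2,3,5],[0,1,2,4,6,7]], Comp 1 2 4 (N (N (N (X 0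
     [1,9,2,4]) (N (X 0 [0,5,1,9]) (N (N (X 0 [0,7,4,9]) (N (X 0 [2,8,5,9]) (X 1 [1,7,8,9]))) (N (X 0
     [0,7,4,9]) (N (X 0 [2,8,5,9]) (X 1 [1,6,8,9])))))) (N (X 0 [1,9,2,4]) (N (X 0 [0,5,1,9]) (X 1
     [3,4,5,9])))) (N (X 0 [0,9,2,3]) (N (X 0 [0,9,2,4]) (N (N (X 0 [0,9,2,6]) (X 1 [1,3,6,9])) (X 1
     [3,4,5,9])))))),
   ([[],[],[0],[1,2],[0,2,3],[0,1,4],[3,4,5],[0,1,3,4],[0,1,2,3,5,6]], Colour (N (N (N (N (N (N (N
     (N (N (L 0) (X 0 [4,7,8,9])) (X 0 [5,6,7,9])) (X 0 [0,2,6,9])) (X 0 [2,3,5,9])) (N (N (N (N (X 0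
     [1,8,4,9]) (L 0)) (X 0 [5,6,7,9])) (X 0 [0,2,6,9])) (X 0 [2,3,5,9]))) (N (N (X 0 [0,5,3,9]) (N
     (N (N (L 1) (X 0 [4,7,8,9])) (N (X 0 [2,8,7,9]) (L 3))) (X 0 [0,2,6,9]))) (N (X 0 [0,5,3,9]) (N
     (N (N (X 0 [1,8,4,9]) (L 1)) (X 1 [3,4,7,9])) (X 0 [0,2,6,9]))))) (N (N (N (X 0 [1,5,2,9]) (N (N
     (X 0 [1,7,2,9]) (N (X 0 [6,8,7,9]) (L 3))) (N (X 0 [0,7,6,9]) (N (L 3) (X 1 [5,6,8,9]))))) (N (X
     0 [1,5,2,9]) (N (N (X 0 [1,7,2,9]) (N (X 0 [1,8,4,9]) (L 3))) (X 1 [4,5,6,9])))) (N (N (X 0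
     [0,5,3,9]) (N (N (X 0 [1,7,2,9]) (N (X 0 [6,8,7,9]) (X 1 [2,3,8,9]))) (N (X 0 [0,7,6,9]) (N (L
     3) (X 1 [2,3,8,9]))))) (X 1 [2,3,4,9])))) (N (X 0 [0,2,1,9]) (N (N (X 0 [0,4,1,9]) (N (N (X 0
     [2,9,5,6]) (N (X 0 [0,7,6,9]) (N (X 0 [5,8,7,9]) (L 0)))) (N (N (X 0 [3,7,5,9]) (N (X 0
     [6,8,7,9]) (X 1 [1,5,8,9]))) (X 1 [4,5,6,9])))) (N (X 0 [0,4,1,9]) (X 1 [2,3,4,9]))))) (N (N (N
     (X 0 [0,9,1,3]) (N (N (N (N (N (L 1) (X 0 [4,7,8,9])) (X 0 [5,6,7,9])) (N (X 0 [1,7,6,9]) (N (X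
     0 [2,8,7,9]) (X 1 [3,6,8,9])))) (N (N (N (L 1) (X 0 [4,7,8,9])) (N (X 0 [2,8,7,9]) (X 1
     [0,5,8,9]))) (N (X 0 [1,7,6,9]) (N (X 0 [2,8,7,9]) (X 1 [0,5,8,9]))))) (N (N (N (N (X 0
     [1,8,4,9]) (L 1)) (X 0 [5,6,7,9])) (X 1 [3,4,6,9])) (X 1 [0,4,5,9])))) (N (X 0 [0,9,1,3]) (N (N
     (X 0 [1,5,2,9]) (N (N (X 0 [1,7,2,9]) (N (X 0 [6,8,7,9]) (X 1 [0,2,8,9]))) (N (X 0 [1,7,2,9]) (N
     (L 2) (X 1 [0,2,8,9]))))) (X 1 [0,2,4,9])))) (N (N (N (X 0 [1,9,2,4]) (N (N (X 0 [0,9,3,6]) (N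
     (N (L 0) (L 0)) (X 1 [0,4,7,9]))) (X 0 [2,3,5,9]))) (N (X 0 [1,9,2,4]) (N (N (N (N (L 1) (X 1
     [1,3,8,9])) (X 0 [5,6,7,9])) (X 1 [3,4,6,9])) (X 1 [0,4,5,9])))) (N (N (N (N (X 0 [0,9,3,6]) (N
     (N (L 2) (X 0 [4,7,8,9])) (N (X 0 [5,8,7,9]) (X 1 [0,2,8,9])))) (N (X 0 [0,9,3,6]) (N (X 0
     [3,7,5,9]) (N (L 2) (X 1 [0,2,8,9]))))) (X 1 [0,2,4,9])) (N (N (N (X 0 [1,9,4,6]) (N (N (L 2) (X
     0 [4,7,8,9])) (X 1 [1,3,7,9]))) (N (X 0 [1,9,4,6]) (N (N (L 2) (X 0 [4,7,8,9])) (X 1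
     [1,3,7,9])))) (X 1 [0,2,4,9]))))))
     [(0,[0,2,9,10]),(0,[0,2,9,10]),(0,[0,5,9,10]),(0,[2,3,9,10]),(0,[2,3,9,10]),(0,[0,2,9,10]),(0,[0,5,9,10]),(0,[2,3,9,10]),(0,[2,3,9,10]),(0,[0,2,9,10]),(0,[0,2,9,10]),(0,[1,7,9,10]),(0,[1,7,9,10]),(0,[1,7,9,10]),(0,[2,8,9,10]),(0,[0,2,9,10]),(0,[0,4,9,10]),(0,[0,4,9,10]),(1,[5,8,9,10]),(0,[0,4,9,10]),(0,[0,2,9,10]),(0,[1,7,9,10]),(0,[1,7,9,10]),(0,[1,7,9,10]),(1,[3,4,9,10]),(0,[0,4,9,10]),(0,[0,4,9,10]),(0,[1,3,9,10]),(0,[0,4,9,10]),(0,[0,4,9,10]),(0,[1,3,9,10]),(0,[0,4,9,10]),(0,[1,3,9,10]),(2,[1,0,9,2,10,3,4,8,5]),(0,[0,4,9,10]),(0,[0,5,9,10]),(1,[4,6,9,10]),(1,[1,8,9,10]),(0,[1,5,9,10]),(0,[1,7,9,10]),(0,[1,5,9,10]),(0,[2,8,9,10]),(0,[1,7,9,10]),(0,[1,7,9,10]),(0,[2,8,9,10]),(0,[1,5,9,10]),(0,[5,6,9,10]),(0,[1,8,9,10]),(1,[0,2,9,10]),(1,[0,2,9,10]),(1,[0,2,9,10]),(1,[0,2,9,10]),(0,[2,3,9,10]),(0,[2,3,9,10]),(0,[2,3,9,10]),(0,[2,8,9,10]),(0,[3,4,9,10]),(0,[3,4,9,10]),(0,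[4,5,9,10]),(0,[4,7,9,10]),(0,[3,4,9,10]),(1,[0,2,9,10]),(1,[0,2,9,10]),(0,[4,5,9,10]),(0,[4,7,9,10]),(0,[4,7,9,10])]),
   ([[],[0],[],[0,1],[1],[0,2,3,4],[1,2,3,4,5],[0,1,2,4,5],[0,4,6]], Comp 2 4 1 (N (N (X 0
     [0,1,2,9]) (N (X 0 [0,3,2,9]) (N (N (N (X 0 [3,9,4,7]) (X 3 [3,2,0,7,1,6,4,9,5])) (X 1
     [1,3,6,9])) (N (N (X 0 [3,9,4,7]) (X 1 [2,5,7,9])) (X 1 [1,3,6,9]))))) (N (N (X 0 [1,3,2,9]) (X
     0 [1,4,2,9])) (N (N (N (X 0 [0,9,4,6]) (N (X 3 [0,2,3,6,1,7,4,9,5]) (X 1 [0,1,7,9]))) (N (X 0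
     [0,9,4,6]) (X 1 [2,5,6,9]))) (X 1 [0,1,3,9]))))),
   ([[],[],[0],[1,2],[0,1,2,3],[0,1],[1,2,3,5],[0,3,4,5,6],[0,1,4,6]], Colour (N (N (N (N (N (N (N
     (N (N (L 0) (X 0 [2,3,8,9])) (N (X 0 [1,8,7,9]) (X 0 [2,3,8,9]))) (X 0 [0,4,6,9])) (X 0
     [2,3,5,9])) (N (N (X 0 [4,9,5,6]) (N (N (L 0) (X 0 [2,3,8,9])) (N (X 0 [1,8,7,9]) (X 0
     [2,3,8,9])))) (X 0 [2,3,5,9]))) (N (N (X 0 [0,5,3,9]) (X 0 [2,4,5,9])) (N (X 0 [0,5,3,9]) (N (N
     (N (X 0 [0,8,3,9]) (L 0)) (X 1 [3,4,7,9])) (N (N (X 0 [0,8,3,9]) (L 0)) (X 1 [3,4,7,9])))))) (N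
     (N (N (X 0 [1,5,2,9]) (X 0 [3,4,5,9])) (N (X 0 [1,5,2,9]) (N (N (N (X 0 [1,8,2,9]) (X 0
     [3,7,8,9])) (N (X 0 [1,8,2,9]) (L 2))) (N (N (X 0 [1,8,2,9]) (X 0 [3,7,8,9])) (X 1
     [5,6,7,9]))))) (N (N (X 0 [0,5,3,9]) (N (N (N (X 0 [0,8,3,9]) (L 2)) (N (X 0 [0,8,3,9]) (L 2)))
     (X 0 [0,4,6,9]))) (X 1 [2,3,4,9])))) (N (X 0 [0,2,1,9]) (N (N (N (N (N (X 0 [0,7,1,9]) (N (L 2)
     (L 2))) (X 0 [0,4,6,9])) (X 0 [3,4,5,9])) (N (N (X 0 [4,9,5,6]) (N (X 0 [0,7,1,9]) (N (L 1) (X 1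
     [1,4,8,9])))) (N (N (X 0 [0,7,1,9]) (N (X 3 [5,8,9,4,7,6,3,0,1]) (X 1 [1,4,8,9]))) (X 1
     [1,5,6,9])))) (N (N (X 0 [0,5,3,9]) (N (N (X 0 [0,7,1,9]) (N (X 0 [0,8,3,9]) (L 2))) (X 0
     [0,4,6,9]))) (X 1 [1,3,4,9]))))) (N (N (N (X 0 [0,9,1,3]) (N (N (N (X 0 [0,9,1,6]) (N (N (L 3)
     (X 0 [5,7,8,9])) (X 1 [3,6,7,9]))) (X 0 [2,4,5,9])) (N (N (X 0 [0,9,1,6]) (N (N (L 0) (X 0
     [5,7,8,9])) (X 1 [0,4,7,9]))) (N (X 0 [0,9,1,6]) (N (N (L 0) (X 1 [0,4,8,9])) (X 1
     [0,4,7,9])))))) (N (X 0 [0,9,1,3]) (N (N (X 0 [1,5,2,9]) (N (X 0 [0,9,1,6]) (X 1 [2,3,6,9]))) (X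
     1 [0,2,4,9])))) (N (N (N (N (N (X 0 [0,9,3,6]) (N (N (L 1) (X 0 [2,3,8,9])) (N (L 1) (X 0
     [2,3,8,9])))) (X 0 [2,3,5,9])) (N (N (X 0 [0,9,3,6]) (N (N (L 1) (X 0 [2,3,8,9])) (X 1
     [0,4,7,9]))) (X 0 [2,3,5,9]))) (N (N (N (N (N (L 3) (X 0 [5,7,8,9])) (N (L 3) (X 4
     [1,9,2,8,7,4,0,3,5]))) (X 1 [1,3,6,9])) (X 0 [2,4,5,9])) (X 1 [1,3,4,9]))) (N (N (N (N (X 0
     [0,9,3,6]) (N (X 0 [2,9,5,7]) (N (L 1) (X 1 [1,6,8,9])))) (X 0 [3,4,5,9])) (X 1 [0,2,4,9])) (N
     (N (N (N (X 0 [2,9,5,7]) (N (L 3) (L 3))) (X 1 [1,3,6,9])) (N (N (N (X 0 [4,8,5,9]) (X 3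
     [1,7,8,0,9,3,2,5,4])) (X 1 [0,5,7,9])) (X 1 [1,3,6,9]))) (X 1 [0,2,4,9]))))))
     [(0,[0,2,9,10]),(0,[0,2,9,10]),(0,[0,2,9,10]),(0,[0,2,9,10]),(0,[1,5,9,10]),(0,[1,8,9,10]),(0,[0,2,9,10]),(0,[0,2,9,10]),(0,[0,2,9,10]),(0,[1,5,9,10]),(0,[1,8,9,10]),(0,[0,2,9,10]),(0,[0,2,9,10]),(1,[3,4,9,10]),(1,[3,4,9,10]),(0,[0,2,9,10]),(1,[3,4,9,10]),(1,[3,4,9,10]),(0,[1,3,9,10]),(0,[1,6,9,10]),(0,[1,6,9,10]),(0,[3,6,9,10]),(0,[3,6,9,10]),(1,[5,7,9,10]),(0,[0,4,9,10]),(0,[0,4,9,10]),(0,[0,4,9,10]),(0,[0,4,9,10]),(0,[0,4,9,10]),(0,[0,4,9,10]),(0,[0,4,9,10]),(0,[0,4,9,10]),(0,[0,4,9,10]),(0,[0,4,9,10]),(0,[0,4,9,10]),(0,[0,4,9,10]),(0,[0,4,9,10]),(0,[0,4,9,10]),(0,[0,5,9,10]),(1,[1,6,9,10]),(1,[1,6,9,10]),(1,[1,4,9,10]),(1,[1,6,9,10]),(0,[0,4,9,10]),(0,[1,4,9,10]),(0,[2,4,9,10]),(0,[2,4,9,10]),(0,[4,8,9,10]),(2,[5,4,10,3,9,6,2,7,0]),(0,[1,5,9,10]),(0,[1,8,9,10]),(0,[1,8,9,10]),(0,[2,3,9,10]),(0,[2,3,9,10]),(0,[2,3,9,10]),(0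,[3,4,9,10]),(0,[2,3,9,10]),(0,[2,3,9,10]),(0,[3,4,9,10]),(0,[2,3,9,10]),(1,[1,6,9,10]),(0,[2,4,9,10]),(0,[2,4,9,10]),(0,[4,8,9,10]),(0,[5,6,9,10]),(0,[2,4,9,10]),(0,[4,8,9,10]),(0,[5,6,9,10]),(0,[3,4,9,10]),(0,[4,8,9,10]),(0,[5,6,9,10]),(0,[5,6,9,10])]),
   ([[],[],[0,1],[0,1,2],[1],[0,3,4],[0,2,4,5],[0,1,2,4,5]], Colour (N (N (N (N (N (N (N (N (L 1)
     (L 1)) (X 0 [1,3,6,8])) (X 0 [1,2,5,8])) (X 0 [0,2,4,8])) (N (N (N (X 0 [3,8,4,6]) (N (X 0
     [1,7,6,8]) (L 1))) (X 0 [1,2,5,8])) (X 0 [0,2,4,8]))) (N (N (N (X 0 [2,8,4,5]) (N (N (L 1) (L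
     1)) (X 0 [1,3,6,8]))) (X 0 [0,3,4,8])) (N (N (X 0 [2,8,4,5]) (N (X 0 [3,8,4,6]) (N (X 0
     [1,7,6,8]) (L 1)))) (N (N (N (L 1) (L 1)) (N (X 0 [1,7,6,8]) (L 1))) (N (N (X 5
     [4,3,6,0,5,1,2,7,8]) (X 1 [4,5,7,8])) (X 1 [4,5,6,8])))))) (N (N (N (N (X 0 [0,5,1,8]) (N (X 0
     [0,6,1,8]) (N (L 2) (L 2)))) (X 0 [0,2,4,8])) (N (N (X 0 [0,5,1,8]) (N (X 0 [0,6,1,8]) (N (X 0
     [3,8,4,7]) (L 2)))) (X 0 [0,2,4,8]))) (N (N (N (X 0 [0,5,1,8]) (N (X 0 [0,6,1,8]) (N (X 5
     [1,6,3,0,2,4,5,7,8]) (X 1 [1,2,7,8])))) (X 0 [0,3,4,8])) (X 1 [1,2,3,8])))) (N (N (N (N (X 0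
     [0,8,1,4]) (X 0 [2,3,4,8])) (N (X 0 [0,8,1,4]) (N (N (N (L 3) (L 3)) (N (X 0 [1,7,6,8]) (L 3)))
     (X 0 [1,2,5,8])))) (N (N (X 0 [0,8,1,4]) (N (N (N (L 3) (X 1 [0,2,7,8])) (X 0 [1,3,6,8])) (N (N
     (L 0) (X 1 [0,2,7,8])) (X 0 [1,3,6,8])))) (X 1 [0,2,3,8]))) (N (N (N (N (N (X 0 [1,8,5,6]) (N (L
     2) (L 2))) (N (N (L 0) (X 1 [0,5,7,8])) (X 1 [0,5,6,8]))) (X 0 [2,3,4,8])) (N (N (N (X 0
     [1,8,5,6]) (N (X 0 [3,8,4,7]) (L 2))) (X 1 [0,3,5,8])) (N (N (X 0 [1,8,5,6]) (N (L 3) (X 1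
     [1,4,7,8]))) (X 1 [0,3,5,8])))) (N (N (N (X 0 [2,8,4,5]) (N (N (L 0) (X 1 [0,2,7,8])) (X 1
     [0,2,6,8]))) (N (N (X 0 [1,8,5,6]) (X 1 [0,2,6,8])) (N (N (L 0) (X 1 [0,2,7,8])) (X 1
     [0,2,6,8])))) (X 1 [0,2,3,8])))))
     [(0,[0,2,8,9]),(0,[0,2,8,9]),(0,[0,2,8,9]),(0,[0,3,8,9]),(0,[0,3,8,9]),(0,[1,4,8,9]),(0,[0,5,8,9]),(0,[0,5,8,9]),(0,[0,5,8,9]),(0,[0,2,8,9]),(0,[0,2,8,9]),(0,[0,3,8,9]),(0,[0,3,8,9]),(0,[1,4,8,9]),(0,[0,5,8,9]),(0,[0,5,8,9]),(0,[0,5,8,9]),(0,[0,2,8,9]),(0,[1,4,8,9]),(0,[1,4,8,9]),(0,[1,4,8,9]),(0,[0,5,8,9]),(0,[0,5,8,9]),(0,[0,5,8,9]),(0,[0,3,8,9]),(0,[0,3,8,9]),(0,[1,4,8,9]),(0,[0,6,8,9]),(0,[0,6,8,9]),(4,[5,6,1,0,9,7,2,4,8]),(0,[0,3,8,9]),(0,[1,4,8,9]),(0,[0,6,8,9]),(0,[0,6,8,9]),(1,[2,7,8,9]),(0,[1,4,8,9]),(1,[2,3,8,9]),(1,[2,3,8,9]),(1,[2,3,8,9]),(0,[0,5,8,9]),(0,[0,5,8,9]),(0,[0,5,8,9]),(0,[0,5,8,9]),(0,[0,5,8,9]),(0,[0,5,8,9]),(0,[0,2,8,9]),(0,[0,2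,8,9]),(0,[0,2,8,9]),(0,[2,3,8,9]),(0,[2,3,8,9]),(5,[1,5,2,0,7,8,6,9,4]),(0,[0,2,8,9]),(0,[0,2,8,9]),(0,[2,3,8,9]),(0,[2,3,8,9]),(1,[1,7,8,9]),(0,[0,2,8,9]),(4,[0,3,4,2,8,7,1,5,9]),(1,[1,7,8,9]),(1,[1,3,8,9]),(0,[1,2,8,9]),(0,[1,2,8,9]),(0,[1,2,8,9]),(0,[1,7,8,9]),(0,[2,7,8,9]),(0,[1,2,8,9]),(0,[1,2,8,9]),(0,[5,6,8,9]),(1,[0,3,8,9]),(0,[1,2,8,9]),(2,[1,5,8,0,9,2,6,7,4]),(1,[0,3,8,9]),(0,[1,3,8,9]),(0,[5,7,8,9]),(0,[1,3,8,9]),(1,[0,5,8,9]),(1,[0,2,8,9]),(1,[0,2,8,9]),(0,[2,3,8,9]),(0,[2,3,8,9]),(0,[4,5,8,9]),(0,[2,3,8,9]),(0,[4,5,8,9]),(0,[2,3,8,9]),(0,[4,6,8,9]),(1,[0,5,8,9]),(0,[4,5,8,9]),(0,[2,7,8,9]),(0,[4,6,8,9]),(1,[0,2,8,9]),(1,[0,2,8,9])]),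
   ([[],[],[0],[0,1],[0,2,3],[0,1,2,3],[1,2,4,5],[2,3,5]], Colour (N (N (N (N (N (N (N (N (L 0) (X
     0 [0,4,7,8])) (X 0 [0,3,6,8])) (N (N (L 0) (X 0 [0,4,7,8])) (X 0 [0,3,6,8]))) (N (X 0 [1,5,4,8])
     (N (N (L 0) (X 0 [1,6,7,8])) (X 0 [0,3,6,8])))) (N (N (N (X 0 [2,6,3,8]) (N (L 1) (X 0
     [0,4,7,8]))) (N (X 0 [2,6,3,8]) (N (L 3) (X 0 [0,4,7,8])))) (N (X 0 [1,5,4,8]) (N (X 0
     [2,6,3,8]) (N (L 2) (X 1 [3,5,7,8])))))) (N (X 0 [1,3,2,8]) (N (N (N (N (L 3) (X 0 [0,4,7,8]))
     (N (L 1) (X 0 [0,4,7,8]))) (N (N (L 3) (X 0 [0,4,7,8])) (X 1 [2,5,6,8]))) (N (X 0 [1,5,4,8]) (N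
     (N (L 3) (X 0 [1,6,7,8])) (X 1 [2,4,6,8])))))) (N (X 0 [0,2,1,8]) (N (N (X 0 [0,4,1,8]) (N (N (N
     (X 0 [4,8,5,7]) (L 0)) (X 0 [0,3,6,8])) (N (N (L 0) (X 1 [2,5,7,8])) (X 0 [0,3,6,8])))) (N (X 0
     [0,4,1,8]) (N (N (N (X 0 [4,8,5,7]) (X 3 [4,1,0,5,2,8,7,6,3])) (X 1 [2,4,6,8])) (X 1
     [1,3,5,8])))))) (N (N (N (N (N (N (X 0 [0,8,1,6]) (N (X 0 [3,7,6,8]) (L 2))) (N (X 0 [0,8,1,6])
     (N (X 0 [3,7,6,8]) (L 2)))) (N (X 0 [1,5,4,8]) (N (X 0 [0,8,1,6]) (N (X 0 [3,7,6,8]) (L 2)))))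
     (N (N (N (X 0 [0,8,1,6]) (N (L 1) (L 1))) (X 1 [0,3,5,8])) (X 1 [0,3,4,8]))) (N (X 0 [1,3,2,8])
     (N (N (N (X 0 [0,8,1,6]) (N (L 1) (X 2 [1,7,0,2,4,6,8,5,3]))) (X 1 [0,2,5,8])) (X 1
     [0,2,4,8])))) (N (N (N (X 0 [1,8,2,4]) (N (N (N (X 0 [1,8,2,7]) (L 0)) (N (X 0 [1,8,2,7]) (L
     2))) (N (N (X 0 [1,8,2,7]) (L 0)) (X 1 [1,5,6,8])))) (N (X 0 [1,8,2,4]) (X 1 [0,3,4,8]))) (N (N
     (N (N (N (L 0) (X 0 [4,6,7,8])) (X 6 [2,1,6,8,3,0,4,5])) (X 1 [0,2,5,8])) (X 1 [0,2,4,8])) (N (N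
     (N (X 6 [0,1,3,8,6,2,4,5]) (N (L 1) (L 1))) (X 1 [0,2,5,8])) (X 1 [0,2,4,8]))))))
     [(0,[0,2,8,9]),(0,[0,2,8,9]),(0,[0,2,8,9]),(0,[0,3,8,9]),(0,[0,3,8,9]),(0,[2,5,8,9]),(0,[2,6,8,9]),(0,[3,4,8,9]),(0,[0,2,8,9]),(0,[0,2,8,9]),(0,[0,3,8,9]),(0,[0,3,8,9]),(0,[2,6,8,9]),(0,[2,6,8,9]),(0,[3,4,8,9]),(0,[0,2,8,9]),(0,[0,3,8,9]),(0,[0,3,8,9]),(0,[2,6,8,9]),(0,[2,6,8,9]),(0,[3,7,8,9]),(0,[0,2,8,9]),(0,[0,4,8,9]),(0,[1,5,8,9]),(0,[1,5,8,9]),(0,[1,5,8,9]),(0,[5,7,8,9]),(2,[8,7,0,2,4,6,5,9,3]),(0,[0,2,8,9]),(0,[0,4,8,9]),(0,[0,4,8,9]),(1,[3,5,8,9]),(0,[0,2,8,9]),(4,[0,4,1,2,8,5,6,3,9]),(1,[5,6,8,9]),(1,[4,6,8,9]),(1,[4,6,8,9]),(0,[0,4,8,9]),(0,[0,4,8,9]),(0,[1,6,8,9]),(0,[0,4,8,9]),(0,[1,5,8,9]),(0,[1,5,8,9]),(0,[1,5,8,9]),(0,[5,7,8,9]),(1,[2,6,8,9]),(0,[0,4,8,9]),(0,[1,6,8,9]),(0,[1,6,8,9]),(0,[0,3,8,9]),(0,[0,3,8,9]),(0,[3,5,8,9]),(3,[4,1,0,5,2,8,7,6,9]),(0,[3,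5,8,9]),(0,[0,3,8,9]),(5,[1,0,6,2,5,9,4,8,3]),(1,[1,5,8,9]),(0,[3,7,8,9]),(0,[1,3,8,9]),(0,[1,3,8,9]),(0,[1,3,8,9]),(0,[2,5,8,9]),(0,[1,3,8,9]),(0,[1,3,8,9]),(3,[4,1,2,5,0,9,8,3,6]),(0,[1,3,8,9]),(1,[0,4,8,9]),(0,[1,5,8,9]),(0,[1,5,8,9]),(0,[1,5,8,9]),(0,[5,7,8,9]),(1,[0,3,8,9]),(0,[1,5,8,9]),(0,[1,5,8,9]),(1,[0,3,8,9]),(1,[0,3,8,9]),(0,[1,5,8,9]),(0,[5,7,8,9]),(1,[0,2,8,9]),(0,[2,5,8,9]),(0,[2,6,8,9]),(0,[3,5,8,9]),(0,[2,5,8,9]),(0,[2,6,8,9]),(6,[0,1,8,9,6,2,4,5]),(0,[3,4,8,9]),(0,[5,7,8,9]),(1,[0,2,8,9]),(1,[0,2,8,9])]),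
   ([[],[],[0],[0,2],[0,1,2],[0,1,3],[1,2,3,5],[1,2,3]], Colour (N (N (N (N (N (N (N (N (L 0) (X 0
     [0,4,7,8])) (X 0 [0,4,6,8])) (X 0 [2,4,5,8])) (N (X 0 [3,5,4,8]) (N (X 0 [3,6,4,8]) (N (X 0
     [2,7,5,8]) (L 3))))) (N (X 0 [1,4,3,8]) (N (N (X 0 [4,8,5,6]) (N (L 1) (X 0 [0,5,7,8]))) (N (N
     (X 0 [2,7,5,8]) (L 3)) (X 1 [3,5,6,8]))))) (N (N (N (X 0 [1,5,2,8]) (N (N (L 0) (X 0 [0,4,7,8]))
     (X 0 [0,4,6,8]))) (N (X 0 [1,5,2,8]) (N (X 0 [3,6,4,8]) (N (X 0 [3,7,4,8]) (X 7
     [6,4,3,8,5,2,0,7]))))) (N (X 0 [1,4,3,8]) (N (X 0 [1,5,2,8]) (N (N (L 0) (X 1 [2,3,7,8])) (X 1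
     [2,3,6,8])))))) (N (X 0 [0,2,1,8]) (N (X 0 [0,3,1,8]) (N (N (N (N (L 0) (X 0 [0,4,7,8])) (X 0
     [0,4,6,8])) (N (N (L 0) (X 0 [0,4,7,8])) (X 0 [0,4,6,8]))) (N (N (X 0 [4,8,5,6]) (X 1
     [2,3,6,8])) (N (X 6 [3,1,5,6,4,2,0,8]) (X 1 [1,5,6,8]))))))) (N (N (N (N (N (N (X 0 [0,8,1,6])
     (N (X 0 [0,8,1,7]) (L 1))) (X 0 [2,4,5,8])) (N (X 0 [3,5,4,8]) (N (X 0 [0,8,1,6]) (N (X 0
     [0,8,1,7]) (L 3))))) (N (X 0 [1,4,3,8]) (N (N (X 0 [0,8,1,6]) (N (X 0 [0,8,1,7]) (L 1))) (X 1
     [0,3,5,8])))) (N (N (N (X 0 [1,5,2,8]) (N (X 0 [0,8,1,6]) (N (X 0 [0,8,1,7]) (L 2)))) (X 1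
     [0,2,4,8])) (X 1 [0,2,3,8]))) (N (N (X 0 [1,8,2,3]) (N (N (N (N (L 1) (X 0 [5,6,7,8])) (N (L 1)
     (L 1))) (X 0 [2,4,5,8])) (N (N (X 0 [4,8,5,6]) (X 6 [3,1,6,5,4,0,2,8])) (X 1 [0,3,5,8])))) (N (N
     (N (N (N (L 2) (X 0 [5,6,7,8])) (N (L 2) (X 6 [2,1,8,7,5,3,0,6]))) (N (N (L 2) (L 2)) (X 1
     [1,5,6,8]))) (X 1 [0,2,4,8])) (X 1 [0,2,3,8])))))
     [(0,[0,2,8,9]),(0,[0,3,8,9]),(0,[1,6,8,9]),(0,[0,4,8,9]),(0,[0,4,8,9]),(0,[0,2,8,9]),(0,[0,2,8,9]),(0,[2,3,8,9]),(0,[0,2,8,9]),(0,[1,5,8,9]),(0,[1,5,8,9]),(0,[2,7,8,9]),(0,[2,7,8,9]),(1,[3,6,8,9]),(0,[0,2,8,9]),(5,[2,8,6,5,3,4,9,0,7]),(0,[0,3,8,9]),(0,[1,6,8,9]),(0,[0,4,8,9]),(0,[0,4,8,9]),(0,[1,6,8,9]),(1,[2,3,8,9]),(1,[2,3,8,9]),(0,[0,4,8,9]),(0,[0,4,8,9]),(0,[0,4,8,9]),(0,[1,4,8,9]),(0,[1,5,8,9]),(0,[2,4,8,9]),(0,[2,4,8,9]),(0,[2,4,8,9]),(0,[2,3,8,9]),(0,[1,5,8,9]),(1,[0,3,8,9]),(1,[0,3,8,9]),(1,[0,3,8,9]),(0,[1,4,8,9]),(1,[0,2,8,9]),(1,[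0,2,8,9]),(1,[0,2,8,9]),(1,[0,2,8,9]),(0,[2,4,8,9]),(0,[2,4,8,9]),(0,[2,4,8,9]),(0,[2,4,8,9]),(0,[2,4,8,9]),(0,[2,4,8,9]),(0,[3,5,8,9]),(0,[3,5,8,9]),(0,[3,6,8,9]),(0,[3,6,8,9]),(0,[3,5,8,9]),(0,[3,7,8,9]),(1,[0,2,8,9]),(0,[3,6,8,9]),(0,[3,6,8,9]),(0,[3,6,8,9])]),
   ([[],[],[],[0,1],[0,2,3],[1,2,3,4],[1,4,5],[0,5,6]], Comp 2 3 0 (N (N (X 0 [0,3,2,8]) (X 0
     [0,3,2,8])) (N (X 0 [1,3,2,8]) (N (N (N (X 0 [0,8,5,6]) (X 8 [3,8,4,5,0,1,6,2])) (N (N (X 0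
     [2,8,6,7]) (X 0 [3,4,7,8])) (X 1 [1,5,6,8]))) (N (N (X 0 [0,8,5,6]) (X 7 [6,0,5,8,1,4,3,2])) (X
     1 [2,4,5,8])))))),
   ([[],[],[0],[2],[1,2,3],[0,1,2,4],[0,4],[1,2,6]], Colour (N (N (N (N (N (N (N (N (L 1) (X 0
     [0,5,7,8])) (X 0 [1,5,6,8])) (N (N (X 0 [5,8,6,7]) (X 0 [3,4,7,8])) (X 0 [2,3,6,8]))) (N (N (N
     (L 1) (X 0 [0,5,7,8])) (X 0 [1,5,6,8])) (N (N (X 0 [5,8,6,7]) (L 1)) (X 0 [2,3,6,8])))) (N (N (X
     0 [0,5,3,8]) (N (X 0 [0,6,3,8]) (N (X 0 [1,7,3,8]) (L 3)))) (N (X 0 [0,5,3,8]) (N (X 0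
     [0,6,3,8]) (X 9 [0,3,1,2,5,4,8,6]))))) (N (N (N (N (N (L 1) (X 0 [0,5,7,8])) (X 0 [1,5,6,8])) (N
     (N (X 0 [5,8,6,7]) (X 0 [3,4,7,8])) (N (L 0) (X 0 [3,4,7,8])))) (N (N (N (L 1) (X 0 [0,5,7,8]))
     (X 0 [1,5,6,8])) (X 1 [2,4,5,8]))) (N (N (X 0 [0,5,3,8]) (N (X 0 [0,6,3,8]) (N (X 0 [1,7,3,8])
     (X 9 [1,3,0,4,5,2,8,7])))) (X 1 [2,3,4,8])))) (N (X 0 [0,2,1,8]) (N (N (N (N (X 0 [0,6,1,8]) (N
     (L 0) (X 0 [0,5,7,8]))) (N (X 0 [0,6,1,8]) (N (L 0) (X 0 [3,4,7,8])))) (N (N (X 0 [0,6,1,8]) (X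
     9 [0,1,3,5,2,4,8,6])) (X 1 [1,4,5,8]))) (N (N (X 0 [0,5,3,8]) (N (X 0 [0,6,1,8]) (N (L 0) (X 9
     [0,1,3,5,2,8,7,6])))) (X 1 [2,3,4,8]))))) (N (N (N (N (X 0 [0,8,1,4]) (N (N (N (X 0 [0,8,1,7])
     (L 1)) (X 0 [1,5,6,8])) (N (N (X 0 [0,8,1,7]) (L 3)) (X 0 [2,3,6,8])))) (N (X 0 [0,8,1,4]) (N (X
     0 [1,5,3,8]) (N (N (X 0 [0,8,1,7]) (L 3)) (N (X 0 [0,8,1,7]) (X 9 [1,0,3,5,4,8,6,7])))))) (N (N
     (X 0 [0,8,1,4]) (N (N (N (X 0 [0,8,1,7]) (X 9 [1,0,3,5,4,2,8,7])) (X 0 [1,5,6,8])) (X 1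
     [0,2,5,8]))) (N (X 0 [0,8,1,4]) (X 1 [2,3,4,8])))) (N (N (X 0 [1,8,2,3]) (N (N (N (N (X 0
     [3,8,6,7]) (X 0 [4,5,7,8])) (X 0 [2,5,6,8])) (N (N (X 0 [3,8,6,7]) (L 3)) (N (L 3) (L 3)))) (N
     (N (N (X 0 [3,8,6,7]) (L 2)) (X 0 [2,5,6,8])) (X 1 [1,4,5,8])))) (N (N (X 0 [0,8,3,4]) (N (N (N
     (L 2) (L 2)) (N (L 2) (L 2))) (X 1 [0,2,5,8]))) (N (N (N (N (X 0 [3,8,6,7]) (X 0 [4,5,7,8])) (N
     (L 2) (X 0 [4,5,7,8]))) (X 1 [0,2,5,8])) (X 1 [2,3,4,8]))))))
     [(0,[0,2,8,9]),(0,[0,2,8,9]),(0,[0,2,8,9]),(0,[0,5,8,9]),(0,[0,5,8,9]),(0,[1,5,8,9]),(0,[0,2,8,9]),(0,[0,2,8,9]),(0,[0,5,8,9]),(0,[0,5,8,9]),(0,[1,5,8,9]),(0,[0,2,8,9]),(0,[0,6,8,9]),(0,[0,6,8,9]),(0,[2,3,8,9]),(0,[0,2,8,9]),(9,[3,0,1,2,4,5,9,8]),(9,[1,3,0,4,5,9,8,7]),(0,[2,4,8,9]),(0,[2,4,8,9]),(0,[2,4,8,9]),(0,[0,5,8,9]),(0,[0,5,8,9]),(0,[1,5,8,9]),(0,[1,4,8,9]),(0,[3,4,8,9]),(0,[3,4,8,9]),(1,[2,5,8,9]),(0,[0,5,8,9]),(0,[1,5,8,9]),(0,[0,5,8,9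]),(0,[3,4,8,9]),(9,[0,1,3,5,2,9,8,6]),(0,[3,4,8,9]),(1,[1,5,8,9]),(1,[1,5,8,9]),(0,[1,5,8,9]),(0,[2,3,8,9]),(1,[0,5,8,9]),(1,[0,5,8,9]),(1,[0,5,8,9]),(1,[0,5,8,9]),(1,[0,5,8,9]),(1,[0,5,8,9]),(1,[0,5,8,9]),(1,[0,5,8,9]),(0,[2,4,8,9]),(0,[2,4,8,9]),(0,[2,4,8,9]),(0,[2,4,8,9]),(0,[2,4,8,9]),(0,[2,4,8,9]),(0,[2,5,8,9]),(1,[1,4,8,9]),(1,[1,4,8,9]),(1,[1,4,8,9]),(1,[1,4,8,9]),(9,[5,3,6,2,0,9,8,1]),(0,[6,7,8,9]),(1,[0,2,8,9]),(1,[0,2,8,9]),(1,[0,2,8,9]),(1,[0,2,8,9]),(1,[0,2,8,9]),(1,[0,2,8,9]),(1,[0,2,8,9]),(1,[0,2,8,9]),(1,[0,2,8,9]),(1,[0,2,8,9]),(1,[0,2,8,9]),(1,[0,2,8,9]),(1,[0,2,8,9]),(0,[4,5,8,9])]),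
   ([[],[0],[],[0,1],[1,2,3],[0,1,2,4],[0,2,3,5]], Colour (N (N (N (N (N (N (N (L 1) (X 0
     [1,4,6,7])) (N (L 3) (X 0 [1,4,6,7]))) (N (N (X 0 [0,6,4,7]) (L 3)) (N (X 0 [0,6,4,7]) (L 3))))
     (N (N (X 0 [2,5,3,7]) (N (L 1) (X 0 [1,4,6,7]))) (N (X 0 [2,5,3,7]) (N (X 0 [0,6,4,7]) (L 3)))))
     (X 0 [0,1,2,7])) (N (N (N (N (N (X 0 [1,7,2,6]) (L 0)) (N (X 0 [1,7,2,6]) (X 7
     [0,2,1,6,3,5,4,7]))) (N (N (X 0 [0,6,4,7]) (L 3)) (X 1 [1,4,5,7]))) (N (N (X 0 [2,5,3,7]) (N (X
     0 [1,7,2,6]) (L 2))) (X 1 [1,3,4,7]))) (N (X 0 [0,3,2,7]) (N (N (N (L 2) (L 2)) (N (L 2) (X 1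
     [2,5,6,7]))) (X 1 [1,3,4,7]))))) (N (N (N (N (X 0 [0,7,2,4]) (N (N (L 0) (L 3)) (N (X 7
     [1,2,0,4,3,5,6,7]) (X 1 [0,5,6,7])))) (N (X 0 [0,7,2,4]) (N (X 0 [2,5,3,7]) (N (L 1) (X 1
     [0,3,6,7]))))) (N (X 0 [1,3,2,7]) (N (N (N (L 1) (X 0 [1,4,6,7])) (N (L 1) (X 0 [1,4,6,7]))) (N
     (N (L 1) (X 1 [0,3,6,7])) (X 1 [2,4,5,7]))))) (N (N (N (X 0 [0,7,2,4]) (N (N (X 0 [1,7,2,6]) (L
     0)) (X 1 [0,1,5,7]))) (X 1 [0,1,3,7])) (N (N (N (N (L 0) (X 6 [0,2,6,7,4,1,3,5])) (X 1
     [0,1,5,7])) (N (N (X 6 [1,2,4,7,6,0,3,5]) (L 0)) (X 1 [0,1,5,7]))) (X 1 [0,1,3,7])))))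
     [(0,[0,1,7,8]),(0,[0,1,7,8]),(0,[2,6,7,8]),(0,[1,4,7,8]),(0,[1,4,7,8]),(0,[1,5,7,8]),(0,[0,1,7,8]),(0,[0,1,7,8]),(0,[0,1,7,8]),(0,[0,1,7,8]),(0,[0,3,7,8]),(0,[1,3,7,8]),(0,[0,1,7,8]),(0,[0,1,7,8]),(0,[0,1,7,8]),(0,[0,3,7,8]),(0,[1,3,7,8]),(0,[0,1,7,8]),(0,[0,1,7,8]),(0,[0,3,7,8]),(0,[1,3,7,8]),(0,[0,1,7,8]),(0,[2,6,7,8]),(0,[1,4,7,8]),(0,[1,4,7,8]),(9,[2,1,7,4,8,3,0,6]),(0,[0,1,7,8]),(7,[7,0,4,6,8,5,1,2]),(7,[7,1,6,4,8,5,0,2]),(0,[0,3,7,8]),(0,[2,5,7,8]),(0,[2,5,7,8]),(0,[3,4,7,8]),(7,[0,2,1,6,3,8,4,7]),(0,[0,3,7,8]),(0,[2,5,7,8]),(0,[2,4,7,8]),(1,[1,3,7,8]),(1,[1,3,7,8]),(1,[1,3,7,8]),(0,[0,5,7,8]),(0,[0,5,7,8]),(0,[0,6,7,8]),(0,[0,5,7,8]),(1,[1,3,7,8]),(0,[0,6,7,8]),(0,[1,3,7,8]),(0,[2,5,7,8]),(0,[3,6,7,8]),(7,[1,2,0,4,3,8,6,7]),(0,[1,3,7,8]),(0,[2,6,7,8]),(1,[0,3,7,8]),(1,[0,3,7,8]),(1,[0,3,7,8]),(0,[1,4,7,8]),(0,[1,4,7,8]),(0,[1,5,7,8]),(0,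[1,4,7,8]),(1,[0,3,7,8]),(0,[1,5,7,8]),(0,[2,5,7,8]),(1,[0,1,7,8]),(1,[0,1,7,8]),(0,[3,4,7,8]),(1,[0,1,7,8]),(1,[0,1,7,8])]),
   ([[],[0],[0,1],[2],[0,2,3],[1,2,3],[0,4,5]], Colour (N (N (N (N (N (N (N (L 0) (X 0 [1,2,6,7]))
     (X 0 [0,4,5,7])) (N (X 0 [1,5,4,7]) (N (L 1) (X 0 [1,2,6,7])))) (X 0 [0,1,3,7])) (N (N (N (N (L
     0) (L 0)) (X 0 [0,4,5,7])) (N (X 0 [1,5,4,7]) (N (L 0) (X 7 [7,1,4,5,6,2,0,3])))) (X 0
     [0,1,3,7]))) (N (N (N (X 0 [1,7,3,4]) (N (N (L 1) (X 0 [2,3,6,7])) (N (L 1) (X 0 [2,3,6,7]))))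
     (N (N (N (X 0 [0,6,3,7]) (L 2)) (X 0 [0,4,5,7])) (N (N (X 0 [0,6,3,7]) (L 3)) (X 11
     [3,5,0,7,1,2,4])))) (N (N (X 0 [1,7,3,4]) (N (N (L 3) (L 3)) (X 1 [1,2,5,7]))) (N (N (N (X 0
     [0,6,3,7]) (L 2)) (X 0 [0,4,5,7])) (X 1 [2,3,4,7]))))) (N (N (N (N (N (X 0 [0,7,3,5]) (N (L 1)
     (X 0 [1,2,6,7]))) (N (X 0 [0,7,3,5]) (N (L 1) (X 0 [1,2,6,7])))) (N (N (N (L 1) (X 0 [1,2,6,7]))
     (N (L 1) (X 0 [1,2,6,7]))) (N (X 0 [1,5,4,7]) (X 11 [3,4,1,7,0,2,5])))) (N (N (N (X 0 [0,7,3,5])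
     (N (L 0) (X 7 [7,3,0,5,6,2,4,1]))) (X 1 [0,2,4,7])) (N (N (N (L 2) (L 2)) (X 1 [2,3,5,7])) (X 1
     [0,2,4,7])))) (N (N (N (X 0 [1,7,3,4]) (N (X 0 [0,7,3,5]) (X 11 [0,1,3,7,5,2,4]))) (N (N (N (X 0
     [1,7,4,6]) (L 2)) (X 11 [1,5,4,7,3,2,0])) (N (X 11 [0,4,5,7,3,2,1]) (N (L 1) (X 1 [0,4,6,7])))))
     (X 1 [0,1,2,7]))))
     [(0,[0,1,7,8]),(0,[0,1,7,8]),(0,[0,1,7,8]),(0,[0,1,7,8]),(0,[3,4,7,8]),(0,[0,1,7,8]),(0,[0,2,7,8]),(0,[0,2,7,8]),(0,[1,2,7,8]),(0,[1,2,7,8]),(0,[1,2,7,8]),(0,[1,2,7,8]),(11,[0,1,7,2,5,8,4]),(0,[0,1,7,8]),(0,[0,1,7,8]),(0,[0,1,7,8]),(0,[3,4,7,8]),(0,[0,1,7,8]),(0,[0,1,7,8]),(0,[3,4,7,8]),(0,[0,1,7,8]),(1,[2,5,7,8]),(0,[0,2,7,8]),(0,[0,2,7,8]),(0,[2,3,7,8]),(0,[2,3,7,8]),(0,[2,5,7,8]),(10,[1,3,0,6,4,2,7,8]),(4,[5,2,7,3,0,8,4,1,6]),(0,[0,2,7,8]),(0,[2,3,7,8]),(0,[2,3,7,8]),(10,[1,3,0,6,4,2,7,8]),(10,[1,3,0,6,4,2,7,8]),(1,[1,5,7,8]),(0,[0,2,7,8]),(0,[0,4,7,8]),(8,[4,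7,0,2,6,3,8,1]),(11,[0,2,7,4,3,8,6]),(0,[2,4,7,8]),(0,[0,2,7,8]),(7,[8,5,4,1,7,2,3,0]),(1,[4,6,7,8]),(0,[0,6,7,8]),(0,[3,5,7,8]),(0,[3,5,7,8]),(0,[0,4,7,8]),(1,[2,3,7,8]),(1,[2,3,7,8]),(7,[7,4,1,3,8,2,0,5]),(0,[1,2,7,8]),(0,[1,2,7,8]),(0,[1,2,7,8]),(0,[1,2,7,8]),(11,[3,4,7,2,0,8,5]),(0,[1,2,7,8]),(0,[1,2,7,8]),(0,[1,2,7,8]),(1,[0,4,7,8]),(0,[1,2,7,8]),(0,[1,2,7,8]),(4,[5,2,7,1,4,8,0,3,6]),(0,[1,2,7,8]),(1,[3,5,7,8]),(0,[3,4,7,8]),(0,[1,5,7,8]),(0,[1,5,7,8]),(7,[7,5,0,3,8,2,1,4]),(0,[1,5,7,8]),(1,[0,6,7,8]),(0,[2,4,7,8]),(1,[0,1,7,8])]),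
   ([[],[],[1],[1],[1,2],[0,1,2,3],[0,2,3,4]], Comp 0 2 1 (N (X 0 [0,7,1,2]) (N (N (X 0 [0,7,2,4])
     (N (X 0 [3,5,4,7]) (N (X 8 [7,6,5,1,0,4,2,3]) (X 11 [1,4,0,2,6,7,5])))) (N (X 0 [0,7,2,4]) (N (N
     (X 12 [2,5,1,7,4,3,6]) (X 11 [4,7,5,6,3,1,2])) (X 1 [1,3,5,7])))))),
   ([[],[],[0],[1,2],[0,2,3],[0,1,4],[4]], Colour (N (N (N (N (N (N (N (L 3) (X 0 [0,2,6,7])) (X 0
     [2,3,5,7])) (N (N (L 0) (X 0 [0,2,6,7])) (X 0 [2,3,5,7]))) (N (N (X 0 [0,5,3,7]) (N (L 2) (X 0
     [0,2,6,7]))) (N (X 0 [0,5,3,7]) (N (L 3) (X 0 [0,2,6,7]))))) (N (N (N (X 0 [1,5,2,7]) (N (L 2)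
     (X 0 [1,3,6,7]))) (N (X 0 [1,5,2,7]) (N (L 1) (X 0 [1,3,6,7])))) (N (N (X 0 [0,5,3,7]) (X 13
     [1,2,4,7,0,3,5])) (X 1 [2,3,4,7])))) (N (X 0 [0,2,1,7]) (N (N (X 0 [0,4,1,7]) (N (N (L 1) (X 0
     [0,5,6,7])) (N (L 1) (X 9 [1,0,6,5,7,4,2,3])))) (N (X 0 [0,4,1,7]) (X 1 [2,3,4,7]))))) (N (N (N
     (X 0 [0,7,1,3]) (N (N (N (L 2) (X 0 [1,5,6,7])) (X 13 [1,0,4,7,2,5,3])) (N (N (L 0) (X 0
     [1,5,6,7])) (X 1 [0,4,5,7])))) (N (X 0 [0,7,1,3]) (N (N (X 0 [1,5,2,7]) (N (L 2) (L 2))) (X 1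
     [0,2,4,7])))) (N (N (N (X 0 [1,7,2,4]) (N (N (L 0) (X 0 [2,3,6,7])) (X 0 [2,3,5,7]))) (N (X 0
     [1,7,2,4]) (N (N (L 0) (X 9 [1,2,6,3,7,4,0,5])) (X 1 [0,4,5,7])))) (N (N (N (N (X 0 [1,7,4,6])
     (L 3)) (N (X 0 [1,7,4,6]) (L 3))) (X 1 [0,2,4,7])) (N (N (N (X 0 [1,7,4,6]) (L 3)) (X 11
     [0,2,1,4,3,7,5])) (X 1 [0,2,4,7]))))))
     [(0,[0,2,7,8]),(0,[0,2,7,8]),(0,[3,4,7,8]),(0,[3,4,7,8]),(0,[4,5,7,8]),(0,[0,2,7,8]),(0,[1,5,7,8]),(0,[2,3,7,8]),(9,[1,2,7,3,8,4,0,5]),(0,[0,2,7,8]),(0,[0,4,7,8]),(0,[2,4,7,8]),(0,[4,6,7,8]),(11,[0,2,7,4,3,8,5]),(0,[0,2,7,8]),(12,[0,5,4,3,2,7,8]),(11,[0,5,3,8,7,4,2]),(11,[2,3,5,8,7,4,0]),(0,[0,4,7,8]),(0,[4,6,7,8]),(0,[4,6,7,8]),(13,[1,2,8,4,7,3,5]),(0,[1,3,7,8]),(1,[2,4,7,8]),(1,[2,4,7,8]),(0,[0,5,7,8]),(1,[2,4,7,8]),(1,[1,5,7,8]),(0,[1,5,7,8]),(0,[4,6,7,8]),(13,[1,0,8,4,7,5,3]),(0,[1,5,7,8]),(1,[0,4,7,8]),(1,[0,4,7,8]),(0,[4,6,7,8]),(1,[0,2,7,8]),(1,[0,2,7,8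]),(0,[2,3,7,8]),(1,[0,4,7,8]),(1,[0,4,7,8]),(0,[3,4,7,8]),(0,[3,4,7,8]),(0,[4,5,7,8]),(0,[3,4,7,8]),(1,[0,2,7,8]),(0,[4,5,7,8])]),
   ([[],[],[],[1,2],[1],[2,4],[0,3,4,5]], Comp 0 3 1 (N (N (X 0 [0,7,1,3]) (X 0 [0,7,1,3])) (N (X 0
     [0,7,2,3]) (N (N (X 0 [0,7,4,5]) (N (X 0 [2,7,4,6]) (X 10 [2,4,7,0,6,5,3,1]))) (N (N (X 0
     [1,7,5,6]) (X 10 [1,5,7,0,6,4,3,2])) (X 14 [4,3,5,2,7,1,0])))))),
   ([[],[],[1],[0,1],[0,2],[0,1,2,3,4]], Colour (N (N (N (N (N (N (L 1) (L 1)) (X 0 [1,3,4,6])) (N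
     (X 0 [2,4,3,6]) (N (L 0) (L 3)))) (N (X 0 [0,3,2,6]) (N (N (L 0) (L 2)) (N (X 12
     [2,1,5,0,4,3,6]) (X 1 [2,4,5,6]))))) (N (N (N (X 0 [0,4,1,6]) (N (L 0) (L 1))) (N (X 0
     [0,4,1,6]) (N (X 12 [1,2,5,0,3,4,6]) (X 1 [1,3,5,6])))) (N (X 0 [0,3,2,6]) (N (X 0 [0,4,1,6]) (N
     (X 11 [1,2,0,6,4,5,3]) (X 1 [1,2,5,6])))))) (N (N (X 0 [0,6,1,2]) (N (N (N (L 0) (L 2)) (X 0
     [1,3,4,6])) (N (N (X 12 [0,4,5,1,3,2,6]) (X 1 [0,3,5,6])) (N (X 11 [0,4,1,6,2,5,3]) (X 1
     [0,3,5,6]))))) (N (N (N (N (L 0) (L 1)) (N (X 12 [0,3,5,2,4,1,6]) (X 1 [0,4,5,6]))) (N (X 0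
     [2,4,3,6]) (N (X 11 [0,3,2,6,1,5,4]) (X 1 [0,3,5,6])))) (N (N (N (X 12 [1,3,5,4,2,0,6]) (X 1
     [1,2,5,6])) (N (X 11 [2,4,3,6,0,5,1]) (X 1 [0,4,5,6]))) (N (N (X 11 [1,3,4,6,0,5,2]) (X 1
     [0,3,5,6])) (N (L 0) (X 1 [0,3,5,6])))))))
     [(0,[0,3,6,7]),(0,[0,3,6,7]),(0,[0,3,6,7]),(0,[2,4,6,7]),(0,[0,3,6,7]),(0,[0,3,6,7]),(0,[2,4,6,7]),(0,[0,5,6,7]),(0,[0,5,6,7]),(0,[0,5,6,7]),(0,[1,5,6,7]),(0,[2,5,6,7]),(11,[1,2,6,5,4,7,3]),(0,[1,2,6,7]),(0,[0,4,6,7]),(0,[0,5,6,7]),(0,[1,5,6,7]),(0,[4,5,6,7]),(11,[0,4,6,5,2,7,3]),(0,[0,4,6,7]),(1,[2,5,6,7]),(0,[0,3,6,7]),(0,[3,5,6,7]),(0,[2,5,6,7]),(11,[0,3,6,5,1,7,4]),(0,[0,3,6,7]),(1,[1,5,6,7]),(0,[1,3,6,7]),(0,[3,5,6,7]),(11,[1,3,6,5,0,7,2]),(0,[1,3,6,7]),(0,[2,4,6,7]),(11,[2,4,6,5,0,7,1]),(0,[2,4,6,7]),(1,[0,3,6,7])]),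
   ([[],[],[0],[0,2],[0,1,2],[1,2,3]], Colour (N (N (N (N (N (N (L 0) (X 0 [0,4,5,6])) (N (X 0
     [3,5,4,6]) (L 2))) (N (X 0 [1,4,3,6]) (N (L 2) (X 13 [1,3,2,6,0,5,4])))) (N (N (N (X 14
     [0,1,3,5,2,4,6]) (X 0 [0,4,5,6])) (N (X 0 [3,5,4,6]) (X 16 [0,5,6,3,4,2]))) (N (X 0 [1,4,3,6])
     (N (L 0) (X 1 [2,3,5,6]))))) (N (X 0 [0,2,1,6]) (N (X 0 [0,3,1,6]) (N (N (L 0) (X 0 [0,4,5,6]))
     (N (L 0) (X 1 [2,3,5,6])))))) (N (N (N (N (N (X 0 [0,6,1,5]) (L 3)) (N (X 0 [0,6,1,5]) (X 13
     [1,0,2,6,3,4,5]))) (N (X 0 [1,4,3,6]) (N (X 0 [0,6,1,5]) (L 2)))) (N (N (N (X 0 [0,6,1,5]) (L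
     1)) (X 1 [0,2,4,6])) (X 1 [0,2,3,6]))) (N (N (X 0 [1,6,2,3]) (N (N (L 3) (L 3)) (N (L 3) (X 11
     [0,3,1,2,5,6,4])))) (N (N (N (L 1) (L 1)) (X 1 [0,2,4,6])) (X 1 [0,2,3,6])))))
     [(0,[0,2,6,7]),(0,[1,5,6,7]),(0,[0,4,6,7]),(15,[6,0,5,3,4,1,7]),(0,[0,2,6,7]),(0,[0,2,6,7]),(11,[0,3,6,2,5,7,4]),(0,[0,2,6,7]),(13,[1,3,7,2,6,5,4]),(0,[1,5,6,7]),(1,[2,3,6,7]),(1,[2,3,6,7]),(0,[0,4,6,7]),(1,[2,3,6,7]),(1,[1,4,6,7]),(0,[1,4,6,7]),(0,[2,4,6,7]),(0,[2,4,6,7]),(8,[4,5,7,0,1,2,3,6]),(1,[0,3,6,7]),(0,[1,4,6,7]),(1,[0,2,6,7]),(1,[0,2,6,7]),(0,[2,4,6,7]),(0,[2,4,6,7]),(0,[2,5,6,7]),(0,[2,4,6,7]),(1,[0,3,6,7]),(0,[2,5,6,7]),(0,[3,5,6,7]),(1,[0,2,6,7]),(1,[0,2,6,7])]),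
   ([[],[],[1],[1],[2],[3,4]], Comp 0 1 2 (N (X 0 [0,6,1,2]) (N (X 0 [0,6,1,3]) (N (N (X 0
     [0,6,4,5]) (X 15 [0,1,4,2,3,5,6])) (N (X 15 [0,1,5,3,2,4,6]) (X 14 [4,1,5,3,6,2,0]))))))]"

lemma steps_C5_ok: "steps_ok 4 K4_2K2 steps_C5"
  by code_simp

definition patterns_C5 :: "rows list" where
  "patterns_C5 = K4_2K2 @ map (rows_of \<circ> fst) steps_C5"

text \<open>
  The types of vertices that remain around a pentagon \<open>0, \<dots>, 4\<close>: with \<open>R i = {i - 1, i + 1}\<close> and
  \<open>Y i = {i - 2, i, i + 2}\<close>, the blocks \<open>0, \<dots>, 9\<close> are \<open>R 0, Y 1, R 2, Y 3, R 4, Y 0, R 1, Y 2, R 3, Y 4\<close>.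
\<close>

definition block_tree :: "nat tree" where
  "block_tree =
     N (N (N (N (N (X 18 [5,0,1,4,2,3]) (X 0 [1,2,4,5])) (X 0 [0,1,3,5])) (N (N (X 0 [0,4,2,5]) (L
     8)) (X 0 [0,1,3,5]))) (N (N (N (X 0 [1,5,3,4]) (L 0)) (N (L 2) (L 1))) (N (N (X 0 [0,4,2,5])
     (L 9)) (N (X 0 [0,4,2,5]) (X 17 [2,0,5,3,1,4]))))) (N (N (N (X 0 [0,5,2,3]) (N (L 4) (X 0
     [1,2,4,5]))) (N (N (L 6) (L 7)) (N (L 5) (X 17 [3,1,5,4,2,0])))) (N (N (X 0 [0,5,2,3]) (N (L
     3) (X 17 [0,2,5,4,1,3]))) (N (N (X 0 [1,5,3,4]) (X 17 [0,3,5,1,4,2])) (N (X 17 [1,4,5,2,0,3])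
     (X 16 [0,2,3,1,4,5])))))"

definition near_witnesses :: "(nat \<times> nat list) list" where
  "near_witnesses =
     [(0,[0,1,5,6]), (17,[2,0,6,5,1,4]), (0,[2,3,5,6]), (17,[4,2,6,5,3,1]), (0,[0,4,5,6]),
     (17,[1,4,6,5,0,3]), (17,[3,0,5,6,4,1]), (1,[3,4,5,6]), (17,[1,3,5,6,2,4]), (1,[1,2,5,6]),
     (0,[1,2,5,6]), (17,[3,1,6,5,2,0]), (0,[3,4,5,6]), (17,[0,3,6,5,4,2]), (17,[4,1,5,6,0,2]),
     (1,[0,4,5,6]), (17,[2,4,5,6,3,0]), (1,[2,3,5,6]), (17,[0,2,5,6,1,3]), (1,[0,1,5,6])]"

definition far_witnesses :: "(nat \<times> nat list) list" where
  "far_witnesses =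
     [(0,[1,6,4,5]), (0,[0,6,2,5]), (0,[1,5,3,6]), (0,[1,5,3,6]), (0,[0,6,3,5]), (0,[0,6,3,5]),
     (0,[0,6,3,5]), (0,[2,6,4,5]), (0,[0,6,2,5]), (0,[0,6,2,5]), (0,[0,5,2,6]), (0,[0,5,2,6]),
     (0,[2,5,4,6]), (0,[0,5,3,6]), (0,[0,5,3,6]), (0,[0,5,3,6]), (0,[1,6,3,5]), (0,[1,6,3,5]),
     (0,[0,5,2,6]), (0,[1,5,4,6])]"

text \<open>The pairs are ordered, the block number growing by \<open>d\<close> modulo 10; symmetry
  of \<open>E\<close> supplies the other direction. Adjacency at distances 2 and 3 is left
  open.\<close>

definition at_distance :: "nat list \<Rightarrow> (bool list \<times> nat) list \<Rightarrow> (bool list \<times> bool list) list" where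
  "at_distance ds ls = concat (map (\<lambda>(s, i). concat (map (\<lambda>(t, j).
     if j \<in> set (map (\<lambda>d. (i + d) mod 10) ds) then [(s, t)] else []) ls)) ls)"

lemma leaves_block_tree:
  "leaves [] (replicate (length C5) None) block_tree =
    [([False, False, True, False, True], 8), ([False, True, False, False, True], 0), ([False, True,
     False, True, False], 2), ([False, True, False, True, True], 1), ([False, True, True, False,
     True], 9), ([True, False, False, True, False], 4), ([True, False, True, False, False], 6),
     ([True, False, True, False, True], 7), ([True, False, True, True, False], 5), ([True, True,
     False, True, False], 3)]"
  by code_simp

lemma block_tree_ok:
  "closed_tree patterns_C5 C5 [] (replicate (length C5) None) block_tree \<and>
   all_refuted patterns_C5 C5 True (at_distance [0, 1] (leaves [] (replicate (length C5) None) block_tree))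
     near_witnesses \<and>
   all_refuted patterns_C5 C5 False (at_distance [4, 5] (leaves [] (replicate (length C5) None) block_tree))
     far_witnesses"
  by code_simp

lemma in_at_distance:
  assumes "(s, i) \<in> set ls" "(t, j) \<in> set ls" "d \<in> set ds" "j = (i + d) mod 10"
  shows "(s, t) \<in> set (at_distance ds ls)"
  using assms unfolding at_distance_def by fastforce

lemma C5_rows: "C5 = [[], [True], [False, True], [False, False, True], [True, False, False, True]]"
  by code_simp

section \<open>Excluding pentagons from graphs without 2K2 and K4\<close>

context sym_graph
begin

lemma copy_C5_iff:
  "copy [c0, c1, c2, c3, c4] C5 \<longleftrightarrow> {c0, c1, c2, c3, c4} \<subseteq> V \<and> E c0 c1 \<and> E c1 c2 \<and> E c2 c3 \<and> E c3 c4 \<and> E c4 c0 \<and>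
    \<not> E c0 c2 \<and> \<not> E c1 c3 \<and> \<not> E c2 c4 \<and> \<not> E c3 c0 \<and> \<not> E c4 c1"
  unfolding C5_rows copy_def by (auto simp: less_Suc_eq numeral_eq_Suc comm)

lemma no_2K2:
  assumes "avoids P" "set K4_2K2 \<subseteq> set P" "{a, b, c, d} \<subseteq> V" "E a b" "E c d" "\<not> E a c" "\<not> E a d" "\<not> E b c"
  shows "E b d"
proof (rule ccontr)
  assume "\<not> E b d"
  then have "copy [a, b, c, d] (rows_of [[],[0],[],[2]])"
    using assms(3-) unfolding copy_def by (auto simp: rows_of_def less_Suc_eq numeral_eq_Suc comm)
  then show False using assms(1,2) by (auto simp: avoids_def K4_2K2_def)
qed

lemma no_K4:
  assumes "avoids P" "set K4_2K2 \<subseteq> set P" "{a, b, c, d} \<subseteq> V" "E a b" "E a c" "E a d" "E b c" "E b d"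
  shows "\<not> E c d"
proof
  assume "E c d"
  then have "copy [a, b, c, d] (rows_of [[],[0],[0,1],[0,1,2]])"
    using assms(3-) unfolding copy_def by (auto simp: rows_of_def less_Suc_eq numeral_eq_Suc comm)
  then show False using assms(1,2) by (auto simp: avoids_def K4_2K2_def)
qed

end

context critical_graph
begin

lemma pentagon_blocks:
  assumes "avoids patterns_C5" "copy xs C5"
  obtains blk :: "'a \<Rightarrow> nat" where
    "\<And>v. v \<in> V \<Longrightarrow> (map (E v) xs, blk v) \<in> set (leaves [] (replicate (length C5) None) block_tree)"
    "\<And>u v. u \<in> V \<Longrightarrow> v \<in> V \<Longrightarrow> E u v \<Longrightarrow> blk v \<noteq> blk u \<and> blk v \<noteq> (blk u + 1) mod 10"
    "\<And>u v. u \<in> V \<Longrightarrow> v \<in> V \<Longrightarrow> blk v = (blk u + 4) mod 10 \<or> blk v = (blk u + 5) mod 10 \<Longrightarrow> E u v"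
proof -
  let ?ls = "leaves [] (replicate (length C5) None) block_tree"
  define blk where "blk v = (SOME i. (map (E v) xs, i) \<in> set ?ls)" for v
  have blk: "(map (E v) xs, blk v) \<in> set ?ls" if "v \<in> V" for v
    unfolding blk_def
    by (rule someI_ex) (use closed_tree_free_sound[OF assms that] block_tree_ok in blast)
  have lt: "blk v < 10" if "v \<in> V" for v
    using blk[OF that] unfolding leaves_block_tree by auto
  have refuted: "E v u \<noteq> b"
    if "u \<in> V" "v \<in> V" "all_refuted patterns_C5 C5 b (at_distance ds ?ls) ws"
      "d \<in> set ds" "blk v = (blk u + d) mod 10" for u v b ds ws d
    using all_refutedD[OF that(3) in_at_distance[OF blk blk, OF that(1,2,4,5)]]
      refutes_pair[OF assms that(1,2)] by blast
  have "blk v \<noteq> blk u \<and> blk v \<noteq> (blk u + 1) mod 10" if "u \<in> V" "v \<in> V" "E u v" for u v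
    using refuted[OF that(1,2), of True "[0, 1]" _ 0] refuted[OF that(1,2), of True "[0, 1]" _ 1]
      block_tree_ok lt[OF that(1)] sym[OF that(3)] by auto
  moreover have "E u v" if "u \<in> V" "v \<in> V" "blk v = (blk u + 4) mod 10 \<or> blk v = (blk u + 5) mod 10" for u v
    using refuted[OF that(1,2), of False "[4, 5]" _ 4] refuted[OF that(1,2), of False "[4, 5]" _ 5]
      block_tree_ok that(3) sym[of v u] by auto
  ultimately show thesis using that blk by blast
qed

text \<open>
  The ten blocks are arranged on a circle: vertices in equal or consecutive blocks are not adjacent, and
  vertices in blocks at distance 4 or 5 are adjacent. An extremal choice of the pentagon separates blocks
  0 and 2, after which the circle is cut greedily into four independent arcs.
\<close>

lemma no_C5:
  assumes k: "k = 4" and av: "avoids patterns_C5"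
  shows "\<not> copy xs C5"
proof
  assume "copy xs C5"
  then have "length xs = 5" by (simp add: copy_def C5_rows)
  then obtain x c1 c2 c3 c4 where "xs = [x, c1, c2, c3, c4]"
    by (auto simp: length_Suc_conv numeral_eq_Suc)
  with \<open>copy xs C5\<close> have x: "copy [x, c1, c2, c3, c4] C5" by simp
  have base: "set K4_2K2 \<subseteq> set patterns_C5" by (auto simp: patterns_C5_def)
  \<comment> \<open>\<open>M c0\<close> is block 3, the type \<open>Y 3 = {0, 1, 3}\<close>. The
    vertices \<open>c1\<close> to \<open>c4\<close> stay fixed, and \<open>c0\<close> is chosen to
    make this block as large as possible.\<close>
  define M where "M c = {v \<in> V. E v c1 \<and> \<not> E v c2 \<and> E v c3 \<and> \<not> E v c4 \<and> E v c}" for c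
  have "card (M c) < Suc (card V)" for c
    using card_mono[OF finite, of "M c"] by (auto simp: M_def)
  then obtain c0 where c: "copy [c0, c1, c2, c3, c4] C5"
    and extremal: "\<And>c. copy [c, c1, c2, c3, c4] C5 \<Longrightarrow> card (M c) \<le> card (M c0)"
    using ex_has_greatest_nat[of "\<lambda>c. copy [c, c1, c2, c3, c4] C5" x "\<lambda>c. card (M c)" "Suc (card V)"] x
    by blast
  obtain blk :: "'a \<Rightarrow> nat" where
    blk: "\<And>v. v \<in> V \<Longrightarrow>
      (map (E v) [c0, c1, c2, c3, c4], blk v) \<in> set (leaves [] (replicate (length C5) None) block_tree)" and
    near: "\<And>u v. u \<in> V \<Longrightarrow> v \<in> V \<Longrightarrow> E u v \<Longrightarrow> blk v \<noteq> blk u \<and> blk v \<noteq> (blk u + 1) mod 10" and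
    far: "\<And>u v. u \<in> V \<Longrightarrow> v \<in> V \<Longrightarrow>
      blk v = (blk u + 4) mod 10 \<or> blk v = (blk u + 5) mod 10 \<Longrightarrow> E u v"
    using pentagon_blocks[OF av c] by blast
  have cV: "c0 \<in> V" using c by (simp add: copy_C5_iff)
  have lt: "blk v \<in> {0,1,2,3,4,5,6,7,8,9}" if "v \<in> V" for v
    using blk[OF that] unfolding leaves_block_tree by auto
  \<comment> \<open>If \<open>u\<close> and \<open>w\<close> were adjacent, \<open>u\<close> could
    replace \<open>c0\<close> on the pentagon. For \<open>y\<close> in block 3, the edges
    \<open>c0 y\<close> and \<open>w u\<close> must not form a 2K2; \<open>w\<close> misses
    \<open>y\<close>, as their blocks are consecutive, and \<open>c0\<close> misses \<open>u\<close>
    and \<open>w\<close>, so \<open>y\<close> is adjacent to \<open>u\<close>. Hence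
    \<open>M u\<close> contains \<open>M c0\<close> and also the new element \<open>w\<close>,
    against the choice of \<open>c0\<close>.\<close>
  have sep: "\<not> E u w" if u: "u \<in> V" "blk u = 0" and w: "w \<in> V" "blk w = 2" for u w
  proof
    assume uw: "E u w"
    have tu: "\<not> E u c0" "E u c1" "\<not> E u c2" "\<not> E u c3" "E u c4"
      using blk[OF u(1)] u(2) unfolding leaves_block_tree by auto
    have tw: "\<not> E w c0" "E w c1" "\<not> E w c2" "E w c3" "\<not> E w c4"
      using blk[OF w(1)] w(2) unfolding leaves_block_tree by auto
    have "copy [u, c1, c2, c3, c4] C5"
      using c tu u(1) sym by (auto simp: copy_C5_iff)
    then have "card (M u) \<le> card (M c0)" by (rule extremal)
    moreover have "M c0 \<subset> M u"
    proof
      show "M c0 \<subseteq> M u"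
      proof
        fix y assume y: "y \<in> M c0"
        then have "y \<in> V" "E y c0" by (auto simp: M_def)
        have "blk y = 3"
          using blk[OF \<open>y \<in> V\<close>] y unfolding leaves_block_tree M_def by auto
        then have "\<not> E w y" using near[OF w(1) \<open>y \<in> V\<close>] w(2) by auto
        then have "E y u"
          using no_2K2[OF av base, of c0 y w u] cV \<open>y \<in> V\<close> u w uw tu tw \<open>E y c0\<close> sym by auto
        then show "y \<in> M u" using y by (simp add: M_def)
      qed
      have "w \<in> M u - M c0" using tw uw w(1) sym by (auto simp: M_def)
      then show "M c0 \<noteq> M u" by blast
    qed
    ultimately show False
      using psubset_card_mono[of "M u" "M c0"] finite by (auto simp: M_def)
  qed
  \<comment> \<open>The circle is cut so that a vertex stays in the current arc as long as possible:
    one of block 5 moves on only if it has a neighbour in block 3, and one of block 7 only if it has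
    a neighbour among those of block 5 that moved on. Each arc spans at most three consecutive
    blocks, so only blocks at distance 2 can conflict.\<close>
  define B5 where "B5 v \<longleftrightarrow> (\<exists>y\<in>V. blk y = 3 \<and> E y v)" for v
  define B7 where "B7 v \<longleftrightarrow> (\<exists>z\<in>V. blk z = 5 \<and> B5 z \<and> E z v)" for v
  define col :: "'a \<Rightarrow> nat" where "col v =
    (if blk v \<le> 2 then 0
     else if blk v \<le> 4 \<or> blk v = 5 \<and> \<not> B5 v then 1
     else if blk v \<le> 6 \<or> blk v = 7 \<and> \<not> B7 v then 2 else 3)" for v
  have proper: "col u \<noteq> col v" if uv: "u \<in> V" "v \<in> V" "E u v" "blk u \<le> blk v" for u v
  proof
    assume eq: "col u = col v"
    have n: "blk v \<noteq> blk u" "blk v \<noteq> Suc (blk u)"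
      using near[OF uv(1-3)] lt[OF uv(1)] lt[OF uv(2)] by (auto simp: mod_Suc)
    then consider "blk u = 0" "blk v = 2" | "blk u = 3" "blk v = 5" "\<not> B5 v"
      | "blk u = 5" "blk v = 7" "B5 u" "\<not> B7 v" | "blk u = 7" "blk v = 9" "B7 u"
      using lt[OF uv(1)] lt[OF uv(2)] uv(4) eq unfolding col_def by (auto split: if_splits)
    then show False
    proof cases
      case 1
      then show False using sep uv by blast
    next
      case 2
      then show False using uv by (auto simp: B5_def)
    next
      case 3
      then show False using uv by (auto simp: B7_def)
    next
      case 4
      \<comment> \<open>The last possible conflict, between blocks 7 and 9, unwinds to a K4 on
        \<open>y\<close>, \<open>z\<close>, \<open>u\<close>, \<open>v\<close> from blocks 3, 5, 7,
        9: the pairs 3-7, 5-9 and 9-3 are at distance 4 on the circle and therefore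
        adjacent.\<close>
      then obtain z y where zy: "z \<in> V" "blk z = 5" "E z u" "y \<in> V" "blk y = 3" "E y z"
        by (auto simp: B7_def B5_def)
      have "E y u" using far[of y u] zy 4 uv(1) by simp
      moreover have "E v y" using far[of v y] zy 4 uv(2) by simp
      moreover have "E z v" using far[of z v] zy 4 uv(2) by simp
      ultimately show False
        using no_K4[OF av base, of y z u v] zy uv sym by auto
    qed
  qed
  have "col ` V \<subseteq> {..<4}" by (auto simp: col_def)
  moreover have "col u \<noteq> col v" if "u \<in> V" "v \<in> V" "E u v" for u v
    using proper[OF that] proper[OF that(2,1) sym[OF that(3)]] by (metis nle_le)
  ultimately show False using not_colorable unfolding colorable_def k by blast
qed

end

text \<open>Without pentagons, the complement of a heptagon and finally the triangle are excluded.\<close>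

definition steps_K3 :: "(nat list list \<times> step) list" where
  "steps_K3 = [
   ([[],[],[0,1],[0,2],[0,1],[1,3,4],[0,2,4,5],[0,2,5],[2,3,4,5]], Colour (N (N (N (N (N (N (N (N
     (N (L 0) (X 0 [0,6,8,9])) (X 0 [1,4,7,9])) (N (N (X 0 [3,8,6,9]) (X 0 [0,7,8,9])) (X 0
     [1,4,7,9]))) (X 0 [0,2,5,9])) (X 0 [2,3,4,9])) (N (X 0 [1,4,3,9]) (X 2 [1,2,3,9,4]))) (N (N (N
     (X 0 [2,9,4,5]) (X 2 [0,2,9,5,4])) (N (X 2 [2,3,5,4,9]) (N (N (N (L 1) (X 0 [0,6,8,9])) (N (X 0
     [3,8,7,9]) (X 0 [0,6,8,9]))) (X 1 [4,5,6,9])))) (N (X 0 [1,4,3,9]) (N (N (N (X 2 [2,7,5,4,9]) (N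
     (L 2) (X 0 [0,6,8,9]))) (N (X 2 [2,7,5,4,9]) (N (L 2) (X 1 [2,3,8,9])))) (N (N (N (L 2) (X 0
     [0,6,8,9])) (N (L 2) (X 0 [0,6,8,9]))) (X 1 [4,5,6,9])))))) (N (N (X 0 [0,3,1,9]) (N (X 2
     [0,3,9,1,4]) (N (N (X 0 [0,6,1,9]) (N (X 0 [0,7,1,9]) (N (X 2 [2,7,9,4,8]) (L 0)))) (X 0
     [0,2,5,9])))) (N (X 0 [0,3,1,9]) (N (X 2 [0,3,9,1,4]) (N (N (X 0 [0,6,1,9]) (N (X 0 [0,7,1,9])
     (N (L 2) (X 1 [2,3,8,9])))) (X 1 [1,4,5,9])))))) (N (N (N (N (N (X 0 [0,9,1,5]) (X 2
     [0,2,1,5,9])) (X 0 [2,3,4,9])) (N (X 0 [1,4,3,9]) (X 2 [1,2,3,9,4]))) (N (N (N (X 0 [0,9,1,5])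
     (N (N (N (L 1) (L 3)) (X 0 [1,4,7,9])) (X 1 [0,2,6,9]))) (N (X 0 [0,9,1,5]) (N (N (N (L 1) (X 1
     [4,5,8,9])) (X 1 [0,2,7,9])) (X 1 [0,2,6,9])))) (X 1 [0,2,3,9]))) (N (N (N (N (X 2 [0,3,5,1,9])
     (N (N (N (X 0 [1,9,3,8]) (L 3)) (X 0 [4,6,7,9])) (N (N (X 0 [1,9,3,8]) (L 3)) (N (X 0 [1,9,3,8])
     (L 3))))) (X 0 [2,3,4,9])) (N (N (N (X 0 [3,9,4,6]) (N (X 2 [0,7,5,1,9]) (N (X 0 [0,9,5,8]) (L
     0)))) (N (X 0 [3,9,4,6]) (N (N (X 2 [0,2,8,5,9]) (X 1 [3,5,8,9])) (N (X 0 [4,8,7,9]) (X 1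
     [3,5,8,9]))))) (N (N (X 2 [0,6,5,1,9]) (X 1 [0,4,6,9])) (X 1 [1,4,5,9])))) (N (N (N (X 0
     [2,9,4,5]) (N (N (N (X 0 [1,9,3,8]) (L 3)) (X 0 [4,6,7,9])) (X 1 [0,2,6,9]))) (N (X 2
     [0,3,5,1,9]) (X 1 [1,4,5,9]))) (X 1 [0,2,3,9])))))
     [(0,[0,2,9,10]),(0,[0,2,9,10]),(0,[4,5,9,10]),(0,[0,3,9,10]),(0,[3,8,9,10]),(0,[3,8,9,10]),(0,[0,6,9,10]),(0,[1,5,9,10]),(0,[0,6,9,10]),(0,[0,6,9,10]),(0,[5,8,9,10]),(0,[1,5,9,10]),(1,[2,3,9,10]),(1,[2,3,9,10]),(0,[5,8,9,10]),(0,[0,6,9,10]),(0,[0,6,9,10]),(1,[2,3,9,10]),(0,[0,6,9,10]),(1,[2,3,9,10]),(0,[0,2,9,10]),(1,[3,8,9,10]),(0,[5,8,9,10]),(0,[1,4,9,10]),(0,[3,8,9,10]),(0,[1,4,9,10]),(0,[4,6,9,10]),(1,[5,8,9,10]),(1,[5,8,9,10]),(0,[4,6,9,10]),(0,[3,8,9,10]),(0,[2,3,9,10]),(0,[2,3,9,10]),(0,[2,3,9,10]),(0,[4,6,9,10]),(0,[2,3,9,10]),(0,[2,3,9,10]),(1,[1,5,9,10]),(0,[2,3,9,10]),(1,[1,5,9,10]),(0,[4,5,9,10]),(0,[4,6,9,10])]),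
   ([[],[],[1],[0,1],[0,1,2],[0,2,3],[2,3,4,5],[1,3,4,5]], Colour (N (N (N (N (N (N (N (N (L 0) (X
     0 [2,6,7,8])) (N (X 0 [1,7,6,8]) (X 2 [1,2,6,8,7]))) (X 0 [1,4,5,8])) (N (X 0 [3,5,4,8]) (X 2
     [1,3,5,8,4]))) (N (X 0 [2,4,3,8]) (N (X 2 [2,4,8,3,5]) (N (N (L 1) (X 0 [2,6,7,8])) (X 1
     [3,5,6,8]))))) (N (X 0 [0,3,2,8]) (N (X 2 [0,3,8,2,4]) (N (N (N (X 3 [2,0,4,1,5,3,6,8,7]) (L 3))
     (X 1 [2,4,6,8])) (N (N (L 1) (X 1 [3,5,7,8])) (X 1 [2,4,6,8])))))) (N (N (N (N (X 0 [0,5,1,8])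
     (X 2 [0,4,1,8,5])) (N (X 0 [0,5,1,8]) (N (N (X 3 [1,0,4,2,3,5,7,8,6]) (X 0 [2,6,7,8])) (N (L 2)
     (X 1 [1,4,7,8]))))) (N (X 0 [2,4,3,8]) (N (X 0 [0,5,1,8]) (N (N (L 1) (X 0 [2,6,7,8])) (X 1
     [3,5,6,8]))))) (N (X 0 [0,3,2,8]) (N (X 2 [0,3,8,2,4]) (X 1 [1,2,4,8]))))) (N (N (X 0 [0,8,1,2])
     (N (X 2 [0,3,1,2,8]) (N (N (N (N (X 0 [0,8,1,7]) (L 3)) (N (X 0 [0,8,1,7]) (L 0))) (X 0
     [1,4,5,8])) (N (N (N (X 0 [0,8,1,7]) (L 3)) (X 1 [2,4,6,8])) (X 1 [0,3,5,8]))))) (N (N (N (N (X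
     2 [0,5,2,1,8]) (N (X 0 [0,8,2,6]) (N (L 2) (L 2)))) (N (X 0 [3,5,4,8]) (N (X 0 [0,8,2,6]) (N (L
     2) (X 1 [1,4,7,8]))))) (N (X 0 [2,4,3,8]) (N (X 2 [0,5,2,1,8]) (X 1 [0,3,5,8])))) (N (N (N (N (X
     0 [1,8,5,6]) (N (X 0 [2,8,3,7]) (L 0))) (N (X 2 [0,3,6,2,8]) (X 1 [2,5,6,8]))) (X 1 [1,2,4,8]))
     (N (N (N (X 0 [1,8,5,6]) (N (X 2 [0,5,7,1,8]) (X 1 [1,3,7,8]))) (X 1 [0,3,5,8])) (X 1
     [1,2,4,8]))))))
     [(0,[0,3,8,9]),(0,[1,4,8,9]),(0,[3,5,8,9]),(0,[1,2,8,9]),(0,[1,7,8,9]),(0,[2,6,8,9]),(0,[0,5,8,9]),(0,[5,6,8,9]),(0,[5,6,8,9]),(0,[1,7,8,9]),(1,[3,5,8,9]),(0,[0,3,8,9]),(0,[3,7,8,9]),(1,[5,6,8,9]),(0,[3,7,8,9]),(0,[2,6,8,9]),(0,[1,4,8,9]),(0,[5,6,8,9]),(0,[1,4,8,9]),(1,[2,6,8,9]),(0,[5,6,8,9]),(0,[2,4,8,9]),(0,[2,4,8,9]),(0,[3,7,8,9]),(0,[2,4,8,9]),(1,[0,5,8,9]),(0,[3,7,8,9]),(0,[3,5,8,9])]),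
   ([[],[],[0],[0,1],[1,2,3],[0,1,2,3],[0,1,2,4]], Colour (N (N (N (N (N (N (N (L 0) (X 0
     [3,5,6,7])) (N (X 0 [4,6,5,7]) (X 2 [3,4,6,7,5]))) (N (X 0 [0,5,4,7]) (N (X 2 [0,5,7,4,6]) (X 4
     [7,0,3,6,5,4,1,2])))) (N (N (N (X 0 [2,6,3,7]) (X 2 [2,5,3,7,6])) (N (X 0 [2,6,3,7]) (X 4
     [7,2,4,5,6,3,1,0]))) (N (X 0 [0,5,4,7]) (N (X 0 [2,6,3,7]) (L 3))))) (N (X 0 [1,3,2,7]) (N (N (N
     (X 2 [1,3,7,2,6]) (X 4 [7,1,5,6,3,2,0,4])) (N (X 0 [4,6,5,7]) (L 2))) (N (X 0 [0,5,4,7]) (N (X 2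
     [0,5,7,4,6]) (X 1 [2,4,6,7])))))) (N (X 0 [0,2,1,7]) (N (X 2 [0,2,7,1,3]) (N (N (N (X 4
     [7,0,6,3,2,1,4,5]) (L 2)) (X 1 [1,3,5,7])) (X 1 [1,3,4,7]))))) (N (N (N (N (X 0 [0,7,1,4]) (N (X
     2 [0,5,1,4,7]) (N (X 4 [7,1,6,5,4,0,2,3]) (L 1)))) (N (X 0 [0,7,1,4]) (N (X 2 [0,5,1,4,7]) (X 1
     [0,3,5,7])))) (N (X 0 [1,3,2,7]) (N (X 0 [0,7,1,4]) (N (X 2 [0,5,1,4,7]) (X 1 [0,2,5,7]))))) (N
     (N (N (X 2 [0,2,4,1,7]) (N (N (X 4 [7,2,5,4,0,1,3,6]) (X 0 [3,5,6,7])) (N (L 1) (X 1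
     [1,4,6,7])))) (N (X 2 [0,2,4,1,7]) (X 1 [1,3,4,7]))) (N (N (N (N (X 4 [7,3,4,0,1,2,6,5]) (X 0
     [3,5,6,7])) (X 1 [0,2,5,7])) (N (N (L 0) (X 0 [3,5,6,7])) (X 1 [0,2,5,7]))) (N (N (N (L 0) (X 1
     [0,2,6,7])) (X 1 [0,2,5,7])) (X 1 [1,3,4,7]))))))
     [(0,[0,2,7,8]),(0,[3,5,7,8]),(0,[4,6,7,8]),(0,[0,2,7,8]),(0,[1,4,7,8]),(1,[2,6,7,8]),(0,[0,5,7,8]),(0,[1,3,7,8]),(1,[0,5,7,8]),(0,[2,6,7,8]),(0,[3,5,7,8]),(1,[0,2,7,8]),(0,[4,6,7,8])]),
   ([[],[0],[],[0,2],[0,1,2,3],[1,2,3],[4,5]], Comp 1 3 2 (N (N (X 0 [1,7,2,3]) (X 2 [0,1,7,2,3]))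
     (N (X 0 [1,7,2,3]) (N (N (N (X 0 [0,7,5,6]) (X 2 [0,3,5,6,7])) (X 5 [0,2,1,3,5,4,7])) (X 1
     [0,1,4,7]))))),
   ([[],[0],[0],[2],[0,1,2,3],[1,2]], Comp 3 0 1 (N (N (X 0 [0,1,3,6]) (X 0 [0,1,3,6])) (N (X 2
     [0,1,6,3,2]) (N (N (X 6 [3,6,0,4,2,1,5]) (X 0 [0,4,5,6])) (X 1 [2,3,4,6]))))),
   ([[],[0],[],[0,2],[1,2,3]], Colour (N (N (N (N (N (L 3) (L 1)) (N (L 0) (L 3))) (X 0 [0,1,2,5]))
     (N (N (X 0 [1,5,2,3]) (N (L 0) (X 7 [5,1,3,2,4,0]))) (N (X 2 [0,1,5,2,3]) (N (L 0) (X 1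
     [2,3,4,5]))))) (N (N (N (N (X 0 [0,5,2,4]) (L 1)) (N (X 0 [0,5,2,4]) (X 7 [5,0,4,2,3,1]))) (N (N
     (X 2 [0,1,4,2,5]) (L 1)) (N (X 2 [0,1,4,2,5]) (X 1 [2,3,4,5])))) (N (N (X 0 [1,5,2,3]) (N (X 0
     [0,5,2,4]) (L 2))) (N (N (L 2) (L 2)) (N (L 2) (X 1 [2,3,4,5]))))))
     [(0,[0,1,5,6]),(0,[0,1,5,6]),(0,[0,1,5,6]),(0,[2,3,5,6]),(7,[2,3,6,5,4,0]),(0,[0,1,5,6]),(0,[2,4,5,6]),(7,[2,4,6,5,3,1]),(0,[0,1,5,6]),(0,[2,4,5,6]),(6,[2,4,5,6,3,1,0]),(1,[2,3,5,6]),(0,[2,3,5,6]),(6,[2,3,5,6,4,0,1]),(1,[2,4,5,6]),(1,[0,1,5,6]),(1,[0,1,5,6]),(1,[0,1,5,6]),(1,[0,1,5,6]),(0,[3,4,5,6]),(1,[0,1,5,6]),(1,[0,1,5,6]),(1,[0,1,5,6]),(1,[0,1,5,6]),(1,[0,1,5,6])]),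
   ([[],[0],[0,1]], Colour (N (N (N (L 3) (L 3)) (N (L 3) (L 2))) (N (N (L 3) (L 1)) (N (L 0) (X 1
     [0,1,2,3]))))
     [(0,[0,1,3,4]),(0,[0,1,3,4]),(0,[0,2,3,4]),(0,[1,2,3,4]),(0,[0,1,3,4]),(8,[3,4,0,2,1]),(8,[3,4,1,2,0]),(0,[0,2,3,4]),(8,[3,4,2,1,0]),(1,[1,2,3,4]),(0,[1,2,3,4]),(1,[0,2,3,4]),(1,[0,1,3,4])])]"

lemma steps_K3_ok: "steps_ok 4 (K4_2K2 @ [C5]) steps_K3"
  by code_simp

definition K3 :: rows where
  "K3 = rows_of [[],[0],[0,1]]"

lemma K3_in_steps: "K3 \<in> set (map (rows_of \<circ> fst) steps_K3)"
  by code_simp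

lemma (in sym_graph) no_K3:
  assumes "avoids P" "K3 \<in> set P" "x \<in> V" "y \<in> V" "z \<in> V" "E x y" "E x z"
  shows "\<not> E y z"
proof
  assume "E y z"
  then have "copy [x, y, z] K3"
    using assms(3-) unfolding copy_def K3_def by (auto simp: rows_of_def less_Suc_eq numeral_eq_Suc comm)
  then show False using assms(1,2) by (auto simp: avoids_def)
qed

lemma (in sym_graph) ex_edge:
  assumes "\<not> colorable E M (Suc k)"
  obtains a b where "a \<in> M" "b \<in> M" "E a b"
proof -
  have "\<exists>u\<in>M. \<exists>v\<in>M. E u v"
    using assms unfolding colorable_def by (force intro: exI[of _ "\<lambda>_. 0"])
  then show thesis using that by blast
qed

text \<open>Once the triangle is excluded, the critical graph is triangle-free and not bipartite,
  and every edge meets the neighbourhood of every other edge. Then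
  \<open>pentagon_through_edge\<close> produces a pentagon, which was excluded before.\<close>

theorem colorable_4_if_2K2_K4_free:
  assumes fin: "finite V" and sym: "\<And>u v. E u v \<Longrightarrow> E v u" and irrefl: "\<And>v. \<not> E v v"
    and free_2K2: "\<And>a b c d. {a, b, c, d} \<subseteq> V \<Longrightarrow> E a b \<Longrightarrow> E c d \<Longrightarrow> E a c \<or> E a d \<or> E b c \<or> E b d"
    and free_K4: "\<And>a b c d. {a, b, c, d} \<subseteq> V \<Longrightarrow> E a b \<Longrightarrow> E a c \<Longrightarrow> E a d \<Longrightarrow> E b c \<Longrightarrow> E b d \<Longrightarrow> \<not> E c d"
  shows "colorable E V 4"
proof (rule ccontr)
  assume "\<not> colorable E V 4"
  from ex_critical[OF fin this sym irrefl] obtain W where W: "W \<subseteq> V" "critical_graph E W 4" by blast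
  interpret critical_graph E W 4 by (rule W(2))
  have "\<not> copy xs (rows_of [[],[0],[],[2]])" for xs
  proof
    assume "copy xs (rows_of [[],[0],[],[2]])"
    then show False using free_2K2[OF subset_trans[OF _ W(1)], of "xs ! 0" "xs ! 1" "xs ! 2" "xs ! 3"]
      by (auto simp: copy_def rows_of_def numeral_eq_Suc length_Suc_conv less_Suc_eq comm)
  qed
  moreover have "\<not> copy xs (rows_of [[],[0],[0,1],[0,1,2]])" for xs
  proof
    assume "copy xs (rows_of [[],[0],[0,1],[0,1,2]])"
    then show False using free_K4[OF subset_trans[OF _ W(1)], of "xs ! 0" "xs ! 1" "xs ! 2" "xs ! 3"]
      by (auto simp: copy_def rows_of_def numeral_eq_Suc length_Suc_conv less_Suc_eq comm)
  qed
  ultimately have base: "avoids K4_2K2" by (simp add: avoids_def K4_2K2_def)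
  have "avoids patterns_C5"
    unfolding patterns_C5_def by (rule steps_ok_sound[OF base steps_C5_ok])
  then have C5: "\<not> copy xs C5" for xs using no_C5 by simp
  \<comment> \<open>The pentagon becomes pattern 2 of the second certificate; only now can it be
    used there.\<close>
  then have "avoids (K4_2K2 @ [C5])" using base by (auto simp: avoids_def)
  from steps_ok_sound[OF this steps_K3_ok] have av: "avoids ((K4_2K2 @ [C5]) @ map (rows_of \<circ> fst) steps_K3)" .
  have nc: "\<not> colorable E W 2" using not_colorable colorable_mono by fastforce
  then obtain a b where ab: "a \<in> W" "b \<in> W" "E a b"
    using ex_edge[of W 1] by (auto simp: numeral_2_eq_2)
  have tri: "\<not> E y z" if "x \<in> W" "y \<in> W" "z \<in> W" "E x y" "E x z" for x y z
    using no_K3[OF av _ that] K3_in_steps by auto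
  have dom: "E x a \<or> E x b \<or> E y a \<or> E y b" if "x \<in> W" "y \<in> W" "E x y" for x y
    using free_2K2[OF subset_trans[OF _ W(1)], of x y a b] that ab by auto
  obtain u v z where "u \<in> W" "v \<in> W" "z \<in> W" "E u a" "\<not> E u b" "E v b" "\<not> E v a" "\<not> E v u"
    "E z u" "E z v" "\<not> E z a" "\<not> E z b"
    by (rule pentagon_through_edge[OF nc ab tri dom]) (assumption | rule that)+
  then have "copy [a, b, v, z, u] C5"
    using ab sym by (auto simp: copy_C5_iff)
  then show False using C5 by blast
qed

section \<open>Graphs without 3K2 and K3\<close>

definition K3_3K2 :: "rows list" where
  "K3_3K2 = [K3, rows_of [[],[0],[],[2],[],[4]]]"

text \<open>Each pattern contains two disjoint pentagons, 0 1 2 3 4 and 5 6 8 9 7, and all edges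
  between them join {2, 4} to {7, 8}. The fourth has no such edge. The last has all four of them;
  the two before it are this graph with one more vertex, and are excluded first because its
  certificate refers to them.\<close>

definition steps_3K2 :: "(nat list list \<times> step) list" where
  "steps_3K2 = [
   ([[],[0],[1],[2],[0,3],[],[5],[2,5],[2,6],[7,8]], Colour (N (N (N (N (N (N (N (N (N (N (L 0) (X
     1 [0,1,5,6,9,10])) (X 1 [0,1,5,7,8,10])) (N (X 1 [0,1,6,8,7,10]) (N (L 0) (X 0 [7,9,10])))) (N
     (X 1 [0,4,2,7,6,10]) (N (N (L 2) (X 0 [7,9,10])) (X 0 [6,8,10])))) (N (N (N (X 1 [0,4,2,8,5,10])
     (N (L 3) (X 0 [8,9,10]))) (X 0 [5,7,10])) (X 0 [5,6,10]))) (N (N (X 1 [1,2,4,10,5,6]) (N (N (N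
     (X 1 [0,1,6,10,7,9]) (L 1)) (X 0 [6,8,10])) (N (N (L 1) (X 0 [7,9,10])) (X 0 [6,8,10])))) (N (N
     (N (N (X 1 [0,1,5,10,8,9]) (L 1)) (N (L 1) (X 0 [8,9,10]))) (X 0 [5,7,10])) (X 0 [5,6,10])))) (N
     (N (N (X 1 [0,1,3,10,5,6]) (N (X 1 [0,1,3,10,5,7]) (N (N (X 1 [0,1,3,10,8,9]) (X 0 [7,9,10])) (X
     0 [6,8,10])))) (N (N (N (X 1 [0,1,3,10,6,8]) (N (X 1 [0,1,3,10,7,9]) (X 0 [8,9,10]))) (X 0
     [5,7,10])) (X 0 [5,6,10]))) (X 0 [3,4,10]))) (N (N (N (N (X 1 [0,4,2,10,5,6]) (N (N (N (X 1
     [0,1,6,10,7,9]) (L 2)) (X 0 [2,8,10])) (X 0 [2,7,10]))) (N (N (N (N (X 1 [0,1,5,10,8,9]) (L 3))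
     (X 0 [2,8,10])) (X 0 [2,7,10])) (X 0 [5,6,10]))) (N (N (N (N (N (L 1) (X 1 [0,1,5,6,9,10])) (X 0
     [2,8,10])) (X 0 [2,7,10])) (N (N (N (X 1 [0,1,6,10,7,9]) (L 1)) (X 0 [2,8,10])) (X 0 [2,7,10])))
     (N (N (N (N (X 1 [0,1,5,10,8,9]) (L 1)) (X 0 [2,8,10])) (X 0 [2,7,10])) (X 0 [5,6,10])))) (X 0
     [2,3,10]))) (N (N (N (N (N (X 1 [1,10,3,4,5,6]) (N (X 1 [0,4,2,7,6,10]) (N (N (X 1
     [1,10,3,4,8,9]) (X 0 [7,9,10])) (X 0 [6,8,10])))) (N (N (N (X 1 [0,4,2,8,5,10]) (N (X 1
     [1,10,3,4,7,9]) (X 0 [8,9,10]))) (X 0 [5,7,10])) (X 0 [5,6,10]))) (N (N (N (N (N (L 1) (X 1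
     [2,3,5,6,9,10])) (N (L 1) (X 0 [8,9,10]))) (N (N (L 1) (X 0 [7,9,10])) (N (L 1) (X 0
     [7,9,10])))) (N (N (N (L 1) (L 1)) (X 0 [6,8,10])) (N (N (L 1) (X 0 [7,9,10])) (X 0 [6,8,10]))))
     (N (N (N (N (L 1) (L 1)) (N (L 1) (X 0 [8,9,10]))) (X 0 [5,7,10])) (X 0 [5,6,10])))) (N (N (N (N
     (N (N (L 0) (X 1 [0,4,5,6,9,10])) (X 1 [0,4,5,7,8,10])) (N (X 1 [0,4,6,8,7,10]) (N (L 0) (X 0
     [7,9,10])))) (N (X 1 [0,4,2,7,6,10]) (N (N (L 0) (X 0 [7,9,10])) (X 0 [6,8,10])))) (N (N (N (X 1
     [0,4,2,8,5,10]) (N (L 0) (X 0 [8,9,10]))) (X 0 [5,7,10])) (X 0 [5,6,10]))) (X 0 [3,4,10]))) (X 0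
     [1,2,10]))) (N (N (N (N (N (N (X 1 [0,10,2,3,5,6]) (N (N (N (X 1 [3,4,6,10,7,9]) (L 2)) (X 0
     [6,8,10])) (N (N (L 2) (X 0 [7,9,10])) (X 0 [6,8,10])))) (N (N (N (N (X 1 [3,4,5,10,8,9]) (L 3))
     (N (L 3) (X 0 [8,9,10]))) (X 0 [5,7,10])) (X 0 [5,6,10]))) (X 0 [0,4,10])) (N (N (N (N (N (N (L
     0) (X 1 [1,2,5,6,9,10])) (N (L 0) (X 0 [8,9,10]))) (N (N (L 0) (X 0 [7,9,10])) (N (L 0) (X 0
     [7,9,10])))) (N (N (N (L 2) (L 2)) (X 0 [6,8,10])) (N (N (L 2) (X 0 [7,9,10])) (X 0 [6,8,10]))))
     (N (N (N (N (L 3) (L 3)) (N (L 3) (X 0 [8,9,10]))) (X 0 [5,7,10])) (X 0 [5,6,10]))) (X 0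
     [0,4,10]))) (N (N (N (N (N (N (N (L 2) (X 1 [3,4,5,6,9,10])) (X 0 [2,8,10])) (X 0 [2,7,10])) (N
     (N (N (X 1 [3,4,6,10,7,9]) (L 2)) (X 0 [2,8,10])) (X 0 [2,7,10]))) (N (N (N (N (X 1
     [3,4,5,10,8,9]) (L 3)) (X 0 [2,8,10])) (X 0 [2,7,10])) (X 0 [5,6,10]))) (X 0 [0,4,10])) (X 0
     [2,3,10]))) (X 0 [0,1,10])))
     [(1,[0,1,5,6,10,11]),(1,[0,1,5,6,10,11]),(1,[0,4,2,7,10,11]),(1,[0,4,5,6,10,11]),(1,[0,4,2,8,10,11]),(1,[0,4,2,7,10,11]),(1,[1,2,5,6,10,11]),(1,[1,2,5,6,10,11]),(1,[1,2,5,6,10,11]),(1,[1,2,5,6,10,11]),(0,[7,10,11]),(1,[0,4,5,6,10,11]),(0,[7,10,11]),(0,[7,10,11]),(0,[8,10,11]),(1,[1,2,5,6,10,11]),(0,[8,10,11]),(0,[7,10,11]),(0,[7,10,11]),(0,[6,10,11]),(0,[6,10,11]),(0,[6,10,11]),(0,[6,10,11]),(0,[6,10,11]),(0,[6,10,11]),(0,[6,10,11]),(1,[3,4,8,9,10,11]),(0,[6,10,11]),(0,[5,10,11]),(0,[5,10,11]),(0,[5,10,11]),(0,[5,10,11]),(0,[5,10,11]),(0,[5,10,11]),(0,[5,10,11]),(0,[5,10,11]),(0,[4,10,11]),(0,[4,10,11]),(0,[4,10,11]),(0,[4,10,11]),(0,[4,10,11]),(0,[4,10,11]),(0,[4,1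0,11]),(0,[4,10,11]),(0,[4,10,11]),(0,[4,10,11]),(0,[4,10,11]),(0,[4,10,11]),(0,[4,10,11]),(0,[4,10,11]),(0,[4,10,11]),(0,[4,10,11]),(0,[4,10,11]),(0,[4,10,11]),(0,[4,10,11]),(0,[4,10,11]),(0,[4,10,11]),(0,[4,10,11]),(0,[4,10,11]),(0,[4,10,11]),(0,[4,10,11]),(0,[4,10,11]),(0,[4,10,11]),(0,[4,10,11]),(0,[4,10,11]),(0,[4,10,11]),(0,[4,10,11]),(0,[4,10,11]),(0,[4,10,11]),(0,[4,10,11]),(0,[4,10,11]),(0,[4,10,11]),(0,[4,10,11]),(0,[4,10,11]),(0,[4,10,11]),(0,[4,10,11]),(0,[4,10,11]),(0,[4,10,11]),(0,[4,10,11]),(0,[4,10,11]),(0,[4,10,11]),(0,[4,10,11]),(0,[4,10,11]),(0,[4,10,11]),(0,[4,10,11]),(0,[4,10,11]),(0,[4,10,11]),(0,[4,10,11]),(0,[4,10,11]),(0,[4,10,11]),(0,[4,10,11]),(0,[4,10,11]),(0,[4,10,11]),(0,[4,10,11]),(0,[4,10,11]),(0,[4,10,11]),(0,[4,10,11]),(0,[4,10,11]),(0,[2,10,11]),(0,[6,10,11]),(0,[6,10,11]),(0,[6,10,11]),(0,[6,10,11]),(0,[6,10,11]),(0,[2,10,11]),(0,[2,10,11]),(0,[2,10,11]),(0,[5,10,11]),(0,[5,10,11]),(0,[5,10,11]),(0,[5,10,11]),(0,[5,10,11]),(0,[2,10,11]),(0,[2,10,11]),(0,[2,10,11]),(0,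[2,10,11]),(0,[4,10,11]),(0,[4,10,11]),(0,[4,10,11]),(0,[4,10,11]),(0,[4,10,11]),(0,[4,10,11]),(0,[4,10,11]),(0,[4,10,11]),(0,[4,10,11]),(0,[4,10,11]),(0,[2,10,11]),(0,[2,10,11]),(0,[4,10,11]),(0,[4,10,11]),(0,[4,10,11]),(0,[4,10,11]),(0,[4,10,11]),(0,[4,10,11]),(0,[4,10,11]),(0,[4,10,11]),(0,[4,10,11]),(0,[4,10,11]),(0,[2,10,11]),(0,[4,10,11]),(0,[4,10,11]),(0,[4,10,11]),(0,[4,10,11]),(0,[4,10,11]),(0,[4,10,11]),(0,[4,10,11]),(0,[4,10,11]),(0,[4,10,11]),(0,[4,10,11]),(0,[1,10,11]),(0,[1,10,11]),(0,[1,10,11]),(0,[1,10,11]),(0,[1,10,11]),(0,[1,10,11]),(0,[1,10,11]),(0,[1,10,11]),(0,[1,10,11]),(0,[1,10,11]),(0,[1,10,11]),(0,[1,10,11]),(0,[1,10,11]),(0,[1,10,11]),(0,[1,10,11]),(0,[1,10,11]),(0,[1,10,11]),(0,[1,10,11]),(0,[1,10,11]),(0,[1,10,11]),(0,[1,10,11]),(0,[1,10,11]),(0,[1,10,11]),(0,[1,10,11]),(0,[1,10,11]),(0,[1,10,11]),(0,[1,10,11]),(0,[1,10,11]),(0,[1,10,11]),(0,[1,10,11]),(0,[1,10,11]),(0,[1,10,11]),(0,[1,10,11]),(0,[1,10,11]),(0,[1,10,11]),(0,[1,10,11]),(0,[1,10,11]),(0,[1,10,11]),(0,[1,10,11]),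(0,[1,10,11]),(0,[1,10,11]),(0,[1,10,11]),(0,[1,10,11]),(0,[1,10,11]),(0,[1,10,11]),(0,[1,10,11]),(0,[1,10,11]),(0,[1,10,11]),(0,[1,10,11]),(0,[1,10,11]),(0,[1,10,11]),(0,[1,10,11]),(0,[1,10,11]),(0,[1,10,11]),(0,[1,10,11]),(0,[1,10,11]),(0,[1,10,11]),(0,[1,10,11]),(0,[1,10,11]),(0,[3,10,11]),(0,[3,10,11]),(0,[3,10,11]),(0,[3,10,11]),(0,[1,10,11]),(0,[1,10,11]),(0,[1,10,11]),(0,[3,10,11]),(0,[3,10,11]),(0,[3,10,11]),(0,[3,10,11]),(0,[1,10,11]),(0,[1,10,11]),(0,[3,10,11]),(0,[3,10,11]),(0,[3,10,11]),(0,[3,10,11]),(0,[1,10,11]),(0,[3,10,11]),(0,[3,10,11]),(0,[3,10,11]),(0,[3,10,11]),(0,[0,10,11]),(0,[0,10,11]),(0,[0,10,11]),(0,[0,10,11]),(0,[0,10,11]),(0,[0,10,11]),(0,[0,10,11]),(0,[0,10,11]),(0,[0,10,11]),(0,[0,10,11]),(0,[0,10,11]),(0,[0,10,11]),(0,[0,10,11]),(0,[0,10,11]),(0,[0,10,11]),(0,[0,10,11]),(0,[0,10,11]),(0,[0,10,11]),(0,[0,10,11]),(0,[0,10,11]),(0,[0,10,11]),(0,[0,10,11]),(0,[0,10,11]),(0,[0,10,11]),(0,[0,10,11]),(0,[0,10,11]),(0,[0,10,11]),(0,[0,10,11]),(0,[0,10,11]),(0,[0,10,11]),(0,[0,10,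11]),(0,[0,10,11]),(0,[0,10,11]),(0,[0,10,11]),(0,[0,10,11]),(0,[0,10,11]),(0,[0,10,11]),(0,[0,10,11]),(0,[0,10,11]),(0,[0,10,11]),(0,[0,10,11]),(0,[0,10,11]),(0,[0,10,11]),(0,[0,10,11]),(0,[0,10,11]),(0,[0,10,11]),(0,[0,10,11]),(0,[0,10,11]),(0,[0,10,11]),(0,[0,10,11]),(0,[0,10,11]),(0,[0,10,11]),(0,[0,10,11]),(0,[0,10,11]),(0,[0,10,11]),(0,[0,10,11]),(0,[0,10,11]),(0,[0,10,11]),(0,[0,10,11])]),
   ([[],[0],[1],[2],[0,3],[],[5],[2,4,5],[4,6],[7,8]], Colour (N (N (N (N (N (N (N (N (N (N (L 1)
     (X 1 [0,1,5,6,9,10])) (X 1 [0,1,5,7,8,10])) (N (X 1 [0,1,6,8,7,10]) (N (L 2) (X 0 [7,9,10]))))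
     (N (N (N (X 1 [0,1,6,10,7,9]) (X 2 [6,5,7,9,10,0,1,4,2,3])) (X 0 [6,8,10])) (N (N (L 3) (X 0
     [7,9,10])) (X 0 [6,8,10])))) (N (N (N (X 1 [1,2,4,8,5,10]) (N (L 2) (X 0 [8,9,10]))) (X 0
     [5,7,10])) (X 0 [5,6,10]))) (N (N (X 1 [1,2,4,10,5,6]) (N (N (N (X 1 [0,1,6,10,7,9]) (L 3)) (X 0
     [4,8,10])) (X 0 [4,7,10]))) (N (N (N (N (X 1 [0,1,5,10,8,9]) (X 2 [1,0,4,3,2,5,6,10,8,9])) (X 0
     [4,8,10])) (X 0 [4,7,10])) (X 0 [5,6,10])))) (N (N (N (X 1 [0,1,3,10,5,6]) (N (X 1
     [0,1,3,10,5,7]) (N (N (X 1 [0,1,3,10,8,9]) (X 0 [7,9,10])) (X 0 [6,8,10])))) (N (N (N (X 1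
     [0,1,3,10,6,8]) (N (X 1 [0,1,3,10,7,9]) (X 0 [8,9,10]))) (X 0 [5,7,10])) (X 0 [5,6,10]))) (X 0
     [3,4,10]))) (N (N (N (N (X 1 [0,4,2,10,5,6]) (N (N (N (X 1 [0,1,6,10,7,9]) (L 0)) (X 0
     [6,8,10])) (X 0 [2,7,10]))) (N (N (N (N (X 1 [0,1,5,10,8,9]) (L 0)) (N (L 0) (X 0 [8,9,10]))) (X
     0 [2,7,10])) (X 0 [5,6,10]))) (N (N (N (N (N (L 0) (X 1 [0,1,5,6,9,10])) (X 0 [4,8,10])) (X 0
     [2,7,10])) (N (N (N (X 1 [0,1,6,10,7,9]) (L 0)) (X 0 [4,8,10])) (X 0 [2,7,10]))) (N (N (N (N (X
     1 [0,1,5,10,8,9]) (L 0)) (X 0 [4,8,10])) (X 0 [2,7,10])) (X 0 [5,6,10])))) (X 0 [2,3,10]))) (N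
     (N (N (N (N (X 1 [1,10,3,4,5,6]) (N (N (N (L 1) (L 3)) (X 0 [6,8,10])) (N (N (L 1) (X 0
     [7,9,10])) (X 0 [6,8,10])))) (N (N (N (N (X 1 [2,3,5,10,8,9]) (L 1)) (N (L 2) (X 0 [8,9,10])))
     (X 0 [5,7,10])) (X 0 [5,6,10]))) (N (N (N (N (N (L 1) (X 1 [2,3,5,6,9,10])) (X 0 [4,8,10])) (X 0
     [4,7,10])) (N (N (N (L 1) (L 3)) (X 0 [4,8,10])) (X 0 [4,7,10]))) (N (N (N (N (X 1
     [2,3,5,10,8,9]) (L 1)) (X 0 [4,8,10])) (X 0 [4,7,10])) (X 0 [5,6,10])))) (N (N (N (N (N (N (X 2
     [1,0,4,3,10,5,6,7,8,9]) (X 1 [0,4,5,6,9,10])) (N (L 1) (X 0 [8,9,10]))) (N (N (L 1) (X 0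
     [7,9,10])) (N (L 1) (X 0 [7,9,10])))) (N (N (N (L 3) (L 3)) (X 0 [6,8,10])) (N (N (L 3) (X 0
     [7,9,10])) (X 0 [6,8,10])))) (N (N (N (N (L 1) (L 1)) (N (L 2) (X 0 [8,9,10]))) (X 0 [5,7,10]))
     (X 0 [5,6,10]))) (X 0 [3,4,10]))) (X 0 [1,2,10]))) (N (N (N (N (N (N (X 1 [0,10,2,3,5,6]) (N (N
     (N (X 1 [0,10,2,3,8,9]) (L 3)) (X 0 [6,8,10])) (N (N (X 1 [0,10,2,3,8,9]) (X 0 [7,9,10])) (X 0
     [6,8,10])))) (N (N (N (X 1 [0,10,2,3,6,8]) (N (L 2) (X 0 [8,9,10]))) (X 0 [5,7,10])) (X 0
     [5,6,10]))) (X 0 [0,4,10])) (N (N (N (N (N (X 1 [0,10,2,7,6,8]) (N (L 2) (X 0 [8,9,10]))) (N (N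
     (X 2 [6,5,7,9,8,0,1,10,2,3]) (X 0 [7,9,10])) (N (L 2) (X 0 [7,9,10])))) (N (N (N (L 3) (L 3)) (X
     0 [6,8,10])) (N (N (L 3) (X 0 [7,9,10])) (X 0 [6,8,10])))) (N (N (N (X 1 [0,10,2,7,6,8]) (N (L
     2) (X 0 [8,9,10]))) (X 0 [5,7,10])) (X 0 [5,6,10]))) (X 0 [0,4,10]))) (N (N (N (N (N (N (N (L 0)
     (X 1 [3,4,5,6,9,10])) (N (L 0) (X 0 [8,9,10]))) (X 0 [2,7,10])) (N (N (N (L 0) (L 0)) (X 0
     [6,8,10])) (X 0 [2,7,10]))) (N (N (N (N (L 0) (L 0)) (N (L 0) (X 0 [8,9,10]))) (X 0 [2,7,10]))
     (X 0 [5,6,10]))) (X 0 [0,4,10])) (X 0 [2,3,10]))) (X 0 [0,1,10])))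
     [(1,[0,1,5,6,10,11]),(1,[2,3,8,9,10,11]),(1,[2,3,8,9,10,11]),(1,[2,3,6,8,10,11]),(1,[2,3,5,6,10,11]),(1,[2,3,8,9,10,11]),(1,[2,3,6,8,10,11]),(1,[0,4,5,6,10,11]),(1,[0,4,5,6,10,11]),(1,[0,4,5,6,10,11]),(1,[2,7,6,8,10,11]),(1,[2,7,6,8,10,11]),(0,[7,10,11]),(0,[8,10,11]),(0,[8,10,11]),(0,[8,10,11]),(0,[8,10,11]),(0,[8,10,11]),(0,[7,10,11]),(0,[8,10,11]),(0,[6,10,11]),(0,[6,10,11]),(0,[6,10,11]),(0,[6,10,11]),(0,[6,10,11]),(0,[6,10,11]),(0,[6,10,11]),(0,[6,10,11]),(0,[6,10,11]),(0,[6,10,11]),(0,[6,10,11]),(0,[5,10,11]),(0,[5,10,11]),(0,[5,10,11]),(0,[5,10,11]),(0,[8,10,11]),(0,[8,10,11]),(0,[5,10,11]),(0,[4,10,11]),(0,[6,10,11]),(0,[4,10,11]),(0,[6,10,11]),(0,[6,10,11]),(0,[6,10,11]),(0,[6,10,11]),(0,[6,10,11]),(0,[6,10,11]),(0,[6,10,11]),(0,[2,10,11]),(0,[2,10,11]),(0,[2,10,11]),(0,[2,10,11]),(0,[2,10,11]),(0,[2,10,11]),(0,[2,10,11]),(0,[2,10,11]),(0,[2,10,11]),(0,[2,10,11]),(0,[2,10,11]),(0,[2,10,11]),(0,[2,10,11]),(0,[2,10,11]),(0,[2,10,11]),(0,[2,10,11]),(0,[2,10,11]),(0,[2,10,11]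),(0,[2,10,11]),(0,[2,10,11]),(0,[2,10,11]),(0,[2,10,11]),(0,[2,10,11]),(0,[2,10,11]),(0,[2,10,11]),(0,[2,10,11]),(0,[2,10,11]),(0,[2,10,11]),(0,[2,10,11]),(0,[2,10,11]),(0,[2,10,11]),(0,[2,10,11]),(0,[2,10,11]),(0,[2,10,11]),(0,[2,10,11]),(0,[2,10,11]),(0,[2,10,11]),(0,[2,10,11]),(0,[2,10,11]),(0,[2,10,11]),(0,[2,10,11]),(0,[2,10,11]),(0,[2,10,11]),(0,[2,10,11]),(0,[2,10,11]),(0,[2,10,11]),(0,[2,10,11]),(0,[2,10,11]),(0,[2,10,11]),(0,[2,10,11]),(0,[2,10,11]),(0,[2,10,11]),(0,[2,10,11]),(0,[2,10,11]),(0,[2,10,11]),(0,[2,10,11]),(0,[2,10,11]),(0,[2,10,11]),(0,[2,10,11]),(0,[2,10,11]),(0,[2,10,11]),(0,[2,10,11]),(0,[2,10,11]),(0,[1,10,11]),(0,[1,10,11]),(0,[1,10,11]),(0,[1,10,11]),(0,[1,10,11]),(0,[1,10,11]),(0,[1,10,11]),(0,[1,10,11]),(0,[1,10,11]),(0,[1,10,11]),(0,[1,10,11]),(0,[1,10,11]),(0,[1,10,11]),(0,[1,10,11]),(0,[1,10,11]),(0,[1,10,11]),(0,[6,10,11]),(0,[6,10,11]),(0,[6,10,11]),(0,[6,10,11]),(0,[1,10,11]),(0,[1,10,11]),(0,[1,10,11]),(0,[1,10,11]),(0,[1,10,11]),(0,[1,10,11]),(0,[1,10,11]),(0,[1,1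0,11]),(0,[1,10,11]),(0,[1,10,11]),(0,[1,10,11]),(0,[1,10,11]),(0,[1,10,11]),(0,[1,10,11]),(0,[1,10,11]),(0,[1,10,11]),(0,[1,10,11]),(0,[1,10,11]),(0,[1,10,11]),(0,[1,10,11]),(0,[1,10,11]),(0,[5,10,11]),(0,[8,10,11]),(0,[8,10,11]),(0,[5,10,11]),(0,[1,10,11]),(0,[1,10,11]),(0,[1,10,11]),(0,[1,10,11]),(0,[1,10,11]),(0,[1,10,11]),(0,[1,10,11]),(0,[1,10,11]),(0,[1,10,11]),(0,[1,10,11]),(0,[1,10,11]),(0,[1,10,11]),(0,[1,10,11]),(0,[1,10,11]),(0,[1,10,11]),(0,[1,10,11]),(0,[1,10,11]),(0,[1,10,11]),(0,[1,10,11]),(0,[6,10,11]),(0,[6,10,11]),(0,[6,10,11]),(0,[6,10,11]),(0,[1,10,11]),(0,[1,10,11]),(0,[1,10,11]),(0,[1,10,11]),(0,[1,10,11]),(0,[1,10,11]),(0,[1,10,11]),(0,[1,10,11]),(0,[1,10,11]),(0,[1,10,11]),(0,[1,10,11]),(0,[1,10,11]),(0,[1,10,11]),(0,[1,10,11]),(0,[1,10,11]),(0,[1,10,11]),(0,[1,10,11]),(0,[1,10,11]),(0,[1,10,11]),(0,[1,10,11]),(0,[1,10,11]),(0,[6,10,11]),(0,[3,10,11]),(0,[3,10,11]),(0,[3,10,11]),(0,[1,10,11]),(0,[1,10,11]),(0,[6,10,11]),(0,[3,10,11]),(0,[3,10,11]),(0,[3,10,11]),(0,[1,10,11]),(0,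[6,10,11]),(0,[3,10,11]),(0,[3,10,11]),(0,[3,10,11]),(0,[1,10,11]),(0,[1,10,11]),(0,[1,10,11]),(0,[1,10,11]),(0,[5,10,11]),(0,[3,10,11]),(0,[3,10,11]),(0,[3,10,11]),(0,[0,10,11]),(0,[0,10,11]),(0,[0,10,11]),(0,[0,10,11]),(0,[0,10,11]),(0,[0,10,11]),(0,[0,10,11]),(0,[0,10,11]),(0,[0,10,11]),(0,[0,10,11]),(0,[0,10,11]),(0,[0,10,11]),(0,[0,10,11]),(0,[0,10,11]),(0,[0,10,11]),(0,[0,10,11]),(0,[0,10,11]),(0,[0,10,11]),(0,[0,10,11]),(0,[0,10,11]),(0,[0,10,11]),(0,[0,10,11]),(0,[0,10,11]),(0,[0,10,11]),(0,[0,10,11]),(0,[0,10,11]),(0,[0,10,11]),(0,[0,10,11]),(0,[0,10,11]),(0,[0,10,11]),(0,[0,10,11]),(0,[0,10,11]),(0,[0,10,11]),(0,[0,10,11]),(0,[0,10,11]),(0,[0,10,11]),(0,[0,10,11]),(0,[0,10,11]),(0,[0,10,11]),(0,[0,10,11]),(0,[0,10,11]),(0,[0,10,11]),(0,[0,10,11]),(0,[0,10,11]),(0,[0,10,11]),(0,[0,10,11]),(0,[0,10,11]),(0,[0,10,11])]),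
   ([[],[0],[1],[2],[0,3],[],[5],[2,5],[4,6],[7,8]], Colour (N (N (N (N (N (N (N (N (N (N (L 0) (X
     1 [0,1,5,6,9,10])) (X 1 [0,1,5,7,8,10])) (N (X 1 [0,1,6,8,7,10]) (N (L 0) (X 0 [7,9,10])))) (N
     (X 1 [0,4,2,7,6,10]) (N (N (L 1) (X 0 [7,9,10])) (X 0 [6,8,10])))) (N (N (N (X 1 [1,2,4,8,5,10])
     (N (L 0) (X 0 [8,9,10]))) (X 0 [5,7,10])) (X 0 [5,6,10]))) (N (N (X 1 [1,2,4,10,5,6]) (N (N (N
     (X 1 [0,1,6,10,7,9]) (L 1)) (X 0 [4,8,10])) (N (N (L 1) (X 0 [7,9,10])) (X 0 [4,8,10])))) (N (N
     (N (N (X 1 [0,1,5,10,8,9]) (X 2 [1,0,4,3,2,5,6,10,8,9])) (X 0 [4,8,10])) (X 0 [5,7,10])) (X 0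
     [5,6,10])))) (N (N (N (X 1 [0,1,3,10,5,6]) (N (X 1 [0,1,3,10,5,7]) (N (N (X 1 [0,1,3,10,8,9]) (X
     0 [7,9,10])) (X 0 [6,8,10])))) (N (N (N (X 1 [0,1,3,10,6,8]) (N (X 1 [0,1,3,10,7,9]) (X 0
     [8,9,10]))) (X 0 [5,7,10])) (X 0 [5,6,10]))) (X 0 [3,4,10]))) (N (N (N (N (X 1 [0,4,2,10,5,6])
     (N (N (N (X 1 [0,1,6,10,7,9]) (X 2 [0,1,2,3,4,5,6,7,10,9])) (X 0 [6,8,10])) (X 0 [2,7,10]))) (N
     (N (N (N (X 1 [0,1,5,10,8,9]) (L 2)) (N (L 0) (X 0 [8,9,10]))) (X 0 [2,7,10])) (X 0 [5,6,10])))
     (N (N (N (N (N (L 0) (X 1 [0,1,5,6,9,10])) (X 0 [4,8,10])) (X 0 [2,7,10])) (N (N (N (X 1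
     [0,1,6,10,7,9]) (X 3 [1,0,4,3,2,6,5,10,7,9])) (X 0 [4,8,10])) (X 0 [2,7,10]))) (N (N (N (N (X 1
     [0,1,5,10,8,9]) (X 3 [0,1,2,3,4,5,6,10,8,9])) (X 0 [4,8,10])) (X 0 [2,7,10])) (X 0 [5,6,10]))))
     (X 0 [2,3,10]))) (N (N (N (N (N (X 1 [1,10,3,4,5,6]) (N (X 1 [0,4,2,7,6,10]) (N (N (L 1) (X 0
     [7,9,10])) (X 0 [6,8,10])))) (N (N (N (N (X 1 [1,10,3,4,7,9]) (L 2)) (N (X 1 [1,10,3,4,7,9]) (X
     0 [8,9,10]))) (X 0 [5,7,10])) (X 0 [5,6,10]))) (N (N (N (N (N (L 1) (X 1 [2,3,5,6,9,10])) (X 0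
     [4,8,10])) (N (N (L 1) (X 0 [7,9,10])) (X 0 [4,8,10]))) (N (N (N (L 1) (L 1)) (X 0 [4,8,10])) (N
     (N (L 1) (X 0 [7,9,10])) (X 0 [4,8,10])))) (N (N (N (N (X 1 [2,3,5,10,8,9]) (X 3
     [3,2,1,0,4,5,6,10,8,9])) (X 0 [4,8,10])) (X 0 [5,7,10])) (X 0 [5,6,10])))) (N (N (N (N (N (X 1
     [1,10,4,8,5,7]) (N (X 2 [5,6,8,9,7,0,1,4,10,3]) (X 0 [8,9,10]))) (N (N (L 1) (X 0 [7,9,10])) (N
     (X 3 [1,0,4,3,10,6,5,8,7,9]) (X 0 [7,9,10])))) (N (X 1 [0,4,2,7,6,10]) (N (N (L 1) (X 0
     [7,9,10])) (X 0 [6,8,10])))) (N (N (N (N (L 2) (L 2)) (N (X 3 [1,0,4,3,10,9,7,8,5,6]) (X 0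
     [8,9,10]))) (X 0 [5,7,10])) (X 0 [5,6,10]))) (X 0 [3,4,10]))) (X 0 [1,2,10]))) (N (N (N (N (N (N
     (X 1 [0,10,2,3,5,6]) (N (N (N (X 1 [0,10,2,3,8,9]) (L 2)) (X 0 [6,8,10])) (N (N (X 1
     [0,10,2,3,8,9]) (X 0 [7,9,10])) (X 0 [6,8,10])))) (N (N (N (X 1 [0,10,2,3,6,8]) (N (L 2) (X 0
     [8,9,10]))) (X 0 [5,7,10])) (X 0 [5,6,10]))) (X 0 [0,4,10])) (N (N (N (N (N (X 1 [0,10,2,7,6,8])
     (N (L 2) (X 0 [8,9,10]))) (N (N (X 2 [6,5,7,9,8,0,1,10,2,3]) (X 0 [7,9,10])) (N (X 3
     [0,1,2,3,10,5,6,7,8,9]) (X 0 [7,9,10])))) (N (N (N (L 2) (L 2)) (X 0 [6,8,10])) (N (N (X 3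
     [0,1,2,3,10,9,8,7,6,5]) (X 0 [7,9,10])) (X 0 [6,8,10])))) (N (N (N (X 1 [0,10,2,7,6,8]) (N (L 2)
     (X 0 [8,9,10]))) (X 0 [5,7,10])) (X 0 [5,6,10]))) (X 0 [0,4,10]))) (N (N (N (N (N (N (N (L 0) (X
     1 [3,4,5,6,9,10])) (N (L 0) (X 0 [8,9,10]))) (X 0 [2,7,10])) (N (N (N (X 1 [3,4,6,10,7,9]) (X 3
     [3,4,0,1,2,6,5,10,7,9])) (X 0 [6,8,10])) (X 0 [2,7,10]))) (N (N (N (N (L 2) (L 2)) (N (L 0) (X 0
     [8,9,10]))) (X 0 [2,7,10])) (X 0 [5,6,10]))) (X 0 [0,4,10])) (X 0 [2,3,10]))) (X 0 [0,1,10])))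
     [(1,[0,1,5,6,10,11]),(1,[0,1,5,6,10,11]),(1,[0,1,7,9,10,11]),(1,[0,1,7,9,10,11]),(1,[0,1,5,6,10,11]),(1,[3,4,5,6,10,11]),(1,[3,4,5,6,10,11]),(1,[3,4,7,9,10,11]),(0,[7,10,11]),(0,[8,10,11]),(0,[8,10,11]),(1,[0,1,5,6,10,11]),(1,[3,4,5,6,10,11]),(0,[8,10,11]),(0,[8,10,11]),(0,[6,10,11]),(0,[6,10,11]),(0,[6,10,11]),(0,[6,10,11]),(1,[2,3,8,9,10,11]),(0,[7,10,11]),(0,[6,10,11]),(0,[6,10,11]),(0,[6,10,11]),(0,[7,10,11]),(0,[6,10,11]),(0,[5,10,11]),(0,[5,10,11]),(1,[0,1,7,9,10,11]),(1,[3,4,7,9,10,11]),(0,[8,10,11]),(0,[5,10,11]),(0,[4,10,11]),(0,[4,10,11]),(0,[6,10,11]),(0,[4,10,11]),(0,[4,10,11]),(0,[4,10,11]),(0,[4,10,11]),(0,[4,10,11]),(3,[1,0,4,3,11,6,5,10,7,9]),(0,[6,10,11]),(0,[4,10,11]),(0,[6,10,11]),(0,[4,10,11]),(0,[4,10,11]),(0,[4,10,11]),(0,[4,10,11]),(0,[4,10,11]),(0,[7,10,11]),(0,[6,10,11]),(0,[2,10,11]),(0,[5,10,11]),(0,[5,10,11]),(0,[5,10,11]),(0,[9,10,11]),(0,[5,10,11]),(3,[0,1,2,3,11,5,6,10,8,9]),(3,[0,1,2,3,11,9,8,10,6,5]),(0,[9,10,11]),(0,[5,10,11]),(0,[2,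10,11]),(0,[2,10,11]),(0,[2,10,11]),(0,[2,10,11]),(0,[2,10,11]),(0,[2,10,11]),(0,[2,10,11]),(0,[2,10,11]),(0,[2,10,11]),(0,[2,10,11]),(0,[2,10,11]),(0,[1,10,11]),(0,[1,10,11]),(0,[1,10,11]),(0,[1,10,11]),(0,[1,10,11]),(0,[1,10,11]),(0,[1,10,11]),(0,[1,10,11]),(0,[1,10,11]),(0,[1,10,11]),(0,[1,10,11]),(0,[9,10,11]),(0,[5,10,11]),(3,[3,2,1,0,11,5,6,10,8,9]),(1,[2,7,4,8,10,11]),(0,[9,10,11]),(0,[5,10,11]),(0,[5,10,11]),(0,[5,10,11]),(0,[1,10,11]),(0,[1,10,11]),(0,[1,10,11]),(0,[1,10,11]),(0,[1,10,11]),(0,[1,10,11]),(0,[1,10,11]),(0,[1,10,11]),(0,[1,10,11]),(0,[1,10,11]),(0,[1,10,11]),(0,[1,10,11]),(0,[1,10,11]),(0,[1,10,11]),(0,[1,10,11]),(0,[1,10,11]),(0,[1,10,11]),(0,[1,10,11]),(0,[1,10,11]),(0,[1,10,11]),(0,[1,10,11]),(0,[1,10,11]),(0,[1,10,11]),(0,[1,10,11]),(0,[1,10,11]),(0,[1,10,11]),(0,[1,10,11]),(0,[1,10,11]),(0,[1,10,11]),(0,[1,10,11]),(1,[2,7,4,8,10,11]),(0,[5,10,11]),(0,[3,10,11]),(0,[3,10,11]),(0,[3,10,11]),(0,[3,10,11]),(0,[5,10,11]),(0,[5,10,11]),(0,[1,10,11]),(0,[9,10,11]),(0,[5,10,11]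),(0,[3,10,11]),(0,[3,10,11]),(0,[3,10,11]),(0,[3,10,11]),(0,[5,10,11]),(0,[5,10,11]),(0,[0,10,11]),(0,[0,10,11]),(0,[0,10,11]),(0,[0,10,11]),(0,[0,10,11]),(0,[0,10,11]),(0,[0,10,11]),(0,[0,10,11]),(0,[0,10,11]),(0,[0,10,11]),(0,[0,10,11]),(0,[0,10,11]),(0,[0,10,11]),(0,[0,10,11]),(0,[0,10,11]),(0,[0,10,11]),(0,[0,10,11]),(0,[0,10,11]),(0,[0,10,11]),(0,[0,10,11]),(0,[0,10,11]),(0,[0,10,11]),(0,[0,10,11]),(0,[0,10,11]),(0,[0,10,11]),(0,[0,10,11]),(0,[0,10,11]),(0,[0,10,11]),(0,[0,10,11]),(0,[0,10,11]),(0,[0,10,11]),(0,[0,10,11]),(0,[0,10,11]),(0,[0,10,11]),(0,[0,10,11]),(0,[0,10,11]),(0,[0,10,11]),(0,[0,10,11]),(0,[0,10,11]),(0,[0,10,11]),(0,[0,10,11]),(0,[0,10,11])]),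
   ([[],[0],[1],[2],[0,3],[],[5],[5],[6],[7,8]], Colour (N (N (N (N (N (N (N (N (N (N (L 0) (X 1
     [0,1,5,6,9,10])) (X 1 [0,1,5,7,8,10])) (N (X 1 [0,1,6,8,7,10]) (N (L 0) (X 0 [7,9,10])))) (N (N
     (N (X 1 [0,1,6,10,7,9]) (L 2)) (X 0 [6,8,10])) (N (N (L 0) (X 0 [7,9,10])) (X 0 [6,8,10])))) (N
     (N (N (N (X 1 [0,1,5,10,8,9]) (L 1)) (N (L 1) (X 0 [8,9,10]))) (X 0 [5,7,10])) (X 0 [5,6,10])))
     (N (N (X 1 [1,2,4,10,5,6]) (N (X 1 [1,2,4,10,5,7]) (N (N (X 1 [1,2,4,10,8,9]) (X 0 [7,9,10])) (X
     0 [6,8,10])))) (N (N (N (X 1 [1,2,4,10,6,8]) (N (X 1 [1,2,4,10,7,9]) (X 0 [8,9,10]))) (X 0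
     [5,7,10])) (X 0 [5,6,10])))) (N (N (N (X 1 [0,1,3,10,5,6]) (N (X 1 [0,1,3,10,5,7]) (N (N (X 1
     [0,1,3,10,8,9]) (X 0 [7,9,10])) (X 0 [6,8,10])))) (N (N (N (X 1 [0,1,3,10,6,8]) (N (X 1
     [0,1,3,10,7,9]) (X 0 [8,9,10]))) (X 0 [5,7,10])) (X 0 [5,6,10]))) (X 0 [3,4,10]))) (N (N (N (N
     (X 1 [0,4,2,10,5,6]) (N (X 1 [0,4,2,10,5,7]) (N (N (X 1 [0,4,2,10,8,9]) (X 0 [7,9,10])) (X 0
     [6,8,10])))) (N (N (N (X 1 [0,4,2,10,6,8]) (N (X 1 [0,4,2,10,7,9]) (X 0 [8,9,10]))) (X 0
     [5,7,10])) (X 0 [5,6,10]))) (N (N (N (N (N (L 2) (X 1 [0,1,5,6,9,10])) (X 1 [0,1,5,7,8,10])) (N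
     (X 1 [0,1,6,8,7,10]) (X 2 [5,7,10,8,6,0,1,4,2,3]))) (N (N (N (X 1 [0,1,6,10,7,9]) (X 2
     [0,4,10,2,1,5,7,6,9,8])) (X 0 [6,8,10])) (N (N (X 2 [0,4,10,2,1,8,9,6,7,5]) (X 0 [7,9,10])) (X 0
     [6,8,10])))) (N (N (N (N (X 1 [0,1,5,10,8,9]) (X 2 [0,4,10,2,1,6,8,5,9,7])) (N (X 2
     [0,4,10,2,1,7,9,5,8,6]) (X 0 [8,9,10]))) (X 0 [5,7,10])) (X 0 [5,6,10])))) (X 0 [2,3,10]))) (N
     (N (N (N (N (X 1 [1,10,3,4,5,6]) (N (X 1 [1,10,3,4,5,7]) (N (N (X 1 [1,10,3,4,8,9]) (X 0
     [7,9,10])) (X 0 [6,8,10])))) (N (N (N (X 1 [1,10,3,4,6,8]) (N (X 1 [1,10,3,4,7,9]) (X 0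
     [8,9,10]))) (X 0 [5,7,10])) (X 0 [5,6,10]))) (N (N (N (N (N (L 1) (X 1 [2,3,5,6,9,10])) (X 1
     [2,3,5,7,8,10])) (N (X 1 [2,3,6,8,7,10]) (X 2 [5,7,10,8,6,2,3,1,4,0]))) (N (N (N (X 1
     [2,3,6,10,7,9]) (X 2 [2,1,10,4,3,5,7,6,9,8])) (X 0 [6,8,10])) (N (N (X 2 [2,1,10,4,3,8,9,6,7,5])
     (X 0 [7,9,10])) (X 0 [6,8,10])))) (N (N (N (N (X 1 [2,3,5,10,8,9]) (X 2 [2,1,10,4,3,6,8,5,9,7]))
     (N (X 2 [2,1,10,4,3,7,9,5,8,6]) (X 0 [8,9,10]))) (X 0 [5,7,10])) (X 0 [5,6,10])))) (N (N (N (N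
     (N (N (L 1) (X 1 [0,4,5,6,9,10])) (X 1 [0,4,5,7,8,10])) (N (X 1 [0,4,6,8,7,10]) (X 2
     [5,7,10,8,6,0,4,1,3,2]))) (N (N (N (X 1 [0,4,6,10,7,9]) (X 2 [0,1,10,3,4,5,7,6,9,8])) (X 0
     [6,8,10])) (N (N (X 2 [0,1,10,3,4,8,9,6,7,5]) (X 0 [7,9,10])) (X 0 [6,8,10])))) (N (N (N (N (X 1
     [0,4,5,10,8,9]) (X 2 [0,1,10,3,4,6,8,5,9,7])) (N (X 2 [0,1,10,3,4,7,9,5,8,6]) (X 0 [8,9,10])))
     (X 0 [5,7,10])) (X 0 [5,6,10]))) (X 0 [3,4,10]))) (X 0 [1,2,10]))) (N (N (N (N (N (N (X 1
     [0,10,2,3,5,6]) (N (X 1 [0,10,2,3,5,7]) (N (N (X 1 [0,10,2,3,8,9]) (X 0 [7,9,10])) (X 0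
     [6,8,10])))) (N (N (N (X 1 [0,10,2,3,6,8]) (N (X 1 [0,10,2,3,7,9]) (X 0 [8,9,10]))) (X 0
     [5,7,10])) (X 0 [5,6,10]))) (X 0 [0,4,10])) (N (N (N (N (N (N (L 0) (X 1 [1,2,5,6,9,10])) (X 1
     [1,2,5,7,8,10])) (N (X 1 [1,2,6,8,7,10]) (X 2 [5,7,10,8,6,1,2,0,3,4]))) (N (N (N (X 1
     [1,2,6,10,7,9]) (X 2 [1,0,10,3,2,5,7,6,9,8])) (X 0 [6,8,10])) (N (N (X 2 [1,0,10,3,2,8,9,6,7,5])
     (X 0 [7,9,10])) (X 0 [6,8,10])))) (N (N (N (N (X 1 [1,2,5,10,8,9]) (X 2 [1,0,10,3,2,6,8,5,9,7]))
     (N (X 2 [1,0,10,3,2,7,9,5,8,6]) (X 0 [8,9,10]))) (X 0 [5,7,10])) (X 0 [5,6,10]))) (X 0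
     [0,4,10]))) (N (N (N (N (N (N (N (L 0) (X 1 [3,4,5,6,9,10])) (X 1 [3,4,5,7,8,10])) (N (X 1
     [3,4,6,8,7,10]) (X 2 [5,7,10,8,6,3,4,2,0,1]))) (N (N (N (X 1 [3,4,6,10,7,9]) (X 2
     [3,2,10,0,4,5,7,6,9,8])) (X 0 [6,8,10])) (N (N (X 2 [3,2,10,0,4,8,9,6,7,5]) (X 0 [7,9,10])) (X 0
     [6,8,10])))) (N (N (N (N (X 1 [3,4,5,10,8,9]) (X 2 [3,2,10,0,4,6,8,5,9,7])) (N (X 2
     [3,2,10,0,4,7,9,5,8,6]) (X 0 [8,9,10]))) (X 0 [5,7,10])) (X 0 [5,6,10]))) (X 0 [0,4,10])) (X 0
     [2,3,10]))) (X 0 [0,1,10])))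
     [(1,[0,1,5,6,10,11]),(1,[0,1,5,6,10,11]),(1,[0,1,8,9,10,11]),(1,[1,2,5,6,10,11]),(1,[3,4,5,6,10,11]),(0,[7,10,11]),(0,[7,10,11]),(1,[1,2,5,6,10,11]),(1,[3,4,5,6,10,11]),(0,[6,10,11]),(1,[0,1,5,7,10,11]),(0,[6,10,11]),(1,[1,2,8,9,10,11]),(1,[3,4,8,9,10,11]),(0,[5,10,11]),(0,[5,10,11]),(1,[2,3,6,8,10,11]),(1,[0,4,6,8,10,11]),(0,[5,10,11]),(1,[2,3,7,9,10,11]),(1,[0,4,7,9,10,11]),(0,[2,10,11]),(0,[1,10,11]),(0,[1,10,11]),(0,[1,10,11]),(0,[0,10,11]),(0,[0,10,11]),(0,[0,10,11])]),
   ([[],[0],[1],[2],[0,3],[],[5],[2,4,5],[2,4,6],[7,8],[1,6,9]], Colour (N (N (N (N (N (N (N (N (N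
     (N (N (L 2) (L 1)) (X 1 [0,1,5,6,9,11])) (X 1 [0,1,5,7,8,11])) (N (X 1 [0,1,6,8,7,11]) (N (N (L
     3) (L 3)) (X 0 [7,9,11])))) (N (N (N (X 1 [0,1,6,11,7,9]) (X 2 [6,5,7,9,11,0,1,4,2,3])) (X 0
     [6,8,11])) (N (N (N (L 0) (X 0 [6,10,11])) (X 0 [7,9,11])) (X 0 [6,8,11])))) (N (N (N (N (X 1
     [0,1,5,11,8,9]) (X 2 [5,6,8,9,11,0,1,4,2,3])) (N (N (X 1 [0,4,5,11,9,10]) (L 1)) (X 0
     [8,9,11]))) (X 0 [5,7,11])) (X 0 [5,6,11]))) (N (N (X 1 [1,2,4,11,5,6]) (N (N (N (X 1
     [0,1,6,11,7,9]) (X 3 [0,1,2,3,4,5,6,7,11,9])) (X 0 [4,8,11])) (X 0 [4,7,11]))) (N (N (N (N (X 1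
     [0,1,5,11,8,9]) (X 3 [0,1,2,3,4,6,5,8,11,9])) (X 0 [4,8,11])) (X 0 [4,7,11])) (X 0 [5,6,11]))))
     (N (N (N (X 1 [0,1,3,11,5,6]) (N (X 1 [0,1,3,11,5,7]) (N (N (X 1 [0,1,3,11,8,9]) (X 0 [7,9,11]))
     (X 0 [6,8,11])))) (N (N (N (X 1 [0,1,3,11,6,8]) (N (X 1 [0,1,3,11,7,9]) (X 0 [8,9,11]))) (X 0
     [5,7,11])) (X 0 [5,6,11]))) (X 0 [3,4,11]))) (N (N (N (N (X 1 [0,4,2,11,5,6]) (N (N (N (X 1
     [0,1,6,11,7,9]) (X 3 [1,0,4,3,2,5,6,7,11,9])) (X 0 [2,8,11])) (X 0 [2,7,11]))) (N (N (N (N (X 1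
     [0,1,5,11,8,9]) (X 3 [1,0,4,3,2,6,5,8,11,9])) (X 0 [2,8,11])) (X 0 [2,7,11])) (X 0 [5,6,11])))
     (N (N (N (N (N (N (L 2) (L 1)) (X 1 [0,1,5,6,9,11])) (X 0 [2,8,11])) (X 0 [2,7,11])) (N (N (N (X
     1 [0,1,6,11,7,9]) (N (L 2) (X 0 [6,10,11]))) (X 0 [2,8,11])) (X 0 [2,7,11]))) (N (N (N (N (X 1
     [0,1,5,11,8,9]) (N (L 1) (X 0 [9,10,11]))) (X 0 [2,8,11])) (X 0 [2,7,11])) (X 0 [5,6,11])))) (X
     0 [2,3,11]))) (N (N (N (N (N (X 1 [1,11,3,4,5,6]) (N (N (N (N (L 0) (X 0 [1,10,11])) (N (L 0) (X
     0 [1,10,11]))) (X 0 [6,8,11])) (N (N (N (L 0) (X 0 [1,10,11])) (X 0 [7,9,11])) (X 0 [6,8,11]))))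
     (N (N (N (N (N (X 1 [0,4,5,11,9,10]) (X 0 [1,10,11])) (N (X 2 [3,2,1,0,4,5,6,11,10,9]) (X 0
     [1,10,11]))) (N (N (X 1 [0,4,5,11,9,10]) (X 0 [1,10,11])) (X 0 [8,9,11]))) (X 0 [5,7,11])) (X 0
     [5,6,11]))) (N (N (N (N (N (N (L 0) (X 0 [1,10,11])) (X 1 [2,3,5,6,9,11])) (X 0 [4,8,11])) (X 0
     [4,7,11])) (N (N (N (N (L 0) (X 0 [1,10,11])) (N (L 0) (X 0 [1,10,11]))) (X 0 [4,8,11])) (X 0
     [4,7,11]))) (N (N (N (N (N (X 1 [2,3,5,11,9,10]) (X 0 [1,10,11])) (N (X 3
     [2,3,4,0,1,5,6,11,10,9]) (X 0 [1,10,11]))) (X 0 [4,8,11])) (X 0 [4,7,11])) (X 0 [5,6,11])))) (N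
     (N (N (N (N (N (X 2 [1,0,4,3,11,5,6,7,8,9]) (X 1 [0,4,5,6,9,11])) (N (X 3
     [0,1,11,3,4,6,5,8,7,9]) (X 0 [8,9,11]))) (N (N (X 3 [0,1,11,3,4,5,6,7,8,9]) (X 0 [7,9,11])) (N
     (N (L 0) (X 0 [1,10,11])) (X 0 [7,9,11])))) (N (N (N (N (L 0) (X 0 [1,10,11])) (N (L 0) (X 0
     [1,10,11]))) (X 0 [6,8,11])) (N (N (N (L 0) (X 0 [1,10,11])) (X 0 [7,9,11])) (X 0 [6,8,11]))))
     (N (N (N (N (N (X 1 [0,4,5,11,9,10]) (X 0 [1,10,11])) (N (X 3 [0,4,3,2,1,5,6,11,10,9]) (X 0
     [1,10,11]))) (N (N (X 1 [0,4,5,11,9,10]) (X 0 [1,10,11])) (X 0 [8,9,11]))) (X 0 [5,7,11])) (X 0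
     [5,6,11]))) (X 0 [3,4,11]))) (X 0 [1,2,11]))) (N (N (N (N (N (N (X 1 [0,11,2,3,5,6]) (N (N (N (N
     (X 1 [0,11,2,3,9,10]) (X 0 [6,10,11])) (N (L 2) (X 0 [6,10,11]))) (X 0 [6,8,11])) (N (N (N (X 1
     [0,11,2,3,9,10]) (X 0 [6,10,11])) (X 0 [7,9,11])) (X 0 [6,8,11])))) (N (N (N (N (N (X 1
     [0,11,2,3,6,10]) (L 1)) (N (X 1 [0,11,2,3,6,10]) (X 0 [9,10,11]))) (N (N (X 1 [0,11,2,3,6,10])
     (L 1)) (X 0 [8,9,11]))) (X 0 [5,7,11])) (X 0 [5,6,11]))) (X 0 [0,4,11])) (N (N (N (N (N (N (X 2
     [0,1,2,3,11,5,6,7,8,9]) (X 1 [1,2,5,6,9,11])) (N (X 3 [1,0,11,3,2,6,5,8,7,9]) (X 0 [8,9,11])))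
     (N (N (X 3 [1,0,11,3,2,5,6,7,8,9]) (X 0 [7,9,11])) (N (N (L 3) (L 3)) (X 0 [7,9,11])))) (N (N (N
     (N (X 1 [1,10,3,11,5,7]) (X 0 [6,10,11])) (N (X 1 [1,10,3,11,5,7]) (X 0 [6,10,11]))) (X 0
     [6,8,11])) (N (N (N (L 3) (X 0 [6,10,11])) (X 0 [7,9,11])) (X 0 [6,8,11])))) (N (N (N (N (N (X 1
     [0,11,2,7,6,10]) (L 1)) (N (X 1 [0,11,2,7,6,10]) (X 0 [9,10,11]))) (N (N (X 1 [0,11,2,7,6,10])
     (L 1)) (X 0 [8,9,11]))) (X 0 [5,7,11])) (X 0 [5,6,11]))) (X 0 [0,4,11]))) (N (N (N (N (N (N (N
     (N (X 2 [6,5,7,9,10,0,11,4,2,3]) (L 1)) (X 1 [3,4,5,6,9,11])) (X 0 [2,8,11])) (X 0 [2,7,11])) (N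
     (N (N (N (L 2) (X 0 [6,10,11])) (N (L 2) (X 0 [6,10,11]))) (X 0 [2,8,11])) (X 0 [2,7,11]))) (N
     (N (N (N (N (X 1 [1,10,3,4,5,11]) (L 1)) (N (X 1 [1,10,3,4,5,11]) (X 0 [9,10,11]))) (X 0
     [2,8,11])) (X 0 [2,7,11])) (X 0 [5,6,11]))) (X 0 [0,4,11])) (X 0 [2,3,11]))) (X 0 [0,1,11])))
     [(1,[0,1,5,6,11,12]),(1,[0,1,5,6,11,12]),(1,[0,1,5,7,11,12]),(1,[1,10,3,4,11,12]),(1,[1,10,3,4,11,12]),(1,[1,10,3,4,11,12]),(0,[10,11,12]),(0,[10,11,12]),(0,[10,11,12]),(1,[0,1,6,8,11,12]),(0,[10,11,12]),(0,[10,11,12]),(0,[10,11,12]),(0,[10,11,12]),(0,[10,11,12]),(0,[10,11,12]),(0,[7,11,12]),(0,[7,11,12]),(0,[7,11,12]),(0,[7,11,12]),(0,[7,11,12]),(0,[7,11,12]),(0,[7,11,12]),(0,[7,11,12]),(0,[7,11,12]),(0,[6,11,12]),(0,[6,11,12]),(0,[6,11,12]),(0,[6,11,12]),(1,[2,3,9,10,11,12]),(0,[6,11,12]),(0,[6,11,12]),(0,[7,11,12]),(0,[6,11,12]),(0,[6,11,12]),(0,[6,11,12]),(0,[5,11,12]),(0,[10,11,12]),(0,[5,11,12]),(0,[5,11,12]),(0,[5,11,12]),(0,[5,11,12]),(0,[5,11,12]),(0,[10,11,12]),(0,[5,11,12]),(0,[2,11,12]),(0,[2,11,12]),(1,[1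,10,5,7,11,12]),(0,[2,11,12]),(0,[2,11,12]),(0,[2,11,12]),(0,[2,11,12]),(0,[10,11,12]),(0,[10,11,12]),(0,[10,11,12]),(0,[10,11,12]),(0,[2,11,12]),(0,[2,11,12]),(0,[2,11,12]),(0,[6,11,12]),(0,[2,11,12]),(0,[2,11,12]),(0,[2,11,12]),(0,[5,11,12]),(0,[5,11,12]),(0,[5,11,12]),(0,[5,11,12]),(0,[2,11,12]),(0,[2,11,12]),(0,[1,11,12]),(0,[1,11,12]),(0,[1,11,12]),(0,[1,11,12]),(0,[1,11,12]),(0,[1,11,12]),(0,[1,11,12]),(0,[1,11,12]),(0,[1,11,12]),(0,[1,11,12]),(0,[1,11,12]),(0,[1,11,12]),(0,[1,11,12]),(0,[1,11,12]),(0,[1,11,12]),(0,[1,11,12]),(0,[1,11,12]),(0,[1,11,12]),(0,[1,11,12]),(0,[1,11,12]),(0,[1,11,12]),(0,[1,11,12]),(0,[1,11,12]),(0,[1,11,12]),(0,[1,11,12]),(0,[1,11,12]),(0,[1,11,12]),(0,[1,11,12]),(0,[1,11,12]),(0,[1,11,12]),(0,[1,11,12]),(0,[1,11,12]),(0,[1,11,12]),(0,[1,11,12]),(0,[1,11,12]),(0,[1,11,12]),(0,[1,11,12]),(0,[1,11,12]),(0,[1,11,12]),(0,[1,11,12]),(0,[1,11,12]),(0,[1,11,12]),(0,[1,11,12]),(0,[1,11,12]),(0,[1,11,12]),(0,[1,11,12]),(0,[1,11,12]),(0,[1,11,12]),(0,[1,11,12]),(0,[1,11,12]),(0,[1,1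1,12]),(0,[1,11,12]),(0,[1,11,12]),(0,[1,11,12]),(0,[1,11,12]),(0,[0,11,12]),(0,[0,11,12]),(0,[0,11,12]),(0,[0,11,12]),(0,[0,11,12]),(0,[0,11,12]),(0,[0,11,12]),(0,[0,11,12]),(0,[0,11,12]),(0,[0,11,12]),(0,[0,11,12]),(0,[0,11,12]),(0,[0,11,12]),(0,[0,11,12]),(0,[0,11,12]),(0,[0,11,12]),(0,[0,11,12]),(0,[0,11,12]),(0,[0,11,12]),(0,[0,11,12]),(0,[0,11,12]),(0,[0,11,12]),(0,[0,11,12]),(0,[0,11,12]),(0,[0,11,12]),(0,[0,11,12]),(0,[0,11,12]),(0,[0,11,12]),(0,[0,11,12]),(0,[0,11,12]),(0,[0,11,12]),(0,[0,11,12]),(0,[0,11,12])]),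
   ([[],[0],[1],[2],[0,3],[],[5],[2,4,5],[2,4,6],[7,8],[1,4,5,9]], Colour (N (N (N (N (N (N (N (N
     (N (N (N (L 3) (L 1)) (X 1 [0,1,5,6,9,11])) (X 1 [0,1,5,7,8,11])) (N (X 1 [0,1,6,8,7,11]) (N (N
     (L 1) (L 1)) (X 0 [7,9,11])))) (N (N (N (X 1 [0,1,6,11,7,9]) (X 2 [6,5,7,9,11,0,1,4,2,3])) (X 0
     [6,8,11])) (N (N (N (X 1 [2,3,6,11,9,10]) (L 1)) (X 0 [7,9,11])) (X 0 [6,8,11])))) (N (N (N (N
     (X 1 [0,1,5,11,8,9]) (X 2 [5,6,8,9,11,0,1,4,2,3])) (N (N (L 2) (X 0 [5,10,11])) (X 0 [8,9,11])))
     (X 0 [5,7,11])) (X 0 [5,6,11]))) (N (N (X 1 [1,2,4,11,5,6]) (N (N (N (X 1 [0,1,6,11,7,9]) (X 3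
     [0,1,2,3,4,5,6,7,11,9])) (X 0 [4,8,11])) (X 0 [4,7,11]))) (N (N (N (N (X 1 [0,1,5,11,8,9]) (X 3
     [0,1,2,3,4,6,5,8,11,9])) (X 0 [4,8,11])) (X 0 [4,7,11])) (X 0 [5,6,11])))) (N (N (N (X 1
     [0,1,3,11,5,6]) (N (X 1 [0,1,3,11,5,7]) (N (N (X 1 [0,1,3,11,8,9]) (X 0 [7,9,11])) (X 0
     [6,8,11])))) (N (N (N (X 1 [0,1,3,11,6,8]) (N (X 1 [0,1,3,11,7,9]) (X 0 [8,9,11]))) (X 0
     [5,7,11])) (X 0 [5,6,11]))) (X 0 [3,4,11]))) (N (N (N (N (X 1 [0,4,2,11,5,6]) (N (N (N (X 1
     [0,1,6,11,7,9]) (X 3 [1,0,4,3,2,5,6,7,11,9])) (X 0 [2,8,11])) (X 0 [2,7,11]))) (N (N (N (N (X 1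
     [0,1,5,11,8,9]) (X 3 [1,0,4,3,2,6,5,8,11,9])) (X 0 [2,8,11])) (X 0 [2,7,11])) (X 0 [5,6,11])))
     (N (N (N (N (N (N (L 0) (X 0 [4,10,11])) (X 1 [0,1,5,6,9,11])) (X 0 [2,8,11])) (X 0 [2,7,11]))
     (N (N (N (X 1 [0,1,6,11,7,9]) (N (L 0) (X 0 [4,10,11]))) (X 0 [2,8,11])) (X 0 [2,7,11]))) (N (N
     (N (N (X 1 [0,1,5,11,8,9]) (N (L 0) (X 0 [4,10,11]))) (X 0 [2,8,11])) (X 0 [2,7,11])) (X 0
     [5,6,11])))) (X 0 [2,3,11]))) (N (N (N (N (N (X 1 [1,11,3,4,5,6]) (N (N (N (N (X 1
     [2,3,6,11,9,10]) (X 0 [1,10,11])) (X 6 [0,1,2,3,4,5,6,7,8,9,11])) (X 0 [6,8,11])) (N (N (N (X 1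
     [2,3,6,11,9,10]) (X 0 [1,10,11])) (X 0 [7,9,11])) (X 0 [6,8,11])))) (N (N (N (N (N (L 2) (X 0
     [1,10,11])) (X 6 [0,1,2,3,4,6,5,8,7,9,11])) (N (N (L 2) (X 0 [1,10,11])) (X 0 [8,9,11]))) (X 0
     [5,7,11])) (X 0 [5,6,11]))) (N (N (N (N (N (N (L 3) (X 0 [1,10,11])) (X 1 [2,3,5,6,9,11])) (X 0
     [4,8,11])) (X 0 [4,7,11])) (N (N (N (N (X 1 [2,3,6,11,9,10]) (X 0 [1,10,11])) (N (L 3) (X 0
     [1,10,11]))) (X 0 [4,8,11])) (X 0 [4,7,11]))) (N (N (N (N (N (L 2) (X 0 [1,10,11])) (N (L 2) (X
     0 [1,10,11]))) (X 0 [4,8,11])) (X 0 [4,7,11])) (X 0 [5,6,11])))) (N (N (N (N (N (N (X 2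
     [1,0,4,3,11,5,6,7,8,9]) (X 1 [0,4,5,6,9,11])) (N (X 3 [0,1,11,3,4,6,5,8,7,9]) (X 0 [8,9,11])))
     (N (N (X 3 [0,1,11,3,4,5,6,7,8,9]) (X 0 [7,9,11])) (N (N (L 2) (X 0 [1,10,11])) (X 0
     [7,9,11])))) (N (N (N (X 6 [5,6,8,9,7,0,1,4,2,3,11]) (N (L 3) (X 0 [1,10,11]))) (X 0 [6,8,11]))
     (N (N (N (L 3) (X 0 [1,10,11])) (X 0 [7,9,11])) (X 0 [6,8,11])))) (N (N (N (N (X 6
     [6,5,7,9,8,0,1,4,2,3,11]) (N (L 2) (X 0 [1,10,11]))) (N (N (L 2) (X 0 [1,10,11])) (X 0
     [8,9,11]))) (X 0 [5,7,11])) (X 0 [5,6,11]))) (X 0 [3,4,11]))) (X 0 [1,2,11]))) (N (N (N (N (N (N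
     (X 1 [0,11,2,3,5,6]) (N (N (N (N (X 1 [0,11,2,3,5,10]) (L 1)) (X 6 [1,0,4,3,2,5,6,7,8,9,11])) (X
     0 [6,8,11])) (N (N (N (X 1 [0,11,2,3,5,10]) (L 1)) (X 0 [7,9,11])) (X 0 [6,8,11])))) (N (N (N (N
     (N (X 1 [0,11,2,3,9,10]) (X 0 [5,10,11])) (X 6 [1,0,4,3,2,6,5,8,7,9,11])) (N (N (X 1
     [0,11,2,3,9,10]) (X 0 [5,10,11])) (X 0 [8,9,11]))) (X 0 [5,7,11])) (X 0 [5,6,11]))) (X 0
     [0,4,11])) (N (N (N (N (N (N (X 2 [0,1,2,3,11,5,6,7,8,9]) (X 1 [1,2,5,6,9,11])) (N (X 3
     [1,0,11,3,2,6,5,8,7,9]) (X 0 [8,9,11]))) (N (N (X 3 [1,0,11,3,2,5,6,7,8,9]) (X 0 [7,9,11])) (N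
     (N (X 6 [0,1,2,3,11,6,5,8,7,9,10]) (L 1)) (X 0 [7,9,11])))) (N (N (N (X 6
     [5,6,8,9,7,1,0,2,4,3,11]) (N (X 1 [0,11,2,8,5,10]) (X 0 [9,10,11]))) (X 0 [6,8,11])) (N (N (N (X
     1 [0,11,2,8,5,10]) (L 1)) (X 0 [7,9,11])) (X 0 [6,8,11])))) (N (N (N (N (X 6
     [6,5,7,9,8,1,0,2,4,3,11]) (N (X 1 [1,10,3,11,6,8]) (X 0 [5,10,11]))) (N (N (L 2) (X 0
     [5,10,11])) (X 0 [8,9,11]))) (X 0 [5,7,11])) (X 0 [5,6,11]))) (X 0 [0,4,11]))) (N (N (N (N (N (N
     (N (N (X 3 [0,11,2,3,4,6,5,8,10,9]) (L 0)) (X 1 [3,4,5,6,9,11])) (X 0 [2,8,11])) (X 0 [2,7,11]))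
     (N (N (N (N (L 0) (L 0)) (N (L 0) (X 0 [9,10,11]))) (X 0 [2,8,11])) (X 0 [2,7,11]))) (N (N (N (N
     (N (L 0) (X 0 [5,10,11])) (N (L 0) (X 0 [5,10,11]))) (X 0 [2,8,11])) (X 0 [2,7,11])) (X 0
     [5,6,11]))) (X 0 [0,4,11])) (X 0 [2,3,11]))) (X 0 [0,1,11])))
     [(1,[0,1,5,6,11,12]),(1,[2,3,5,6,11,12]),(1,[2,3,5,10,11,12]),(1,[2,8,5,10,11,12]),(1,[2,8,5,10,11,12]),(0,[10,11,12]),(1,[0,1,5,6,11,12]),(0,[10,11,12]),(0,[10,11,12]),(0,[10,11,12]),(0,[10,11,12]),(0,[10,11,12]),(0,[10,11,12]),(0,[7,11,12]),(0,[7,11,12]),(0,[7,11,12]),(6,[1,0,4,3,2,5,6,7,8,11,12]),(0,[7,11,12]),(0,[7,11,12]),(0,[7,11,12]),(0,[7,11,12]),(0,[7,11,12]),(0,[10,11,12]),(0,[7,11,12]),(0,[7,11,12]),(0,[7,11,12]),(0,[6,11,12]),(0,[6,11,12]),(0,[6,11,12]),(0,[7,11,12]),(0,[6,11,12]),(0,[5,11,12]),(0,[5,11,12]),(0,[5,11,12]),(0,[5,11,12]),(0,[5,11,12]),(0,[8,11,12]),(0,[5,11,12]),(0,[5,11,12]),(0,[5,11,12]),(0,[2,11,12]),(0,[2,11,12]),(0,[2,11,12]),(0,[2,11,12]),(0,[2,11,12]),(0,[2,11,12]),(0,[2,11,12]),(0,[2,11,12]),(0,[2,11,12]),(0,[2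,11,12]),(0,[2,11,12]),(0,[2,11,12]),(0,[2,11,12]),(0,[2,11,12]),(0,[2,11,12]),(0,[2,11,12]),(0,[2,11,12]),(0,[2,11,12]),(0,[2,11,12]),(0,[2,11,12]),(0,[2,11,12]),(0,[2,11,12]),(0,[2,11,12]),(0,[2,11,12]),(0,[1,11,12]),(0,[1,11,12]),(0,[1,11,12]),(0,[1,11,12]),(0,[1,11,12]),(0,[1,11,12]),(0,[1,11,12]),(0,[5,11,12]),(0,[1,11,12]),(0,[1,11,12]),(0,[1,11,12]),(0,[1,11,12]),(0,[1,11,12]),(0,[1,11,12]),(0,[5,11,12]),(0,[1,11,12]),(0,[1,11,12]),(0,[1,11,12]),(0,[1,11,12]),(0,[1,11,12]),(0,[1,11,12]),(0,[1,11,12]),(0,[1,11,12]),(0,[1,11,12]),(0,[1,11,12]),(0,[1,11,12]),(0,[1,11,12]),(0,[5,11,12]),(0,[1,11,12]),(0,[1,11,12]),(0,[1,11,12]),(0,[1,11,12]),(0,[5,11,12]),(0,[1,11,12]),(0,[1,11,12]),(0,[1,11,12]),(0,[3,11,12]),(0,[1,11,12]),(0,[1,11,12]),(0,[1,11,12]),(0,[1,11,12]),(0,[1,11,12]),(0,[3,11,12]),(0,[1,11,12]),(0,[3,11,12]),(0,[0,11,12]),(0,[0,11,12]),(0,[0,11,12]),(0,[0,11,12]),(0,[0,11,12]),(0,[0,11,12]),(0,[0,11,12]),(0,[0,11,12]),(0,[0,11,12]),(0,[0,11,12]),(0,[0,11,12]),(0,[0,11,12]),(0,[0,11,12]),(0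,[0,11,12]),(0,[0,11,12]),(0,[0,11,12]),(0,[0,11,12]),(0,[0,11,12]),(0,[0,11,12]),(0,[0,11,12]),(0,[0,11,12]),(0,[0,11,12]),(0,[0,11,12]),(0,[0,11,12]),(0,[0,11,12]),(0,[0,11,12]),(0,[0,11,12]),(0,[0,11,12]),(0,[0,11,12]),(0,[0,11,12]),(0,[0,11,12]),(0,[0,11,12])]),
   ([[],[0],[1],[2],[0,3],[],[5],[2,4,5],[2,4,6],[7,8]], Colour (N (N (N (N (N (N (N (N (N (N (L 0)
     (X 1 [0,1,5,6,9,10])) (X 1 [0,1,5,7,8,10])) (N (X 1 [0,1,6,8,7,10]) (N (L 3) (X 0 [7,9,10]))))
     (N (N (N (X 1 [0,1,6,10,7,9]) (X 2 [6,5,7,9,10,0,1,4,2,3])) (X 0 [6,8,10])) (N (N (L 2) (X 0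
     [7,9,10])) (X 0 [6,8,10])))) (N (N (N (N (X 1 [0,1,5,10,8,9]) (X 2 [5,6,8,9,10,0,1,4,2,3])) (N
     (L 1) (X 0 [8,9,10]))) (X 0 [5,7,10])) (X 0 [5,6,10]))) (N (N (X 1 [1,2,4,10,5,6]) (N (N (N (X 1
     [0,1,6,10,7,9]) (X 3 [0,1,2,3,4,5,6,7,10,9])) (X 0 [4,8,10])) (X 0 [4,7,10]))) (N (N (N (N (X 1
     [0,1,5,10,8,9]) (X 3 [0,1,2,3,4,6,5,8,10,9])) (X 0 [4,8,10])) (X 0 [4,7,10])) (X 0 [5,6,10]))))
     (N (N (N (X 1 [0,1,3,10,5,6]) (N (X 1 [0,1,3,10,5,7]) (N (N (X 1 [0,1,3,10,8,9]) (X 0 [7,9,10]))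
     (X 0 [6,8,10])))) (N (N (N (X 1 [0,1,3,10,6,8]) (N (X 1 [0,1,3,10,7,9]) (X 0 [8,9,10]))) (X 0
     [5,7,10])) (X 0 [5,6,10]))) (X 0 [3,4,10]))) (N (N (N (N (X 1 [0,4,2,10,5,6]) (N (N (N (X 1
     [0,1,6,10,7,9]) (X 3 [1,0,4,3,2,5,6,7,10,9])) (X 0 [2,8,10])) (X 0 [2,7,10]))) (N (N (N (N (X 1
     [0,1,5,10,8,9]) (X 3 [1,0,4,3,2,6,5,8,10,9])) (X 0 [2,8,10])) (X 0 [2,7,10])) (X 0 [5,6,10])))
     (N (N (N (N (N (L 0) (X 1 [0,1,5,6,9,10])) (X 0 [2,8,10])) (X 0 [2,7,10])) (N (N (N (X 1
     [0,1,6,10,7,9]) (L 0)) (X 0 [2,8,10])) (X 0 [2,7,10]))) (N (N (N (N (X 1 [0,1,5,10,8,9]) (L 0))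
     (X 0 [2,8,10])) (X 0 [2,7,10])) (X 0 [5,6,10])))) (X 0 [2,3,10]))) (N (N (N (N (N (X 1
     [1,10,3,4,5,6]) (N (N (N (L 2) (X 6 [0,1,2,3,4,5,6,7,8,9,10])) (X 0 [6,8,10])) (N (N (L 2) (X 0
     [7,9,10])) (X 0 [6,8,10])))) (N (N (N (N (L 3) (X 6 [0,1,2,3,4,6,5,8,7,9,10])) (N (L 1) (X 0
     [8,9,10]))) (X 0 [5,7,10])) (X 0 [5,6,10]))) (N (N (N (N (N (L 3) (X 1 [2,3,5,6,9,10])) (X 0
     [4,8,10])) (X 0 [4,7,10])) (N (N (N (L 2) (X 7 [0,1,2,3,4,6,5,8,7,9,10])) (X 0 [4,8,10])) (X 0
     [4,7,10]))) (N (N (N (N (L 3) (X 7 [0,1,2,3,4,5,6,7,8,9,10])) (X 0 [4,8,10])) (X 0 [4,7,10])) (X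
     0 [5,6,10])))) (N (N (N (N (N (N (X 2 [1,0,4,3,10,5,6,7,8,9]) (X 1 [0,4,5,6,9,10])) (N (X 3
     [0,1,10,3,4,6,5,8,7,9]) (X 0 [8,9,10]))) (N (N (X 3 [0,1,10,3,4,5,6,7,8,9]) (X 0 [7,9,10])) (N
     (L 3) (X 0 [7,9,10])))) (N (N (N (X 6 [5,6,8,9,7,0,1,4,2,3,10]) (L 2)) (X 0 [6,8,10])) (N (N (X
     7 [5,6,8,9,7,1,0,2,4,3,10]) (X 0 [7,9,10])) (X 0 [6,8,10])))) (N (N (N (N (X 6
     [6,5,7,9,8,0,1,4,2,3,10]) (L 1)) (N (X 7 [6,5,7,9,8,1,0,2,4,3,10]) (X 0 [8,9,10]))) (X 0
     [5,7,10])) (X 0 [5,6,10]))) (X 0 [3,4,10]))) (X 0 [1,2,10]))) (N (N (N (N (N (N (X 1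
     [0,10,2,3,5,6]) (N (N (N (L 2) (X 6 [1,0,4,3,2,5,6,7,8,9,10])) (X 0 [6,8,10])) (N (N (L 2) (X 0
     [7,9,10])) (X 0 [6,8,10])))) (N (N (N (N (L 1) (X 6 [1,0,4,3,2,6,5,8,7,9,10])) (N (L 1) (X 0
     [8,9,10]))) (X 0 [5,7,10])) (X 0 [5,6,10]))) (X 0 [0,4,10])) (N (N (N (N (N (N (X 2
     [0,1,2,3,10,5,6,7,8,9]) (X 1 [1,2,5,6,9,10])) (N (X 3 [1,0,10,3,2,6,5,8,7,9]) (X 0 [8,9,10])))
     (N (N (X 3 [1,0,10,3,2,5,6,7,8,9]) (X 0 [7,9,10])) (N (L 1) (X 0 [7,9,10])))) (N (N (N (X 6
     [5,6,8,9,7,1,0,2,4,3,10]) (L 2)) (X 0 [6,8,10])) (N (N (X 7 [5,6,8,9,7,0,1,4,2,3,10]) (X 0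
     [7,9,10])) (X 0 [6,8,10])))) (N (N (N (N (X 6 [6,5,7,9,8,1,0,2,4,3,10]) (L 1)) (N (X 7
     [6,5,7,9,8,0,1,4,2,3,10]) (X 0 [8,9,10]))) (X 0 [5,7,10])) (X 0 [5,6,10]))) (X 0 [0,4,10]))) (N
     (N (N (N (N (N (N (L 0) (X 1 [3,4,5,6,9,10])) (X 0 [2,8,10])) (X 0 [2,7,10])) (N (N (N (L 2) (X
     7 [1,0,4,3,2,6,5,8,7,9,10])) (X 0 [2,8,10])) (X 0 [2,7,10]))) (N (N (N (N (L 1) (X 7
     [1,0,4,3,2,5,6,7,8,9,10])) (X 0 [2,8,10])) (X 0 [2,7,10])) (X 0 [5,6,10]))) (X 0 [0,4,10])) (X 0
     [2,3,10]))) (X 0 [0,1,10])))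
     [(1,[0,1,5,6,10,11]),(1,[0,1,5,6,10,11]),(1,[0,1,5,7,10,11]),(1,[0,1,6,8,10,11]),(1,[3,4,5,6,10,11]),(0,[7,10,11]),(6,[0,1,2,3,4,6,5,8,7,10,11]),(1,[2,3,5,6,10,11]),(7,[0,1,2,3,4,5,6,7,8,10,11]),(0,[7,10,11]),(0,[6,10,11]),(0,[6,10,11]),(0,[6,10,11]),(0,[6,10,11]),(0,[6,10,11]),(0,[6,10,11]),(0,[6,10,11]),(0,[6,10,11]),(0,[6,10,11]),(0,[5,10,11]),(0,[5,10,11]),(0,[5,10,11]),(0,[5,10,11]),(0,[5,10,11]),(0,[8,10,11]),(0,[5,10,11]),(0,[5,10,11]),(0,[2,10,11]),(0,[2,10,11]),(0,[2,10,11]),(0,[2,10,11]),(0,[2,10,11]),(0,[2,10,11]),(0,[2,10,11]),(0,[2,10,11]),(0,[2,10,11]),(0,[1,10,11]),(0,[1,10,11]),(0,[1,10,11]),(0,[1,10,11]),(0,[6,10,11]),(0,[6,10,11]),(0,[6,10,11]),(0,[6,10,11]),(0,[1,10,11]),(0,[1,10,11]),(0,[1,10,11]),(0,[6,10,11]),(0,[6,10,11]),(0,[6,10,11]),(0,[6,10,11]),(0,[1,10,11]),(0,[1,10,11]),(0,[1,10,11]),(0,[1,10,11]),(0,[1,10,11]),(0,[1,10,11]),(0,[5,10,11]),(0,[5,10,11]),(0,[8,10,11]),(0,[5,10,11]),(0,[5,10,11]),(0,[1,10,11]),(0,[1,10,11]),(0,[1,10,11]),(0,[1,10,11]),(0,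[1,10,11]),(0,[6,10,11]),(0,[6,10,11]),(0,[6,10,11]),(0,[6,10,11]),(0,[1,10,11]),(0,[1,10,11]),(0,[1,10,11]),(0,[1,10,11]),(0,[6,10,11]),(0,[6,10,11]),(0,[3,10,11]),(0,[6,10,11]),(0,[1,10,11]),(0,[5,10,11]),(0,[5,10,11]),(0,[3,10,11]),(0,[3,10,11]),(0,[5,10,11]),(0,[0,10,11]),(0,[0,10,11]),(0,[0,10,11]),(0,[0,10,11]),(0,[0,10,11]),(0,[0,10,11]),(0,[0,10,11]),(0,[0,10,11]),(0,[0,10,11]),(0,[0,10,11]),(0,[0,10,11]),(0,[0,10,11]),(0,[0,10,11]),(0,[0,10,11]),(0,[0,10,11]),(0,[0,10,11]),(0,[0,10,11]),(0,[0,10,11]),(0,[0,10,11]),(0,[0,10,11]),(0,[0,10,11]),(0,[0,10,11]),(0,[0,10,11]),(0,[0,10,11]),(0,[0,10,11]),(0,[0,10,11])])]"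

lemma steps_3K2_ok: "steps_ok 4 K3_3K2 steps_3K2"
  by code_simp

definition patterns_3K2 :: "rows list" where
  "patterns_3K2 = K3_3K2 @ map (rows_of \<circ> fst) steps_3K2"

text \<open>
  For anticomplete edges \<open>xy\<close> and \<open>ab\<close> of \<open>J\<close>, the three nested trees refute all pentagons through \<open>ab\<close> in the
  nonneighbourhood of \<open>xy\<close>.
\<close>

definition pentagon_ok :: "rows list \<Rightarrow> rows \<Rightarrow> nat \<Rightarrow> nat \<Rightarrow> nat \<Rightarrow> nat \<Rightarrow> nat tree tree tree \<Rightarrow> bool" where
  "pentagon_ok P J x y a b T \<longleftrightarrow>
    edge_at J x y = Some True \<and> edge_at J a b = Some True \<and>
    list_all (\<lambda>(p, q). edge_at J p q = Some False) [(a, x), (a, y), (b, x), (b, y)] \<and>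
    (let n = length J; R = requirements n [a] [x, y, b]; R' = requirements (Suc n) [b] [x, y, a, n];
       R'' = requirements (Suc (Suc n)) [n, Suc n] [x, y, a, b]
     in closed_tree P J [] R T \<and>
       list_all (\<lambda>(s, T'). closed_tree P (J @ [s]) [] R' T' \<and>
         list_all (\<lambda>(t, T''). closed_tree P (J @ [s, t]) [] R'' T'' \<and> leaves [] R'' T'' = [])
           (leaves [] R' T')) (leaves [] R T))"

text \<open>Two pentagons, 0 3 6 5 7 and 1 2 8 4 7, that share the vertex 7 and have no further
  edges.\<close>

definition joined_pentagons :: rows where
  "joined_pentagons = rows_of [[],[],[1],[0],[],[],[3,5],[0,1,4,5],[2,4]]"

definition joined_pentagons_tree :: "nat tree tree tree" where
  "joined_pentagons_tree =
     N (N (N (X 1 [0,9,1,2,5,6]) (N (N (L (N (N (N (N (N (X 1 [2,8,3,10,5,7]) (X 1 [1,7,6,9,8,10]))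
     (N (X 1 [2,8,6,9,7,10]) (L (N (N (N (N (N (X 1 [2,8,5,7,9,11]) (X 1 [1,7,3,6,8,11])) (N (X 1
     [2,8,3,6,7,11]) (X 0 [7,10,11]))) (N (N (X 1 [0,7,2,8,6,11]) (X 0 [6,9,11])) (N (X 0 [6,9,11])
     (X 0 [6,9,11])))) (X 1 [0,3,1,2,5,11])) (X 1 [0,3,1,2,4,11]))))) (X 0 [3,6,10])) (N (N (N (X 1
     [0,9,1,2,5,10]) (X 1 [0,9,1,2,5,10])) (X 0 [5,7,10])) (X 0 [3,6,10]))) (N (N (X 1
     [1,2,4,10,5,6]) (X 0 [3,6,10])) (N (N (N (X 1 [0,9,1,2,4,10]) (X 0 [4,8,10])) (X 0 [4,7,10]))
     (X 0 [3,6,10]))))) (L (N (N (N (N (N (X 1 [2,8,3,10,5,7]) (L (N (N (N (N (N (X 1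
     [1,2,5,6,10,11]) (X 1 [1,7,3,6,8,11])) (N (X 1 [2,8,3,6,7,11]) (X 0 [8,9,11]))) (N (N (X 1
     [0,7,2,8,6,11]) (X 0 [6,9,11])) (N (X 0 [6,9,11]) (X 0 [6,9,11])))) (X 1 [0,3,1,2,5,11])) (X 1
     [0,3,1,2,4,11])))) (N (L (N (N (N (N (N (X 1 [1,2,5,6,10,11]) (X 1 [1,7,3,6,8,11])) (N (X 1
     [2,8,3,6,7,11]) (X 0 [8,9,11]))) (N (N (X 1 [0,7,2,8,6,11]) (X 0 [6,9,11])) (N (X 0 [6,9,11])
     (X 0 [6,9,11])))) (X 1 [0,3,1,2,5,11])) (X 1 [0,3,1,2,4,11]))) (L (N (N (N (N (N (X 1
     [1,2,5,6,10,11]) (X 1 [1,7,3,6,8,11])) (N (X 1 [2,8,3,6,7,11]) (X 0 [8,9,11]))) (N (N (X 1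
     [0,7,2,8,6,11]) (X 0 [6,9,11])) (N (X 0 [6,9,11]) (X 0 [6,9,11])))) (X 1 [0,3,1,2,5,11])) (X 1
     [0,3,1,2,4,11]))))) (X 0 [3,6,10])) (N (N (N (X 1 [0,9,1,2,5,10]) (X 1 [0,9,1,2,5,10])) (X 0
     [5,7,10])) (X 0 [3,6,10]))) (N (N (X 1 [1,2,4,10,5,6]) (X 0 [3,6,10])) (N (N (N (X 1
     [0,9,1,2,4,10]) (X 0 [4,8,10])) (X 0 [4,7,10])) (X 0 [3,6,10])))))) (X 0 [0,7,9]))) (N (N (N
     (X 2 [2,1,7,4,8,3,6,0,5,9]) (X 1 [1,7,3,6,8,9])) (X 0 [0,7,9])) (X 0 [5,6,9]))) (N (N (X 1
     [0,9,1,2,5,6]) (N (N (L (N (N (N (N (N (X 1 [2,8,3,10,5,7]) (X 1 [1,2,3,10,4,9])) (N (X 1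
     [1,2,3,10,4,9]) (X 1 [1,2,3,10,4,9]))) (X 0 [3,6,10])) (N (N (N (X 1 [0,9,1,2,5,10]) (X 1
     [0,9,1,2,5,10])) (X 0 [5,7,10])) (X 0 [3,6,10]))) (N (N (X 1 [1,2,4,10,5,6]) (X 0 [3,6,10]))
     (N (N (N (X 1 [0,9,1,2,5,10]) (X 0 [4,8,10])) (X 0 [4,7,10])) (X 0 [3,6,10]))))) (X 0
     [4,8,9])) (X 0 [0,7,9]))) (N (X 1 [1,2,3,6,4,9]) (X 0 [5,6,9])))"

lemma joined_pentagons_ok: "pentagon_ok patterns_3K2 joined_pentagons 2 1 0 3 joined_pentagons_tree"
  by code_simp

text \<open>The pentagon 0 1 6 4 5 and an edge 23 anticomplete to it. The pentagon step for the
  edges 01 and 23 produces a second pentagon through 23, which leads to the patterns with two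
  pentagons.\<close>

definition C5_K2 :: rows where
  "C5_K2 = rows_of [[],[0],[],[2],[],[0,4],[1,4]]"

definition C5_K2_tree :: "nat tree tree tree" where
  "C5_K2_tree =
     N (N (N (L (N (N (N (L (N (N (N (X 5 [0,1,6,4,5,2,3,7,8,9]) (X 1 [0,5,2,3,6,9])) (N (X 1
     [1,6,2,3,5,9]) (X 2 [2,7,9,8,3,0,1,5,6,4]))) (X 1 [0,1,2,3,4,9]))) (X 1 [0,5,2,7,6,8])) (N (X
     1 [1,6,2,7,5,8]) (L (N (N (N (X 2 [2,3,8,9,7,0,1,5,6,4]) (X 1 [0,5,2,3,6,9])) (N (X 1
     [1,6,2,3,5,9]) (X 0 [5,8,9]))) (X 1 [0,1,2,3,4,9]))))) (N (N (X 1 [0,1,2,7,4,8]) (X 0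
     [4,6,8])) (X 0 [4,5,8])))) (L (N (N (N (X 1 [0,5,3,8,6,7]) (X 9 [1,7,2,0,8,4,5,6,3])) (N (L (N
     (N (N (X 4 [0,1,6,4,5,2,3,7,8,9]) (X 1 [0,5,2,3,6,9])) (N (X 1 [1,6,2,3,5,9]) (X 0 [6,7,9])))
     (X 1 [0,1,2,3,4,9]))) (L (N (N (N (X 3 [1,0,5,4,6,3,2,8,7,9]) (X 1 [0,5,2,3,6,9])) (N (X 1
     [1,6,2,3,5,9]) (X 0 [6,7,9]))) (X 1 [0,1,2,3,4,9]))))) (N (N (X 1 [0,1,2,7,4,8]) (X 0
     [4,6,8])) (X 0 [4,5,8]))))) (N (L (N (N (N (X 1 [1,6,3,8,5,7]) (L (N (N (N (X 4
     [0,1,6,4,5,3,2,8,7,9]) (X 1 [0,5,2,3,6,9])) (N (X 1 [1,6,2,3,5,9]) (X 0 [5,7,9]))) (X 1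
     [0,1,2,3,4,9])))) (N (X 9 [0,7,2,1,8,4,6,5,3]) (L (N (N (N (X 3 [0,1,6,4,5,3,2,8,7,9]) (X 1
     [0,5,2,3,6,9])) (N (X 1 [1,6,2,3,5,9]) (X 0 [5,7,9]))) (X 1 [0,1,2,3,4,9]))))) (N (N (X 1
     [0,1,2,7,4,8]) (X 0 [4,6,8])) (X 0 [4,5,8])))) (L (N (N (N (L (N (N (N (X 2
     [3,2,7,9,8,0,1,5,6,4]) (X 1 [0,5,2,3,6,9])) (N (X 1 [1,6,2,3,5,9]) (X 0 [5,7,9]))) (X 1
     [0,1,2,3,4,9]))) (L (N (N (N (X 3 [1,0,5,4,6,2,3,7,8,9]) (X 1 [0,5,2,3,6,9])) (N (X 1
     [1,6,2,3,5,9]) (X 0 [5,7,9]))) (X 1 [0,1,2,3,4,9])))) (N (L (N (N (N (X 3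
     [0,1,6,4,5,2,3,7,8,9]) (X 1 [0,5,2,3,6,9])) (N (X 1 [1,6,2,3,5,9]) (X 0 [5,7,9]))) (X 1
     [0,1,2,3,4,9]))) (L (N (N (N (X 8 [0,1,6,4,5,2,3,7,8,9]) (X 1 [0,5,2,3,6,9])) (N (X 1
     [1,6,2,3,5,9]) (X 0 [5,7,9]))) (X 1 [0,1,2,3,4,9]))))) (N (N (X 1 [0,1,2,7,4,8]) (X 0
     [4,6,8])) (X 0 [4,5,8])))))) (N (N (L (N (N (N (X 1 [0,1,3,8,4,7]) (X 1 [0,1,3,8,4,7])) (N (X
     1 [0,1,3,8,4,7]) (X 1 [0,1,3,8,4,7]))) (N (N (X 9 [5,7,2,0,8,6,1,4,3]) (X 0 [4,6,8])) (X 0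
     [4,5,8])))) (X 0 [4,6,7])) (X 0 [4,5,7]))"

lemma C5_K2_ok: "pentagon_ok (patterns_3K2 @ [joined_pentagons]) C5_K2 0 1 2 3 C5_K2_tree"
  by code_simp

section \<open>Pentagons among the nonneighbours of an edge\<close>

context critical_graph
begin

text \<open>Without triangles the neighbourhoods of \<open>x\<close> and \<open>y\<close> are
  independent, so two colours for the remaining vertices would give 1 + 1 + 2 = 4 colours in
  all.\<close>

lemma not_2_colorable_nonneighbours:
  assumes k: "k = 4" and av: "avoids P" and P: "set K3_3K2 \<subseteq> set P" and V: "x \<in> V" "y \<in> V"
  shows "\<not> colorable E {v \<in> V. \<not> E v x \<and> \<not> E v y} 2"
proof
  let ?M = "{v \<in> V. \<not> E v x \<and> \<not> E v y}"
  assume M: "colorable E ?M 2"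
  have K3: "K3 \<in> set P" using P by (auto simp: K3_3K2_def)
  have ind: "colorable E {v \<in> V. E v w} 1" if "w \<in> V" for w
    unfolding colorable_def
  proof (intro exI[of _ "\<lambda>_. 0"] conjI ballI impI)
    fix u v assume "u \<in> {v \<in> V. E v w}" "v \<in> {v \<in> V. E v w}" "E u v"
    then show "(0 :: nat) \<noteq> 0" using no_K3[OF av K3 that, of u v] comm by blast
  qed auto
  have "colorable E ({v \<in> V. E v x} \<union> {v \<in> V. E v y} \<union> ?M) (1 + 1 + 2)"
    by (intro colorable_Un ind V M)
  then have "colorable E V (1 + 1 + 2)" by (rule colorable_subset) auto
  then show False using not_colorable k by (simp add: numeral_eq_Suc)
qed

text \<open>An edge of \<open>M\<close> anticomplete to \<open>ab\<close> would form a 3K2 with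
  \<open>xy\<close> and \<open>ab\<close>. This gives the domination hypothesis of
  \<open>pentagon_through_edge\<close>.\<close>

lemma pentagon_in_nonneighbours:
  assumes k: "k = 4" and av: "avoids P" and P: "set K3_3K2 \<subseteq> set P"
    and V: "x \<in> V" "y \<in> V" and xy: "E x y" and ab: "a \<in> M" "b \<in> M" "E a b"
    and M: "M = {v \<in> V. \<not> E v x \<and> \<not> E v y}"
  obtains u v z where "u \<in> M" "v \<in> M" "z \<in> M" "E u a" "\<not> E u b" "E v b" "\<not> E v a" "\<not> E v u"
    "E z u" "E z v" "\<not> E z a" "\<not> E z b"
proof -
  have nc: "\<not> colorable E M 2"
    unfolding M by (rule not_2_colorable_nonneighbours[OF k av P V])
  have dom: "E p a \<or> E p b \<or> E q a \<or> E q b" if "p \<in> M" "q \<in> M" "E p q" for p q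
  proof (rule ccontr)
    assume "\<not> ?thesis"
    then have "copy [x, y, a, b, p, q] (rows_of [[],[0],[],[2],[],[4]])"
      using ab that V xy unfolding copy_def M
      by (auto simp: rows_of_def less_Suc_eq numeral_eq_Suc comm)
    then show False using av P by (auto simp: avoids_def K3_3K2_def)
  qed
  have tri: "\<not> E q r" if "p \<in> M" "q \<in> M" "r \<in> M" "E p q" "E p r" for p q r
    using no_K3[OF av, of p q r] P that M by (auto simp: K3_3K2_def)
  show thesis by (rule pentagon_through_edge[OF nc ab tri dom]) (assumption | rule that)+
qed

text \<open>The pentagon through \<open>ab\<close> is known to exist, so a copy of \<open>J\<close>
  is impossible as soon as no such pentagon is compatible with it. Its vertices \<open>u\<close>,
  \<open>v\<close>, \<open>z\<close> are appended to the copy one at a time; the tree for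
  \<open>z\<close> has no leaves.\<close>

lemma pentagon_step:
  assumes k: "k = 4" and av: "avoids P" and P: "set K3_3K2 \<subseteq> set P" and ok: "pentagon_ok P J x y a b T"
  shows "\<not> copy xs J"
proof
  assume c: "copy xs J"
  define M where "M = {v \<in> V. \<not> E v (xs ! x) \<and> \<not> E v (xs ! y)}"
  define n where "n = length J"
  have len: "length xs = n" using c by (simp add: copy_def n_def)
  note e = edge_at_sound[OF copy_imp_agrees[OF c]]
  have J: "x < n" "y < n" "a < n" "b < n" "E (xs ! x) (xs ! y)" "E (xs ! a) (xs ! b)"
    "\<not> E (xs ! a) (xs ! x)" "\<not> E (xs ! a) (xs ! y)" "\<not> E (xs ! b) (xs ! x)" "\<not> E (xs ! b) (xs ! y)"
    using ok unfolding pentagon_ok_def len[symmetric] by (auto dest: e)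
  have inV: "i < n \<Longrightarrow> xs ! i \<in> V" for i using c len by (auto simp: copy_def)
  have aM: "xs ! a \<in> M" "xs ! b \<in> M" using J inV by (auto simp: M_def)
  obtain u v z where uvz: "u \<in> M" "v \<in> M" "z \<in> M" "E u (xs ! a)" "\<not> E u (xs ! b)" "E v (xs ! b)"
    "\<not> E v (xs ! a)" "\<not> E v u" "E z u" "E z v" "\<not> E z (xs ! a)" "\<not> E z (xs ! b)"
    using pentagon_in_nonneighbours[OF k av P _ _ J(5) aM J(6) M_def] inV J by blast
  then have uV: "u \<in> V" "v \<in> V" "z \<in> V" by (auto simp: M_def)
  have cu: "copy (xs @ [u]) (J @ [map (E u) xs])" using c uV by (simp add: copy_snoc)
  have cv: "copy (xs @ [u] @ [v]) (J @ [map (E u) xs] @ [map (E v) (xs @ [u])])"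
    using cu uV copy_snoc[of "xs @ [u]" v "J @ [map (E u) xs]"] by simp
  let ?R = "requirements n [a] [x, y, b]" and ?R' = "requirements (Suc n) [b] [x, y, a, n]"
  let ?R'' = "requirements (Suc (Suc n)) [n, Suc n] [x, y, a, b]"
  have T: "closed_tree P J [] ?R T" and
    T': "\<And>s T' t T''. (s, T') \<in> set (leaves [] ?R T) \<Longrightarrow> closed_tree P (J @ [s]) [] ?R' T' \<and>
      ((t, T'') \<in> set (leaves [] ?R' T') \<longrightarrow> closed_tree P (J @ [s, t]) [] ?R'' T'' \<and> leaves [] ?R'' T'' = [])"
    using ok unfolding pentagon_ok_def Let_def n_def[symmetric] list_all_iff by fastforce+
  obtain T1 where T1: "(map (E u) xs, T1) \<in> set (leaves [] ?R T)"
    using requirements_sound[OF av c uV(1), of "[a]" "[x, y, b]" T] T uvz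
    unfolding n_def[symmetric] M_def by auto
  have v: "E v ((xs @ [u]) ! i)" if "i \<in> set [b]" for i
    using that uvz J len by (simp add: nth_append)
  have v': "\<not> E v ((xs @ [u]) ! i)" if "i \<in> set [x, y, a, n]" for i
    using that uvz J len by (auto simp: nth_append M_def)
  have "closed_tree P (J @ [map (E u) xs]) [] (requirements (length (J @ [map (E u) xs])) [b] [x, y, a, n]) T1"
    using conjunct1[OF T'[OF T1]] by (simp add: n_def)
  from requirements_sound[OF av cu uV(2) this v v']
  obtain T2 where T2: "(map (E v) (xs @ [u]), T2) \<in> set (leaves [] ?R' T1)"
    by (auto simp: n_def)
  note T2' = mp[OF conjunct2[OF T'[OF T1]] T2]
  have z: "E z ((xs @ [u] @ [v]) ! i)" if "i \<in> set [n, Suc n]" for i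
    using that uvz len by (auto simp: nth_append)
  have z': "\<not> E z ((xs @ [u] @ [v]) ! i)" if "i \<in> set [x, y, a, b]" for i
    using that uvz J len by (auto simp: nth_append M_def)
  have "closed_tree P (J @ [map (E u) xs] @ [map (E v) (xs @ [u])]) []
      (requirements (length (J @ [map (E u) xs] @ [map (E v) (xs @ [u])])) [n, Suc n] [x, y, a, b]) T2"
    using conjunct1[OF T2'] by (simp add: n_def)
  from requirements_sound[OF av cv uV(3) this z z'] show False
    using conjunct2[OF T2'] by (simp add: n_def)
qed

end

text \<open>The nonneighbours of an edge \<open>xy\<close> are not 2-colourable, hence contain an
  edge and a pentagon through it. So \<open>C5_K2\<close> is unavoidable in a critical graph, and
  its exclusion is the aim of all preceding patterns.\<close>

theorem colorable_4_if_3K2_K3_free: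
  assumes fin: "finite V" and sym: "\<And>u v. E u v \<Longrightarrow> E v u" and irrefl: "\<And>v. \<not> E v v"
    and free_3K2: "\<And>x y a b c d. {x, y, a, b, c, d} \<subseteq> V \<Longrightarrow> E x y \<Longrightarrow> E a b \<Longrightarrow> E c d \<Longrightarrow>
      E x a \<or> E x b \<or> E y a \<or> E y b \<or> E x c \<or> E x d \<or> E y c \<or> E y d \<or> E a c \<or> E a d \<or> E b c \<or> E b d"
    and free_K3: "\<And>a b c. {a, b, c} \<subseteq> V \<Longrightarrow> E a b \<Longrightarrow> E a c \<Longrightarrow> \<not> E b c"
  shows "colorable E V 4"
proof (rule ccontr)
  assume "\<not> colorable E V 4"
  from ex_critical[OF fin this sym irrefl] obtain W where W: "W \<subseteq> V" "critical_graph E W 4" by blast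
  interpret critical_graph E W 4 by (rule W(2))
  have "\<not> copy xs (rows_of [[],[0],[],[2],[],[4]])" for xs
  proof
    assume "copy xs (rows_of [[],[0],[],[2],[],[4]])"
    then show False
      using free_3K2[OF subset_trans[OF _ W(1)], of "xs ! 0" "xs ! 1" "xs ! 2" "xs ! 3" "xs ! 4" "xs ! 5"]
      by (auto simp: copy_def rows_of_def numeral_eq_Suc length_Suc_conv less_Suc_eq comm)
  qed
  moreover have "\<not> copy xs K3" for xs
  proof
    assume "copy xs K3"
    then show False using free_K3[OF subset_trans[OF _ W(1)], of "xs ! 0" "xs ! 1" "xs ! 2"]
      by (auto simp: copy_def K3_def rows_of_def numeral_eq_Suc length_Suc_conv less_Suc_eq comm)
  qed
  ultimately have base: "avoids K3_3K2" by (simp add: avoids_def K3_3K2_def)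
  have av: "avoids patterns_3K2"
    unfolding patterns_3K2_def by (rule steps_ok_sound[OF base steps_3K2_ok])
  have P: "set K3_3K2 \<subseteq> set patterns_3K2" by (auto simp: patterns_3K2_def)
  have "avoids (patterns_3K2 @ [joined_pentagons])"
    using pentagon_step[OF _ av P joined_pentagons_ok] av by (auto simp: avoids_def)
  from pentagon_step[OF _ this _ C5_K2_ok] P have C5_K2: "\<not> copy xs C5_K2" for xs by auto
  obtain x y where xy: "x \<in> W" "y \<in> W" "E x y"
    using ex_edge[of W 3] not_colorable by (auto simp: numeral_eq_Suc)
  define M where "M = {v \<in> W. \<not> E v x \<and> \<not> E v y}"
  have "\<not> colorable E M 2"
    unfolding M_def by (rule not_2_colorable_nonneighbours[OF _ av P xy(1,2)]) simp
  then obtain a b where ab: "a \<in> M" "b \<in> M" "E a b"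
    using ex_edge[of M 1] by (auto simp: numeral_2_eq_2)
  obtain u v z where "u \<in> M" "v \<in> M" "z \<in> M" "E u a" "\<not> E u b" "E v b" "\<not> E v a" "\<not> E v u"
    "E z u" "E z v" "\<not> E z a" "\<not> E z b"
    using pentagon_in_nonneighbours[OF refl av P xy ab M_def] by blast
  then have "copy [a, b, x, y, z, u, v] C5_K2"
    using ab xy unfolding copy_def M_def C5_K2_def
    by (auto simp: rows_of_def less_Suc_eq numeral_eq_Suc comm)
  then show False using C5_K2 by blast
qed

section \<open>Colouring by a maximum clique\<close>

text \<open>An induced matching, chosen edge by edge. In this form an edge \<open>xy\<close> extends
  any matching found among its common nonneighbours, which is how \<open>p\<close> drops by one in
  the recursion.\<close>

fun has_matching :: "('a \<Rightarrow> 'a \<Rightarrow> bool) \<Rightarrow> 'a set \<Rightarrow> nat \<Rightarrow> bool" where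
  "has_matching E V 0 = True"
| "has_matching E V (Suc p) =
    (\<exists>x\<in>V. \<exists>y\<in>V. E x y \<and> has_matching E {v \<in> V. \<not> E v x \<and> \<not> E v y} p)"

text \<open>Every neighbourhood is 2K2-free. Coincident vertices do no harm: if a = c, for instance,
  then \<open>E c d\<close> is already the alternative \<open>E a d\<close>.\<close>

definition butterfly_free :: "('a \<Rightarrow> 'a \<Rightarrow> bool) \<Rightarrow> 'a set \<Rightarrow> bool" where
  "butterfly_free E V \<longleftrightarrow> (\<forall>v a b c d. {v, a, b, c, d} \<subseteq> V \<and> E v a \<and> E v b \<and> E v c \<and> E v d \<and> E a b \<and> E c d \<longrightarrow>
     E a c \<or> E a d \<or> E b c \<or> E b d)"

text \<open>An upper bound on clique sizes passes to vertex subsets and can be lowered until it is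
  attained.\<close>

definition omega_le :: "('a \<Rightarrow> 'a \<Rightarrow> bool) \<Rightarrow> 'a set \<Rightarrow> nat \<Rightarrow> bool" where
  "omega_le E V m \<longleftrightarrow> (\<forall>K. K \<subseteq> V \<and> pairwise E K \<longrightarrow> card K \<le> m)"

lemma omega_le_subset: "omega_le E V m \<Longrightarrow> W \<subseteq> V \<Longrightarrow> omega_le E W m"
  unfolding omega_le_def by blast

lemma butterfly_free_subset: "butterfly_free E V \<Longrightarrow> W \<subseteq> V \<Longrightarrow> butterfly_free E W"
  unfolding butterfly_free_def by (meson order_trans)

lemma card_triangle: "card (SIGMA j:{..<m}. {..j}) = (m + 1) choose 2"
proof -
  have "(\<Sum>j<m. Suc j) = (m + 1) choose 2"
    by (induction m) (auto simp: numeral_2_eq_2)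
  then show ?thesis by simp
qed

locale clique_list = sym_graph +
  fixes vs :: "'a list" and m :: nat
  assumes vs: "distinct vs" "length vs = m" "set vs \<subseteq> V" "pairwise E (set vs)"
    and omega: "omega_le E V m"
begin

text \<open>Since \<open>E\<close> is irreflexive, a clique vertex misses itself and nothing else in
  the clique.\<close>

definition missed :: "'a \<Rightarrow> nat set" where
  "missed v = {i. i < m \<and> \<not> E v (vs ! i)}"

text \<open>The larger index comes first. The diagonal colours \<open>(i, i)\<close> are for
  vertices missing only \<open>vs ! i\<close>, so the palette is the triangle of pairs
  \<open>(j, i)\<close> with i at most j and j below m.\<close>

definition colour :: "'a \<Rightarrow> nat \<times> nat" where
  "colour v = (let i = Min (missed v) in
    (if missed v = {i} then i else Min (missed v - {i}), i))"

lemma finite_missed: "finite (missed v)"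
  by (simp add: missed_def)

lemma adj: "i < m \<Longrightarrow> j < m \<Longrightarrow> i \<noteq> j \<Longrightarrow> E (vs ! i) (vs ! j)"
  using vs by (simp add: pairwise_def nth_eq_iff_index_eq)

lemma card_clique_le:
  assumes "distinct us" "set us \<subseteq> V" "\<And>u v. u \<in> set us \<Longrightarrow> v \<in> set us \<Longrightarrow> u \<noteq> v \<Longrightarrow> E u v"
  shows "length us \<le> m"
proof -
  have "pairwise E (set us)" using assms(3) by (simp add: pairwise_def)
  then have "card (set us) \<le> m" using omega assms(2) unfolding omega_le_def by blast
  then show ?thesis using distinct_card[OF assms(1)] by simp
qed

lemma missed_nonempty:
  assumes "v \<in> V"
  shows "missed v \<noteq> {}"
proof
  assume "missed v = {}"
  then have all: "E v w" if "w \<in> set vs" for w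
    using that vs(2) unfolding missed_def by (auto simp: in_set_conv_nth)
  then have "v \<notin> set vs" using irrefl by blast
  then have "length (v # vs) \<le> m"
    using assms vs all sym by (intro card_clique_le) (auto simp: pairwise_def)
  then show False using vs(2) by simp
qed

lemma colour_in:
  assumes "v \<in> V"
  shows "colour v \<in> (SIGMA j:{..<m}. {..j})"
proof -
  let ?i = "Min (missed v)"
  have i: "?i \<in> missed v" using missed_nonempty[OF assms] finite_missed by simp
  show ?thesis
  proof (cases "missed v = {?i}")
    case True
    then show ?thesis using i by (auto simp: colour_def Let_def missed_def)
  next
    case False
    then have "missed v - {?i} \<noteq> {}" using i by blast
    then have j: "Min (missed v - {?i}) \<in> missed v - {?i}"
      by (rule Min_in[OF finite_Diff[OF finite_missed]])
    then have "?i \<le> Min (missed v - {?i})" using finite_missed by simp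
    then show ?thesis using False j by (auto simp: colour_def Let_def missed_def)
  qed
qed

text \<open>Adjacent vertices never share a diagonal colour: if both missed only
  \<open>vs ! i\<close>, they could replace it and yield a clique with m + 1 vertices. Otherwise i
  and j are the two smallest missed indices of both vertices, which determines their adjacency to
  the clique up to index j.\<close>

lemma same_colour:
  assumes "u \<in> V" "v \<in> V" "E u v" "colour u = colour v" "colour u = (j, i)"
  shows "i < j" "j < m" "w \<in> {u, v} \<Longrightarrow> l < m \<Longrightarrow> l \<le> j \<Longrightarrow> E w (vs ! l) \<longleftrightarrow> l \<noteq> i \<and> l \<noteq> j"
proof -
  have col: "colour w = (j, i)" if "w \<in> {u, v}" for w
    using that assms(4,5) by auto
  then have Min: "Min (missed w) = i" if "w \<in> {u, v}" for w
    using that by (simp add: colour_def Let_def)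
  have i: "i \<in> missed w" "\<And>l. l \<in> missed w \<Longrightarrow> i \<le> l" if "w \<in> {u, v}" for w
    using Min[OF that] missed_nonempty[of w] finite_missed[of w] assms(1,2) that by auto
  have not_single: "missed w \<noteq> {i}" if "w \<in> {u, v}" for w
  proof
    assume "missed w = {i}"
    then have "j = i" using col[OF that] by (simp add: colour_def)
    \<comment> \<open>Both ends have \<open>j = i\<close> as first component, whereas a second
      smallest missed index would lie in \<open>missed x - {i}\<close>.\<close>
    have single: "missed x = {i}" if "x \<in> {u, v}" for x
    proof (rule ccontr)
      assume n: "missed x \<noteq> {i}"
      then have "missed x - {i} \<noteq> {}" using i(1)[OF that] by blast
      then have "Min (missed x - {i}) \<in> missed x - {i}"
        by (rule Min_in[OF finite_Diff[OF finite_missed]])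
      moreover have "Min (missed x - {i}) = j"
        using n col[OF that] Min[OF that] by (simp add: colour_def Let_def)
      ultimately show False using \<open>j = i\<close> by simp
    qed
    have im: "i < m" using i(1)[of u] by (simp add: missed_def)
    define ws where "ws = remove1 (vs ! i) vs"
    have ws: "set ws = set vs - {vs ! i}" "distinct ws" "length ws = m - 1"
      using vs im by (auto simp: ws_def length_remove1)
    have E: "E x w" if xw: "x \<in> {u, v}" "w \<in> set ws" for x w
    proof -
      obtain l where "l < m" "w = vs ! l" "l \<noteq> i"
        using xw(2) vs(2) unfolding ws(1) by (auto simp: in_set_conv_nth)
      then show ?thesis using single[OF xw(1)] unfolding missed_def by blast
    qed
    have "length (u # v # ws) \<le> m"
    proof (rule card_clique_le)
      show "distinct (u # v # ws)" using ws(2) E irrefl assms(3) by auto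
      show "set (u # v # ws) \<subseteq> V" using ws(1) vs(3) assms(1,2) by auto
      show "E x y" if "x \<in> set (u # v # ws)" "y \<in> set (u # v # ws)" "x \<noteq> y" for x y
        using that E assms(3) vs(4) ws(1) by (auto simp: pairwise_def comm)
    qed
    then show False using ws(3) im by simp
  qed
  have j: "Min (missed w - {i}) = j" "j \<in> missed w - {i}" if "w \<in> {u, v}" for w
  proof -
    show "Min (missed w - {i}) = j"
      using not_single[OF that] col[OF that] Min[OF that] by (simp add: colour_def Let_def)
    moreover have "missed w - {i} \<noteq> {}" using not_single[OF that] i(1)[OF that] by blast
    ultimately show "j \<in> missed w - {i}" using Min_in[OF finite_Diff[OF finite_missed]] by metis
  qed
  show "i < j" using i(2)[of u j] j(2)[of u] by force
  show "j < m" using j(2)[of u] by (simp add: missed_def)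
  show "E w (vs ! l) \<longleftrightarrow> l \<noteq> i \<and> l \<noteq> j" if w: "w \<in> {u, v}" and l: "l < m" "l \<le> j"
  proof -
    have "l \<in> missed w \<Longrightarrow> l \<noteq> i \<Longrightarrow> j \<le> l"
      using j(1)[OF w] Min_le[of "missed w - {i}" l] finite_missed by auto
    then have "l \<in> missed w \<longleftrightarrow> l = i \<or> l = j"
      using i(1)[OF w] j(2)[OF w] l by auto
    then show ?thesis using l by (auto simp: missed_def)
  qed
qed

text \<open>An edge \<open>uv\<close> whose ends have equal colour is anticomplete to the clique
  edge of the two indices in that colour.\<close>

lemma colorable_if_2K2_free:
  assumes "\<And>a b c d. {a, b, c, d} \<subseteq> V \<Longrightarrow> E a b \<Longrightarrow> E c d \<Longrightarrow> E a c \<or> E a d \<or> E b c \<or> E b d"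
  shows "colorable E V ((m + 1) choose 2)"
proof (rule colorableI[of "SIGMA j:{..<m}. {..j}" _ colour])
  show "colour u \<noteq> colour v" if uv: "u \<in> V" "v \<in> V" "E u v" for u v
  proof
    assume c: "colour u = colour v"
    obtain j i where ji: "colour u = (j, i)" by fastforce
    note s = same_colour[OF uv c ji]
    have "E (vs ! i) (vs ! j)" using adj s by simp
    moreover have "\<not> E w (vs ! i)" "\<not> E w (vs ! j)" if "w \<in> {u, v}" for w
      using s(3)[OF that, of i] s(3)[OF that, of j] s(1,2) by auto
    moreover have "{u, v, vs ! i, vs ! j} \<subseteq> V" using uv vs(2,3) s(1,2) by auto
    ultimately show False
      using assms[of u v "vs ! i" "vs ! j"] uv(3) by blast
  qed
  show "colour ` V \<subseteq> (SIGMA j:{..<m}. {..j})" using colour_in by blast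
qed (simp_all only: card_triangle finite_SigmaI finite_lessThan finite_atMost order_refl)

text \<open>The colour (1, 0) means that the first two clique vertices are both missed, so it does
  not occur here. If adjacent \<open>u\<close> and \<open>v\<close> share another colour
  \<open>(j, i)\<close>, one of these two clique vertices is adjacent to both and distinct from
  \<open>vs ! i\<close> and \<open>vs ! j\<close>; it is the centre of a butterfly.\<close>

lemma colorable_neighbours_if_butterfly_free:
  assumes "butterfly_free E V" "2 \<le> m"
  shows "colorable E {v \<in> V. E v (vs ! 0) \<or> E v (vs ! 1)} (((m + 1) choose 2) - 1)"
proof (rule colorableI[of "(SIGMA j:{..<m}. {..j}) - {(1, 0)}" _ colour])
  have not_10: "colour v \<noteq> (1, 0)" if "v \<in> V" "E v (vs ! 0) \<or> E v (vs ! 1)" for v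
  proof
    assume c: "colour v = (1, 0)"
    have 0: "0 = Min (missed v)" and 1: "missed v \<noteq> {0}" "Min (missed v - {0}) = 1"
      using c by (auto simp: colour_def Let_def split: if_splits)
    then have "0 \<in> missed v" using missed_nonempty[OF that(1)] finite_missed Min_in by metis
    moreover then have "1 \<in> missed v"
      using 1 finite_missed[of v] Min_in[of "missed v - {0}"] by auto
    ultimately show False using that(2) by (auto simp: missed_def)
  qed
  show "colour ` {v \<in> V. E v (vs ! 0) \<or> E v (vs ! 1)} \<subseteq> (SIGMA j:{..<m}. {..j}) - {(1, 0)}"
  proof (rule image_subsetI)
    fix v assume "v \<in> {v \<in> V. E v (vs ! 0) \<or> E v (vs ! 1)}"
    then show "colour v \<in> (SIGMA j:{..<m}. {..j}) - {(1, 0)}"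
      using colour_in[of v] not_10[of v] by simp
  qed
  show "card ((SIGMA j:{..<m}. {..j}) - {(1, 0)}) \<le> ((m + 1) choose 2) - 1"
    using assms(2) card_triangle[of m] by (simp add: card_Diff_singleton_if del: card_SigmaI)
  show "colour u \<noteq> colour v"
    if uv': "u \<in> {v \<in> V. E v (vs ! 0) \<or> E v (vs ! 1)}" "v \<in> {v \<in> V. E v (vs ! 0) \<or> E v (vs ! 1)}" "E u v" for u v
  proof
    assume c: "colour u = colour v"
    have uv: "u \<in> V" "v \<in> V" "E u v" using uv' by auto
    obtain j i where ji: "colour u = (j, i)" by fastforce
    note s = same_colour[OF uv c ji]
    \<comment> \<open>The centre is \<open>vs ! 0\<close>, or \<open>vs ! 1\<close> if i = 0. In the
      latter case j is at least 2, as (1, 0) is excluded, so l is below j in both cases.\<close>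
    define l where "l = (if i = 0 then 1 else 0 :: nat)"
    have l: "l < j" "l \<noteq> i" "l < m"
      using s(1,2) not_10[of u] uv'(1) ji by (auto simp: l_def)
    have "E (vs ! i) (vs ! j)" "E (vs ! l) (vs ! i)" "E (vs ! l) (vs ! j)" using adj s(1,2) l by auto
    moreover have "\<not> E w (vs ! i)" "\<not> E w (vs ! j)" "E w (vs ! l)" if "w \<in> {u, v}" for w
      using s(3)[OF that, of i] s(3)[OF that, of j] s(3)[OF that, of l] s(1,2) l by auto
    moreover have "{vs ! l, u, v, vs ! i, vs ! j} \<subseteq> V" using uv vs(2,3) s(1,2) l by auto
    ultimately show False
      using assms(1)[unfolded butterfly_free_def, rule_format, of "vs ! l" "vs ! i" "vs ! j" u v] uv(3)
      by (auto simp: comm)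
  qed
qed simp

end

lemma ex_clique_list:
  assumes "\<not> omega_le E V m"
  obtains vs where "distinct vs" "length vs = Suc m" "set vs \<subseteq> V" "pairwise E (set vs)"
proof -
  obtain K where K: "K \<subseteq> V" "pairwise E K" "Suc m \<le> card K"
    using assms unfolding omega_le_def by (auto simp: not_le Suc_le_eq)
  then obtain K' where K': "K' \<subseteq> K" "card K' = Suc m" "finite K'"
    using obtain_subset_with_card_n by metis
  obtain vs where "set vs = K'" "distinct vs" using finite_distinct_list[OF K'(3)] by blast
  then show thesis
    using that[of vs] K K' distinct_card[of vs] pairwise_subset by (metis order_trans)
qed

lemma choose_2_mono: "m \<le> n \<Longrightarrow> m choose 2 \<le> n choose 2"
  unfolding choose_two by (intro div_le_mono mult_le_mono diff_le_mono) auto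

lemma chi_bound_0: "chi_bound p 0 = 0"
  by (subst chi_bound.simps) simp

text \<open>This allows the bound on the clique number to be taken as attained. As the clauses
  change form with m, the transitions between them are checked separately.\<close>

lemma chi_bound_mono:
  assumes "2 \<le> p"
  shows "chi_bound p m \<le> chi_bound p (Suc m)"
  using assms
proof (induction p rule: dec_induct)
  case base
  have 4: "chi_bound 2 4 = 10" using chi_bound_clauses(4)[of 4] by (simp add: choose_two)
  consider "m = 0" | "m = 1" | "m = 2" | "m = 3" | "4 \<le> m" by linarith
  then show ?case
  proof cases
    case 5
    then show ?thesis
      using chi_bound_clauses(4)[of m] chi_bound_clauses(4)[of "Suc m"] choose_2_mono[of "m + 1" "Suc m + 1"]
      by simp
  qed (use chi_bound_clauses(1)[of 2] chi_bound_clauses(2,3) 4 in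
      \<open>simp_all add: chi_bound_0 eval_nat_numeral\<close>)
next
  case (step p)
  have c3: "chi_bound (Suc p) l = chi_bound p l + ((l + 1) choose 2) - 1" if "3 \<le> l" for l
    using chi_bound_clauses(6)[OF that, of "Suc p"] step.hyps by simp
  have c2: "chi_bound (Suc p) 2 = 2 * p" using chi_bound_clauses(5)[of "Suc p"] step.hyps by simp
  consider "m = 0" | "m = 1" | "m = 2" | "3 \<le> m" by linarith
  then show ?case
  proof cases
    case 1
    then show ?thesis by (simp add: chi_bound_0)
  next
    case 2
    then show ?thesis using chi_bound_clauses(1)[of "Suc p"] c2 step.hyps by (simp add: numeral_2_eq_2)
  next
    case 3
    \<comment> \<open>The closed form is a lower bound for p = 2 as well, where the value is
      3.\<close>
    have "2 * p - 2 \<le> chi_bound p 2"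
      using chi_bound_clauses(2) chi_bound_clauses(5)[of p] step.hyps by (cases "p = 2") auto
    then have "2 * p - 2 \<le> chi_bound p 3" using step.IH 3 by (simp add: numeral_3_eq_3 numeral_2_eq_2)
    moreover have "chi_bound (Suc p) 3 = chi_bound p 3 + 6 - 1" using c3[of 3] by (simp add: choose_two)
    ultimately show ?thesis using c2 3 by simp
  next
    case 4
    then show ?thesis
      using c3[of m] c3[of "Suc m"] step.IH choose_2_mono[of "m + 1" "Suc m + 1"] by simp
  qed
qed

text \<open>Strong induction on \<open>p\<close>, needed for all vertex sets. The inner induction
  lowers \<open>m\<close> until the bound is attained, and then a clique with exactly that many
  vertices is available.\<close>

theorem colorable_chi_bound:
  assumes "2 \<le> p" and sym: "\<And>u v. E u v \<Longrightarrow> E v u" and irrefl: "\<And>v. \<not> E v v"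
    and "finite V" "\<not> has_matching E V p" "butterfly_free E V" "omega_le E V m"
  shows "colorable E V (chi_bound p m)"
  using assms(1,4-)
proof (induction p arbitrary: V m rule: less_induct)
  case (less p)
  from less.prems(5) show ?case
  proof (induction m)
    case 0
    have "V = {}"
    proof (rule ccontr)
      assume "V \<noteq> {}"
      then obtain v where "v \<in> V" by blast
      then show False using 0 unfolding omega_le_def by (auto dest!: spec[of _ "{v}"])
    qed
    then show ?case by (simp add: colorable_def)
  next
    case (Suc m)
    show ?case
    proof (cases "omega_le E V m")
      case True
      then show ?thesis using Suc.IH colorable_mono[OF _ chi_bound_mono] less.prems(1) by blast
    next
      case False
      obtain vs where vs: "distinct vs" "length vs = Suc m" "set vs \<subseteq> V" "pairwise E (set vs)"
        by (rule ex_clique_list[OF False])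
      interpret clique_list E V vs "Suc m"
        using sym irrefl vs Suc.prems by unfold_locales auto
      have matching_2: "E a c \<or> E a d \<or> E b c \<or> E b d"
        if "p = 2" "{a, b, c, d} \<subseteq> V" "E a b" "E c d" for a b c d
        using less.prems(3) that sym by (auto simp: numeral_2_eq_2 comm)
      \<comment> \<open>The clique number is \<open>Suc m\<close>: the two 4-colour theorems serve
        \<open>p = 2\<close>, \<open>m = 2\<close> and \<open>p = 3\<close>,
        \<open>m = 1\<close>.\<close>
      consider "m = 0" | "p = 2" "m = 2" | "p = 2" "m \<noteq> 2" "1 \<le> m" | "p = 3" "m = 1" | "3 \<le> p" "p \<noteq> 3 \<or> m \<noteq> 1" "1 \<le> m"
        using less.prems(1) by linarith
      then show ?thesis
      proof cases
        case 1
        have "\<not> E u v" if "u \<in> V" "v \<in> V" for u v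
        proof
          assume "E u v"
          then have "length [u, v] \<le> Suc m" using that irrefl by (intro card_clique_le) (auto simp: comm)
          then show False using 1 by simp
        qed
        then have "colorable E V 1" unfolding colorable_def by (intro exI[of _ "\<lambda>_. 0"]) auto
        then show ?thesis using 1 chi_bound_clauses(1)[OF less.prems(1)] by simp
      next
        case 2
        have K4: "\<not> E c d" if K: "{a, b, c, d} \<subseteq> V" "E a b" "E a c" "E a d" "E b c" "E b d" for a b c d
        proof
          assume "E c d"
          then have "length [a, b, c, d] \<le> Suc m"
            using K irrefl by (intro card_clique_le) (auto simp: comm)
          then show False using 2 by simp
        qed
        have "colorable E V 4"
          by (rule colorable_4_if_2K2_K4_free[OF less.prems(2) sym irrefl matching_2[OF 2(1)] K4])
        then show ?thesis using 2 chi_bound_clauses(3) by (simp add: eval_nat_numeral)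
      next
        case 3
        have "chi_bound 2 (Suc m) = (Suc m + 1) choose 2"
        proof (cases "m = 1")
          case True
          then show ?thesis using chi_bound_clauses(2) by (simp add: eval_nat_numeral)
        next
          case False
          then show ?thesis using chi_bound_clauses(4)[of "Suc m"] 3 by simp
        qed
        then show ?thesis using colorable_if_2K2_free[OF matching_2[OF 3(1)]] 3 by simp
      next
        case 4
        have K3: "\<not> E b c" if K: "{a, b, c} \<subseteq> V" "E a b" "E a c" for a b c
        proof
          assume "E b c"
          then have "length [a, b, c] \<le> Suc m"
            using K irrefl by (intro card_clique_le) (auto simp: comm)
          then show False using 4 by simp
        qed
        have 3: "E x a \<or> E x b \<or> E y a \<or> E y b \<or> E x c \<or> E x d \<or> E y c \<or> E y d \<or> E a c \<or> E a d \<or> E b c \<or> E b d"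
          if "{x, y, a, b, c, d} \<subseteq> V" "E x y" "E a b" "E c d" for x y a b c d
        proof (rule ccontr)
          assume n: "\<not> ?thesis"
          let ?W1 = "{v \<in> V. \<not> E v x \<and> \<not> E v y}"
          let ?W2 = "{v \<in> ?W1. \<not> E v a \<and> \<not> E v b}"
          have W: "a \<in> ?W1" "b \<in> ?W1" "c \<in> ?W2" "d \<in> ?W2" using that(1) n by (auto simp: comm)
          then have "has_matching E ?W2 (Suc 0)" using that(4) unfolding has_matching.simps by blast
          then have "has_matching E ?W1 (Suc (Suc 0))" using that(3) W unfolding has_matching.simps(2)[of _ _ "Suc 0"] by blast
          then have "has_matching E V (Suc (Suc (Suc 0)))"
            using that(1,2) unfolding has_matching.simps(2)[of _ _ "Suc (Suc 0)"] by blast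
          then show False using less.prems(3) 4(1) by (simp add: numeral_3_eq_3)
        qed
        have "colorable E V 4"
          by (rule colorable_4_if_3K2_K3_free[OF less.prems(2) sym irrefl 3 K3])
        then show ?thesis using 4 chi_bound_clauses(5)[of 3] by (simp add: numeral_2_eq_2)
      next
        case 5
        let ?S = "{v \<in> V. E v (vs ! 0) \<or> E v (vs ! 1)}" and ?R = "{v \<in> V. \<not> E v (vs ! 0) \<and> \<not> E v (vs ! 1)}"
        have "E (vs ! 0) (vs ! 1)" "vs ! 0 \<in> V" "vs ! 1 \<in> V" using adj[of 0 1] 5(3) vs(2,3) by auto
        then have "\<not> has_matching E ?R (p - 1)"
          using less.prems(3) 5(1) by (cases p) auto
        moreover have "finite ?R" "butterfly_free E ?R" "omega_le E ?R (Suc m)"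
          using less.prems(2) butterfly_free_subset[OF less.prems(4)] omega_le_subset[OF Suc.prems] by auto
        ultimately have "colorable E ?R (chi_bound (p - 1) (Suc m))"
          using less.IH[of "p - 1" ?R "Suc m"] 5(1) by simp
        moreover have "colorable E ?S (((Suc m + 1) choose 2) - 1)"
          using colorable_neighbours_if_butterfly_free[OF less.prems(4)] 5(3) by simp
        ultimately have "colorable E (?S \<union> ?R) (((Suc m + 1) choose 2) - 1 + chi_bound (p - 1) (Suc m))"
          by (rule colorable_Un[rotated])
        moreover have "?S \<union> ?R = V" by blast
        \<comment> \<open>For clique number 2 the summand is 3 - 1 = 2, the slope of 2p - 2. Here p
          is at least 4, since p = 3 is a case of its own, so the closed form holds for
          \<open>p - 1\<close> too.\<close>
        moreover have "((Suc m + 1) choose 2) - 1 + chi_bound (p - 1) (Suc m) \<le> chi_bound p (Suc m)"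
        proof (cases "m = 1")
          case True
          have "chi_bound p 2 = 2 * p - 2" "chi_bound (p - 1) 2 = 2 * (p - 1) - 2"
            using chi_bound_clauses(5)[of p] chi_bound_clauses(5)[of "p - 1"] 5(1,2) True by auto
          moreover have "(3 :: nat) choose 2 = 3" by (simp add: choose_two)
          ultimately show ?thesis using True 5(1,2) by (simp add: eval_nat_numeral)
        next
          case False
          \<comment> \<open>The truncated \<open>- 1\<close> stands at different places on the two
            sides; they agree because the binomial coefficient is positive.\<close>
          have "1 \<le> (Suc m + 1) choose 2" by (simp add: Suc_le_eq)
          then show ?thesis using chi_bound_clauses(6)[of "Suc m" p] False 5 by simp
        qed
        ultimately show ?thesis using colorable_mono by metis
      qed
    qed
  qed
qed

section \<open>Forbidden induced subgraphs\<close>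

text \<open>The subgraph induced on the image of \<open>f\<close> is isomorphic to \<open>F\<close>
  by the inverse of \<open>f\<close>.\<close>

lemma not_free_of:
  assumes "F \<in> \<F>" "inj_on f (pverts F)" "f ` pverts F \<subseteq> pverts G" "pair_graph G" "pair_graph F"
    and arcs: "\<And>i j. i \<in> pverts F \<Longrightarrow> j \<in> pverts F \<Longrightarrow> (i, j) \<in> parcs F \<longleftrightarrow> (f i, f j) \<in> parcs G"
  shows "\<not> free_of \<F> G"
proof -
  interpret G: pair_graph G by fact
  interpret F: pair_graph F by fact
  define H where "H = with_proj G \<restriction> f ` pverts F"
  define g where "g = the_inv_into (pverts F) f"
  have gf: "g (f i) = i" if "i \<in> pverts F" for i
    using that assms(2) by (simp add: g_def the_inv_into_f_f)
  have ind: "induced_subgraph H (with_proj G)"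
    unfolding H_def using assms(3) by (intro G.induced_induce) simp
  have in_verts: "i \<in> pverts F \<and> j \<in> pverts F" if "(i, j) \<in> parcs F" for i j
    using F.arc_fst_in_verts[OF that] F.arc_snd_in_verts[OF that] by simp
  have arcs_H: "arcs H = map_prod f f ` parcs F"
  proof (intro equalityI subsetI)
    fix e assume "e \<in> arcs H"
    then obtain i j where "i \<in> pverts F" "j \<in> pverts F" "e = (f i, f j)" "e \<in> parcs G"
      by (cases e) (auto simp: H_def)
    then have "(i, j) \<in> parcs F" "e = map_prod f f (i, j)" using arcs by auto
    then show "e \<in> map_prod f f ` parcs F" by blast
  next
    fix e assume "e \<in> map_prod f f ` parcs F"
    then obtain i j where ij: "(i, j) \<in> parcs F" "e = (f i, f j)" by auto
    then show "e \<in> arcs H" using in_verts[OF ij(1)] arcs[of i j] by (simp add: H_def)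
  qed
  \<comment> \<open>The arcs are pairs of vertices, so the map on vertices determines the map on
    arcs, and tail and head remain the projections.\<close>
  let ?h = "\<lparr>iso_verts = g, iso_arcs = map_prod g g, iso_head = snd, iso_tail = fst\<rparr>"
  have inj: "inj_on g (f ` pverts F)" using gf by (auto intro: inj_onI)
  have inj': "inj_on (map_prod g g) (arcs H)"
    by (rule inj_on_subset[OF map_prod_inj_on[OF inj inj]]) (auto simp: H_def)
  have "pre_digraph.digraph_isomorphism H ?h"
    unfolding pre_digraph.digraph_isomorphism_def using inj inj'
    by (auto simp: H_def intro: G.wellformed_induce_subgraph)
  moreover have "with_proj F = app_iso ?h H"
  proof -
    have "g ` f ` pverts F = pverts F" by (simp add: image_image gf)
    moreover have "map_prod g g (map_prod f f e) = e" if "e \<in> parcs F" for e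
      using that in_verts gf by (cases e) auto
    then have "map_prod g g ` map_prod f f ` parcs F = parcs F" by (simp add: image_image)
    ultimately show ?thesis unfolding app_iso_def arcs_H by (simp add: H_def with_proj_def)
  qed
  ultimately have "digraph_iso H (with_proj F)" unfolding digraph_iso_def by blast
  with ind assms(1) show ?thesis unfolding free_of_def by blast
qed

text \<open>Vertices 2k and 2k + 1 form the k-th edge, as in \<open>matching_graph\<close>, so lying
  in the same edge is equality of \<open>div 2\<close>.\<close>

lemma has_matching_imp_indexed:
  assumes "has_matching E V p" and sym: "\<And>u v. E u v \<Longrightarrow> E v u"
  shows "\<exists>f :: nat \<Rightarrow> 'a. f ` {..<2 * p} \<subseteq> V \<and>
    (\<forall>i<2 * p. \<forall>j<2 * p. i \<noteq> j \<longrightarrow> (E (f i) (f j) \<longleftrightarrow> i div 2 = j div 2))"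
  using assms(1)
proof (induction p arbitrary: V)
  case (Suc p)
  let ?W = "\<lambda>x y. {v \<in> V. \<not> E v x \<and> \<not> E v y}"
  obtain x y where xy: "x \<in> V" "y \<in> V" "E x y" "has_matching E (?W x y) p"
    using Suc.prems by auto
  obtain g :: "nat \<Rightarrow> 'a" where g: "g ` {..<2 * p} \<subseteq> ?W x y"
    "\<And>i j. i < 2 * p \<Longrightarrow> j < 2 * p \<Longrightarrow> i \<noteq> j \<Longrightarrow> E (g i) (g j) \<longleftrightarrow> i div 2 = j div 2"
    using Suc.IH[OF xy(4)] by blast
  \<comment> \<open>The new edge takes the indices 0 and 1; shifting the others by two respects the
    pairing.\<close>
  define f where "f = case_nat x (case_nat y g)"
  have f: "f 0 = x" "f (Suc 0) = y" "f (Suc (Suc i)) = g i" for i by (simp_all add: f_def)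
  have idx: "i = 0 \<or> i = Suc 0 \<or> (\<exists>k<2 * p. i = Suc (Suc k))" if "i < 2 * Suc p" for i
    using that by (cases i; cases "i - 1") auto
  have gW: "g k \<in> V" "\<not> E (g k) x" "\<not> E (g k) y" "\<not> E x (g k)" "\<not> E y (g k)" if "k < 2 * p" for k
    using g(1) that sym by blast+
  show ?case
  proof (intro exI[of _ f] conjI allI impI)
    show "f ` {..<2 * Suc p} \<subseteq> V"
    proof (rule image_subsetI)
      fix i assume "i \<in> {..<2 * Suc p}"
      then show "f i \<in> V" using idx[of i] xy(1,2) gW(1) by (auto simp: f)
    qed
    fix i j assume "i < 2 * Suc p" "j < 2 * Suc p" "i \<noteq> j"
    then show "E (f i) (f j) \<longleftrightarrow> i div 2 = j div 2"
      using idx[of i] idx[of j] xy(3) sym[OF xy(3)] gW g(2) by (auto simp: f)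
  qed
qed simp

lemma matching_graph_simps:
  "pverts (matching_graph p) = {..<2 * p}"
  "(i, j) \<in> parcs (matching_graph p) \<longleftrightarrow> i < 2 * p \<and> j < 2 * p \<and> i \<noteq> j \<and> i div 2 = j div 2"
proof -
  show "(i, j) \<in> parcs (matching_graph p) \<longleftrightarrow> i < 2 * p \<and> j < 2 * p \<and> i \<noteq> j \<and> i div 2 = j div 2"
  proof
    assume R: "i < 2 * p \<and> j < 2 * p \<and> i \<noteq> j \<and> i div 2 = j div 2"
    then have "i div 2 < p" "i = 2 * (i div 2) \<and> j = 2 * (i div 2) + 1 \<or> i = 2 * (i div 2) + 1 \<and> j = 2 * (i div 2)"
      by presburger+
    then show "(i, j) \<in> parcs (matching_graph p)"
      unfolding matching_graph_def by (auto intro!: bexI[of _ "i div 2"])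
  qed (auto simp: matching_graph_def)
qed (simp add: matching_graph_def)

theorem theorem3p8:
  fixes G :: "'a pair_pre_digraph" and p :: nat
  assumes "p \<ge> 2"
    and "pair_graph G"
    and "free_of {matching_graph p, butterfly} G"
  shows "chromatic_number G \<le> chi_bound p (clique_number G)"
proof -
  interpret G: pair_graph G by (rule assms(2))
  define E where "E u v \<longleftrightarrow> (u, v) \<in> parcs G" for u v
  have sym: "E v u" if "E u v" for u v
    using that G.arcs_symmetric by (auto simp: E_def)
  have irrefl: "\<not> E v v" for v using G.pair_no_loops[of "(v, v)"] by (auto simp: E_def)
  have matching: "\<not> has_matching E (pverts G) p"
  proof
    assume "has_matching E (pverts G) p"
    then obtain f :: "nat \<Rightarrow> 'a" where f: "f ` {..<2 * p} \<subseteq> pverts G"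
      "\<And>i j. i < 2 * p \<Longrightarrow> j < 2 * p \<Longrightarrow> i \<noteq> j \<Longrightarrow> E (f i) (f j) \<longleftrightarrow> i div 2 = j div 2"
      using has_matching_imp_indexed[of E "pverts G" p, OF _ sym] by blast
    have "inj_on f {..<2 * p}"
    proof (rule inj_onI, rule ccontr)
      fix i j assume ij: "i \<in> {..<2 * p}" "j \<in> {..<2 * p}" "f i = f j" "i \<noteq> j"
      \<comment> \<open>\<open>k\<close> is the partner of \<open>i\<close>. The vertex
        \<open>f j = f i\<close> is adjacent to \<open>f k\<close>, but \<open>j\<close> lies in
        another edge than \<open>k\<close>.\<close>
      define k where "k = (if even i then i + 1 else i - 1)"
      have k: "k < 2 * p" "k \<noteq> i" "k div 2 = i div 2" "j \<noteq> k \<Longrightarrow> j div 2 \<noteq> k div 2"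
        using ij unfolding k_def by (auto; presburger)+
      have "E (f i) (f k)" using f(2)[of i k] k ij by simp
      moreover have "j \<noteq> k" using calculation ij(3) irrefl by auto
      ultimately show False using f(2)[of j k] k ij by simp
    qed
    then have "\<not> free_of {matching_graph p, butterfly} G"
      using f irrefl assms(2) pair_graph_matching_graph
      by (intro not_free_of[of "matching_graph p" _ f]) (auto simp: matching_graph_simps E_def)
    then show False using assms(3) by simp
  qed
  have butterfly: "butterfly_free E (pverts G)"
    unfolding butterfly_free_def
  proof (intro allI impI, rule ccontr)
    fix v a b c d
    assume *: "{v, a, b, c, d} \<subseteq> pverts G \<and> E v a \<and> E v b \<and> E v c \<and> E v d \<and> E a b \<and> E c d"
      and n: "\<not> (E a c \<or> E a d \<or> E b c \<or> E b d)"
    define f where "f = (!) [v, a, b, c, d]"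
    have f: "f 0 = v" "f (Suc 0) = a" "f 2 = b" "f 3 = c" "f 4 = d" by (simp_all add: f_def)
    have s: "E a v" "E b v" "E c v" "E d v" "E b a" "E d c" "\<not> E c a" "\<not> E d a" "\<not> E c b" "\<not> E d b"
      using * n sym by blast+
    have P: "pverts butterfly = {0, 1, 2, 3, 4}" by (simp add: butterfly_def Let_def)
    have "distinct [v, a, b, c, d]" using * n s irrefl by auto
    then have "inj_on f (pverts butterfly)" unfolding P by (auto simp: inj_on_def f)
    moreover have "\<forall>i\<in>pverts butterfly. \<forall>j\<in>pverts butterfly. (i, j) \<in> parcs butterfly \<longleftrightarrow> E (f i) (f j)"
      unfolding P using * n s irrefl by (simp add: butterfly_def Let_def f)
    moreover have "f ` pverts butterfly \<subseteq> pverts G" unfolding P using * by (auto simp: f)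
    ultimately have "\<not> free_of {matching_graph p, butterfly} G"
      using assms(2) pair_graph_butterfly by (intro not_free_of[of butterfly _ f]) (auto simp: E_def)
    then show False using assms(3) by simp
  qed
  \<comment> \<open>Finiteness makes \<open>Max\<close> an upper bound for the sizes of
    cliques.\<close>
  have "finite {card K |K. clique G K}"
  proof (rule finite_subset)
    show "{card K |K. clique G K} \<subseteq> card ` Pow (pverts G)" by (auto simp: clique_def)
  qed simp
  then have "omega_le E (pverts G) (clique_number G)"
    unfolding omega_le_def clique_number_def E_def
    by (auto intro!: Max_ge simp: clique_def)
  then have "colorable E (pverts G) (chi_bound p (clique_number G))"
    using colorable_chi_bound[OF assms(1) sym irrefl _ matching butterfly] by simp
  then obtain c where "c ` pverts G \<subseteq> {..<chi_bound p (clique_number G)}"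
    "\<forall>u\<in>pverts G. \<forall>v\<in>pverts G. E u v \<longrightarrow> c u \<noteq> c v"
    unfolding colorable_def by blast
  then have "proper_coloring G (chi_bound p (clique_number G)) c"
    using G.arc_fst_in_verts G.arc_snd_in_verts unfolding proper_coloring_def E_def by force
  then show ?thesis unfolding chromatic_number_def by (blast intro: Least_le)
qed

end
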